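(* Let $(X,\sigma_X)$ be an irreducible (one-step) shift of finite type, $(Y,\sigma_Y)$ a subshift, $\pi:X\to Y$ a one-block factor map and $f\in C(X)$. Let $g_n$ $(n\in\mathbb N)$ be the functions on $Y$ associated to $f$ and $\pi$ as defined in the context, and $\mathcal G=\{\log g_n\}_{n=1}^\infty$. Then for $h\in C(Y)$ the following statements are equivalent. (i) $P(\sigma_X,\pi,f-h\circ\pi)(y)=0$ for every periodic point $y\in Y$; equivalently, $\lim_{n\to\infty}\frac1n\log\left(\frac{g_n(y)}{e^{(S_nh)(y)}}\right)=0$ for every periodic point $y\in Y$. (ii) The function $f-h\circ\pi$ is a compensation function for $\pi$. (iii) $\lim_{n\to\infty}\frac1n\log\left(\frac{g_n(y)}{e^{(S_nh)(y)}}\right)=0$ for every $y\in Y$. (iv) The sequence $\mathcal G$ is asymptotically additive on $Y$ and satisfies $\lim_{n\to\infty}\frac1n\left\lVert\log\left(\frac{g_n}{e^{S_nh}}\right)\right\rVert_\infty=0$. (v) $\int P(\sigma_X,\pi,f)\,dm=\int h\,dm$ for all $m\in M(Y,\sigma_Y)$.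
   Context: $\mathbb N=\{1,2,\dots\}$. A (one-sided) subshift $(X,\sigma_X)$ is a closed set $X\subseteq\{1,\dots,k\}^{\mathbb N}$ (some $k\ge1$) with $\sigma_X(X)\subseteq X$, where $(\sigma_Xx)_i=x_{i+1}$. The metric is $d(x,x')=2^{-k}$ if $x_i=x_i'$ for $1\le i\le k$ and $x_{k+1}\ne x'_{k+1}$, $d(x,x')=1$ if $x_1\neq x_1'$, and $d(x,x)=0$. $B_n(X)$ is the set of words of length $n$ appearing in points of $X$, $B_0(X)=\{\epsilon\}$ (empty word), $B(X)=\bigcup_{n\ge0}B_n(X)$. The cylinder $[x_1\dots x_n]$ is the set of $z\in X$ with $z_i=x_i$ for $1\le i\le n$. $X$ is irreducible if for all $u,v\in B(X)$ there is $w\in B(X)$ with $uwv\in B(X)$. Shifts of finite type are one-step: $X$ is the set of all sequences in $\{1,\dots,k\}^{\mathbb N}$ in which no word of a given set of forbidden blocks of length $\le2$ appears. $x$ is periodic if $\sigma_X^lx=x$ for some $l\in\mathbb N$. $M(X,\sigma_X)$ is the set of $\sigma_X$-invariant Borel probability measures; $h_\mu(\sigma_X)$ is measure-theoretic entropy; $C(X)$ is the set of real continuous functions on $X$; $(S_nf)(x)=\sum_{i=0}^{n-1}f(\sigma_X^ix)$. A factor map $\pi:X\to Y$ is a continuous surjection with $\pi\circ\sigma_X=\sigma_Y\circ\pi$; it is one-block if $\pi(x)_i$ depends only on $x_i$, so $\pi$ acts on words. Relative pressure: for $f\in C(X)$, $n\in\mathbb N$, $\delta>0$, $y\in Y$,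 let $P_n(\sigma_X,\pi,f,\delta)(y)=\sup\{\sum_{x\in E}e^{(S_nf)(x)}: E\text{ is an }(n,\delta)\text{-separated subset of }\pi^{-1}(\{y\})\}$, $P(\sigma_X,\pi,f,\delta)(y)=\limsup_{n\to\infty}\frac1n\log P_n(\sigma_X,\pi,f,\delta)(y)$, and $P(\sigma_X,\pi,f)(y)=\lim_{\delta\to0}P(\sigma_X,\pi,f,\delta)(y)$. The functions $g_n$: for $y\in Y$ let $E_n(y)$ denote a set consisting of exactly one point from each cylinder $[x_1\dots x_n]$ in $X$ such that $\pi(x_1\dots x_n)=y_1\dots y_n$; set $g_n(y)=\sup_{E_n(y)}\sum_{x\in E_n(y)}e^{(S_nf)(x)}$, the supremum over all such choices $E_n(y)$. $F\in C(X)$ is a compensation function for $\pi$ if $\sup_{\mu\in M(X,\sigma_X)}\{h_\mu(\sigma_X)+\int F\,d\mu+\int\phi\circ\pi\,d\mu\}=\sup_{\nu\in M(Y,\sigma_Y)}\{h_\nu(\sigma_Y)+\int\phi\,d\nu\}$ for every $\phi\in C(Y)$. A sequence $\{\log f_n\}_{n=1}^\infty$ with $f_n:Y\to(0,\infty)$ continuous is asymptotically additive on $Y$ if for every $\epsilon>0$ there is a continuous function $\rho_\epsilon$ on $Y$ with $\limsup_{n\to\infty}\frac1n\lVert\log f_n-S_n\rho_\epsilon\rVert_\infty<\epsilon$ (supremum norm). *)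

theory Defs
  imports "HOL-Probability.Probability"
begin

text \<open>
  A one-sided sequence $x_1 x_2 \ldots$ is a function \<open>x :: nat \<Rightarrow> nat\<close> whose value \<open>x i\<close> is the
  mathematical $x_{i+1}$; the symbols of the alphabet are $1, \ldots, k$. Open, closed, continuous
  and Borel refer to the library topology on \<open>nat \<Rightarrow> nat\<close>, which is the product of the discrete
  topologies. Lemma \<open>open_iff_shift_dist\<close> below shows that it is the topology of the metric
  \<open>shift_dist\<close>. (The library's own \<open>dist\<close> on this type is another metric and is not used.)
\<close>

type_synonym point = "nat \<Rightarrow> nat"

definition shift :: "point \<Rightarrow> point" where
  "shift x = (\<lambda>i. x (Suc i))"

definition shift_dist :: "point \<Rightarrow> point \<Rightarrow> real" where
  "shift_dist x y = (if x = y then 0 else (1/2) ^ (LEAST i. x i \<noteq> y i))"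

lemma shift_dist_le_iff: "shift_dist x y \<le> (1/2) ^ n \<longleftrightarrow> (\<forall>i<n. x i = y i)"
proof (cases "x = y")
  case True
  then show ?thesis by (simp add: shift_dist_def)
next
  case False
  then obtain j where j: "x j \<noteq> y j" by auto
  let ?l = "LEAST i. x i \<noteq> y i"
  have l: "x ?l \<noteq> y ?l" using j by (rule LeastI)
  have "shift_dist x y \<le> (1/2) ^ n \<longleftrightarrow> n \<le> ?l"
    using False by (simp add: shift_dist_def power_decreasing_iff)
  also have "\<dots> \<longleftrightarrow> (\<forall>i<n. x i = y i)"
  proof
    assume le: "n \<le> ?l"
    show "\<forall>i<n. x i = y i"
    proof (intro allI impI)
      fix i assume "i < n"
      then have "i < ?l" using le by (rule less_le_trans)
      then show "x i = y i" using not_less_Least[of i "\<lambda>i. x i \<noteq> y i"] by blast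
    qed
  next
    assume "\<forall>i<n. x i = y i"
    then have "\<not> ?l < n" using l by blast
    then show "n \<le> ?l" by simp
  qed
  finally show ?thesis .
qed

lemma open_iff_shift_dist:
  "open U \<longleftrightarrow> (\<forall>x\<in>U. \<exists>e>0. \<forall>y. shift_dist x y < e \<longrightarrow> y \<in> U)"
proof
  assume U: "open U"
  show "\<forall>x\<in>U. \<exists>e>0. \<forall>y. shift_dist x y < e \<longrightarrow> y \<in> U"
  proof
    fix x assume "x \<in> U"
    then obtain V :: "nat \<Rightarrow> nat set" where V: "x \<in> (\<Pi>\<^sub>E i\<in>UNIV. V i)"
        "finite {i. V i \<noteq> UNIV}" "(\<Pi>\<^sub>E i\<in>UNIV. V i) \<subseteq> U"
      using product_topology_open_contains_basis[of "\<lambda>i. euclidean" UNIV U x] U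
      unfolding open_fun_def by auto
    obtain n where n: "{i. V i \<noteq> UNIV} \<subseteq> {..<n}"
      using finite_nat_iff_bounded V(2) by blast
    have "y \<in> U" if "shift_dist x y < (1/2) ^ n" for y
    proof -
      have "x i = y i" if "i < n" for i
        using \<open>shift_dist x y < (1/2) ^ n\<close> shift_dist_le_iff[of x y n] that by simp
      then have *: "x i = y i" if "i < n" for i using that .
      have "y i \<in> V i" for i
      proof (cases "i < n")
        case True
        have "x i \<in> V i" using V(1) by (simp add: PiE_iff)
        then show ?thesis using *[OF True] by simp
      next
        case False
        then have "V i = UNIV" using n by auto
        then show ?thesis by simp
      qed
      then show ?thesis using V(3) by (auto simp: PiE_iff)
    qed
    then show "\<exists>e>0. \<forall>y. shift_dist x y < e \<longrightarrow> y \<in> U"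
      by (intro exI[of _ "(1/2) ^ n"]) auto
  qed
next
  assume U: "\<forall>x\<in>U. \<exists>e>0. \<forall>y. shift_dist x y < e \<longrightarrow> y \<in> U"
  show "open U"
  proof (subst open_subopen, intro ballI)
    fix x assume "x \<in> U"
    then obtain e where e: "e > 0" "\<forall>y. shift_dist x y < e \<longrightarrow> y \<in> U" using U by blast
    obtain n where n: "(1/2::real) ^ n < e" using real_arch_pow_inv[of e "1/2"] e(1) by auto
    let ?T = "{y. \<forall>i\<in>{..<n}. y i \<in> {x i}}"
    have "open ?T" by (rule product_topology_basis') (auto intro: Topological_Spaces.open_discrete)
    moreover have "y \<in> U" if "y \<in> ?T" for y
    proof -
      have "shift_dist x y \<le> (1/2) ^ n" using that by (simp add: shift_dist_le_iff)
      then show ?thesis using e(2) n by simp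
    qed
    ultimately show "\<exists>T. open T \<and> x \<in> T \<and> T \<subseteq> U" by (intro exI[of _ ?T]) auto
  qed
qed


section \<open>Subshifts, shifts of finite type, factor maps\<close>

definition subshift :: "point set \<Rightarrow> bool" where
  "subshift X \<longleftrightarrow>
     (\<exists>k\<ge>1. \<forall>x\<in>X. \<forall>i. x i \<in> {1..k}) \<and> closed X \<and> shift ` X \<subseteq> X"

definition prefix :: "nat \<Rightarrow> point \<Rightarrow> nat list" where
  "prefix n x = map x [0..<n]"

definition occurs :: "nat list \<Rightarrow> point \<Rightarrow> bool" where
  "occurs w x \<longleftrightarrow> (\<exists>m. w = map x [m..<m + length w])"

text \<open>The empty word belongs to the language by convention, also for empty \<open>X\<close>.\<close>

definition lang :: "point set \<Rightarrow> nat list set" where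
  "lang X = insert [] {w. \<exists>x\<in>X. occurs w x}"

definition words :: "nat \<Rightarrow> point set \<Rightarrow> nat list set" where
  "words n X = {w \<in> lang X. length w = n}"

definition cylinder :: "point set \<Rightarrow> nat list \<Rightarrow> point set" where
  "cylinder X w = {z \<in> X. prefix (length w) z = w}"

definition irreducible_shift :: "point set \<Rightarrow> bool" where
  "irreducible_shift X \<longleftrightarrow>
     (\<forall>u\<in>lang X. \<forall>v\<in>lang X. \<exists>w\<in>lang X. u @ w @ v \<in> lang X)"

definition one_step_SFT :: "point set \<Rightarrow> bool" where
  "one_step_SFT X \<longleftrightarrow>
     (\<exists>k\<ge>1. \<exists>F. (\<forall>w\<in>F. set w \<subseteq> {1..k} \<and> length w \<le> 2) \<and>
        X = {x. (\<forall>i. x i \<in> {1..k}) \<and> (\<forall>w\<in>F. \<not> occurs w x)})"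

definition factor_map :: "point set \<Rightarrow> point set \<Rightarrow> (point \<Rightarrow> point) \<Rightarrow> bool" where
  "factor_map X Y \<pi> \<longleftrightarrow>
     continuous_on X \<pi> \<and> \<pi> ` X = Y \<and> (\<forall>x\<in>X. \<pi> (shift x) = shift (\<pi> x))"

text \<open>The symbol map \<open>\<Phi>\<close> that induces \<open>\<pi>\<close>; \<open>\<pi>\<close> acts on words by \<open>map \<Phi>\<close>.\<close>

definition one_block :: "point set \<Rightarrow> (point \<Rightarrow> point) \<Rightarrow> (nat \<Rightarrow> nat) \<Rightarrow> bool" where
  "one_block X \<pi> \<Phi> \<longleftrightarrow> (\<forall>x\<in>X. \<forall>i. \<pi> x i = \<Phi> (x i))"

definition periodic :: "point \<Rightarrow> bool" where
  "periodic x \<longleftrightarrow> (\<exists>l\<ge>1. (shift ^^ l) x = x)"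

definition birkhoff_sum :: "nat \<Rightarrow> (point \<Rightarrow> real) \<Rightarrow> point \<Rightarrow> real" where
  "birkhoff_sum n f x = (\<Sum>i<n. f ((shift ^^ i) x))"


section \<open>Relative pressure and the functions $g_n$\<close>

definition separated :: "nat \<Rightarrow> real \<Rightarrow> point set \<Rightarrow> bool" where
  "separated n \<delta> E \<longleftrightarrow>
     (\<forall>x\<in>E. \<forall>x'\<in>E. x \<noteq> x' \<longrightarrow> (\<exists>i<n. shift_dist ((shift ^^ i) x) ((shift ^^ i) x') > \<delta>))"

text \<open>
  On a subshift with \<open>y \<in> \<pi> ` X\<close>, \<open>f\<close> continuous and \<open>\<delta> > 0\<close>, the separated sets are finite and
  the sums form a nonempty bounded set of reals, so the real-valued sums and suprema here and in
  \<open>g_fun\<close> are the mathematical ones.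
\<close>

definition rel_pressure_n ::
  "point set \<Rightarrow> (point \<Rightarrow> point) \<Rightarrow> (point \<Rightarrow> real) \<Rightarrow> nat \<Rightarrow> real \<Rightarrow> point \<Rightarrow> real" where
  "rel_pressure_n X \<pi> f n \<delta> y =
     (SUP E \<in> {E. E \<subseteq> {x\<in>X. \<pi> x = y} \<and> separated n \<delta> E}. \<Sum>x\<in>E. exp (birkhoff_sum n f x))"

definition rel_pressure_delta ::
  "point set \<Rightarrow> (point \<Rightarrow> point) \<Rightarrow> (point \<Rightarrow> real) \<Rightarrow> real \<Rightarrow> point \<Rightarrow> ereal" where
  "rel_pressure_delta X \<pi> f \<delta> y =
     limsup (\<lambda>n. ereal (ln (rel_pressure_n X \<pi> f n \<delta> y) / real n))"

definition rel_pressure ::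
  "point set \<Rightarrow> (point \<Rightarrow> point) \<Rightarrow> (point \<Rightarrow> real) \<Rightarrow> point \<Rightarrow> ereal" where
  "rel_pressure X \<pi> f y = Lim (at_right 0) (\<lambda>\<delta>. rel_pressure_delta X \<pi> f \<delta> y)"

definition fibre_words :: "point set \<Rightarrow> (nat \<Rightarrow> nat) \<Rightarrow> nat \<Rightarrow> point \<Rightarrow> nat list set" where
  "fibre_words X \<Phi> n y = {w \<in> words n X. map \<Phi> w = prefix n y}"

text \<open>The possible choices of the set $E_n(y)$.\<close>

definition cylinder_choices ::
  "point set \<Rightarrow> (nat \<Rightarrow> nat) \<Rightarrow> nat \<Rightarrow> point \<Rightarrow> point set set" where
  "cylinder_choices X \<Phi> n y =
     {E. E \<subseteq> (\<Union>w\<in>fibre_words X \<Phi> n y. cylinder X w) \<and>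
         (\<forall>w\<in>fibre_words X \<Phi> n y. \<exists>!x. x \<in> E \<inter> cylinder X w)}"

definition g_fun ::
  "point set \<Rightarrow> (nat \<Rightarrow> nat) \<Rightarrow> (point \<Rightarrow> real) \<Rightarrow> nat \<Rightarrow> point \<Rightarrow> real" where
  "g_fun X \<Phi> f n y =
     (SUP E \<in> cylinder_choices X \<Phi> n y. \<Sum>x\<in>E. exp (birkhoff_sum n f x))"


section \<open>Invariant measures, entropy, compensation functions\<close>

definition invariant_measures :: "point set \<Rightarrow> point measure set" where
  "invariant_measures X =
     {\<mu>. prob_space \<mu> \<and> sets \<mu> = sets (restrict_space borel X) \<and> distr \<mu> \<mu> shift = \<mu>}"

definition finite_partition :: "'a measure \<Rightarrow> 'a set set \<Rightarrow> bool" where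
  "finite_partition \<mu> P \<longleftrightarrow> finite P \<and> P \<subseteq> sets \<mu> \<and> partition_on (space \<mu>) P"

definition partition_entropy :: "'a measure \<Rightarrow> 'a set set \<Rightarrow> real" where
  "partition_entropy \<mu> P = - (\<Sum>A\<in>P. measure \<mu> A * ln (measure \<mu> A))"

text \<open>The nonempty atoms of the join of \<open>T\<^sup>-\<^sup>i P\<close> for $0 \le i < n$.\<close>

definition iterated_join :: "'a measure \<Rightarrow> ('a \<Rightarrow> 'a) \<Rightarrow> 'a set set \<Rightarrow> nat \<Rightarrow> 'a set set" where
  "iterated_join \<mu> T P n =
     {{x \<in> space \<mu>. \<forall>i<n. (T ^^ i) x \<in> c i} | c. \<forall>i<n. c i \<in> P} - {{}}"

definition measure_entropy :: "'a measure \<Rightarrow> ('a \<Rightarrow> 'a) \<Rightarrow> ereal" where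
  "measure_entropy \<mu> T =
     (SUP P \<in> {P. finite_partition \<mu> P}.
        ereal (lim (\<lambda>n. partition_entropy \<mu> (iterated_join \<mu> T P n) / real n)))"

definition compensation_function ::
  "point set \<Rightarrow> point set \<Rightarrow> (point \<Rightarrow> point) \<Rightarrow> (point \<Rightarrow> real) \<Rightarrow> bool" where
  "compensation_function X Y \<pi> F \<longleftrightarrow>
     continuous_on X F \<and>
     (\<forall>\<phi>. continuous_on Y \<phi> \<longrightarrow>
        (SUP \<mu> \<in> invariant_measures X.
           measure_entropy \<mu> shift + ereal (\<integral>x. F x \<partial>\<mu>) + ereal (\<integral>x. \<phi> (\<pi> x) \<partial>\<mu>)) =
        (SUP \<nu> \<in> invariant_measures Y.
           measure_entropy \<nu> shift + ereal (\<integral>y. \<phi> y \<partial>\<nu>)))"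


section \<open>Asymptotic additivity\<close>

text \<open>The inserted \<open>0\<close> only makes the norm on the empty set equal to \<open>0\<close>.\<close>

definition sup_norm :: "'a set \<Rightarrow> ('a \<Rightarrow> real) \<Rightarrow> ereal" where
  "sup_norm Y u = Sup (insert 0 ((\<lambda>y. ereal \<bar>u y\<bar>) ` Y))"

text \<open>The argument \<open>F\<close> is the sequence $f_n$ of positive functions, not the sequence $\log f_n$.\<close>

definition log_asymptotically_additive ::
  "point set \<Rightarrow> (nat \<Rightarrow> point \<Rightarrow> real) \<Rightarrow> bool" where
  "log_asymptotically_additive Y F \<longleftrightarrow>
     (\<forall>n\<ge>1. continuous_on Y (F n) \<and> (\<forall>y\<in>Y. F n y > 0)) \<and>
     (\<forall>\<epsilon>>0. \<exists>\<rho>. continuous_on Y \<rho> \<and>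
        limsup (\<lambda>n. ereal (1 / real n) *
          sup_norm Y (\<lambda>y. ln (F n y) - birkhoff_sum n \<rho> y)) < ereal \<epsilon>)"

end

theory Submission
  imports Defs
begin

text \<open>
  Write $A_n = \log g_n - S_n h$. Cutting words into pieces makes $g_n$ submultiplicative along orbits,
  and adding to \<open>f\<close> a potential lifted from \<open>Y\<close> changes $\log g_n$ by the Birkhoff sum of that
  potential, up to an error that is $o(n)$ uniformly in \<open>y\<close> (lemma \<open>ln_g_lift\<close>). Hence nearly
  everything is about the single potential $f - h \circ \pi$. The pivot of the proof is the property
  that $A_n$ is $o(n)$ uniformly on \<open>Y\<close> (\<open>sublinear\<close>). It implies (iii) and (iv), which in turn
  imply (i), and it is equivalent to each of the five conditions.

  From periodic points to all points. In an irreducible shift of finite type, the words with a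
  prescribed pair of end symbols can be concatenated freely once a fixed connecting word is inserted.
  So every word \<open>u\<close> of \<open>Y\<close> begins a periodic point whose period exceeds the length of \<open>u\<close> by a
  bounded amount and over which the weights grow at least at the rate suggested by \<open>u\<close>
  (\<open>periodic_approximation\<close>). If the rates over periodic points vanish, $A_n$ cannot be large at \<open>u\<close>.
  It cannot be very negative either, for by subadditivity the value of $A_n$ over one period bounds
  the rate of the periodic point from above. This is \<open>sublinear_of_periodic\<close>, the step from (i)
  to (iv).

  The relative pressure at \<open>y\<close> is the growth rate of the weights of those words over \<open>y\<close> that continue
  to a full preimage of \<open>y\<close> (\<open>rel_pressure_eq\<close>), whereas $g_n$ counts all words over $y_1 \dots y_n$.
  By compactness a word that continues over \<open>y\<close> for a long time continues forever. Cutting long words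
  into blocks, each of which visibly continues, shows that the two growth rates agree at periodic
  points (\<open>rel_pressure_periodic\<close>, the two forms of (i)) and after integration
  (\<open>integral_fibre_sum_ge\<close>). The reverse Fatou lemma and a maximal ergodic inequality then give (v)
  (\<open>integral_rel_pressure\<close>); conversely, (v) for the invariant measures on periodic orbits is (i).

  For (ii), the variational principle (\<open>variational_principle\<close>) is proved for every factor of an
  irreducible shift of finite type, thus for \<open>Y\<close> and, with the identity map, for \<open>X\<close>. The upper bound is
  Gibbs' inequality on words together with the fact that the symbols generate; the lower bound comes
  from random concatenations of freely concatenable words. It turns (ii) into the equality of the
  pressures of $f - h \circ \pi + \phi \circ \pi$ and of $\phi$ for all $\phi$ (\<open>compensation_iff\<close>).
  If $A_n$ is uniformly $o(n)$, the partition sums that define the two pressures agree up to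
  $e^{o(n)}$. Conversely, a potential $\phi$ that vanishes on a periodic orbit and is hugely negative
  away from it reduces the first pressure to the rate of $A_n$ over the orbit and the second one
  to \<open>0\<close> (\<open>rate_zero_of_pressures\<close>).
\<close>


section \<open>Coordinates, words and Birkhoff sums\<close>

lemma funpow_shift: "(shift ^^ n) x = (\<lambda>i. x (i + n))"
proof (induction n)
  case (Suc n)
  then show ?case by (simp add: shift_def)
qed simp

lemma length_prefix [simp]: "length (prefix n x) = n"
  by (simp add: prefix_def)

lemma nth_prefix [simp]: "i < n \<Longrightarrow> prefix n x ! i = x i"
  by (simp add: prefix_def)

lemma prefix_eq_iff: "prefix n x = prefix n y \<longleftrightarrow> (\<forall>i<n. x i = y i)"
  by (auto simp: list_eq_iff_nth_eq)

lemma prefix_0 [simp]: "prefix 0 x = []"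
  by (simp add: prefix_def)

lemma prefix_add: "prefix (m + n) x = prefix m x @ prefix n ((shift ^^ m) x)"
  by (rule nth_equalityI) (auto simp: nth_append funpow_shift)

lemma take_prefix: "take m (prefix (m + n) x) = prefix m x"
  by (simp add: prefix_add)

lemma drop_prefix: "drop m (prefix (m + n) x) = prefix n ((shift ^^ m) x)"
  by (simp add: prefix_add)

lemma prefix_mono_eq: "prefix n x = prefix n y \<Longrightarrow> m \<le> n \<Longrightarrow> prefix m x = prefix m y"
  by (auto simp: prefix_eq_iff)

lemma birkhoff_sum_add:
  "birkhoff_sum (m + n) f x = birkhoff_sum m f x + birkhoff_sum n f ((shift ^^ m) x)"
proof (induction n)
  case (Suc n)
  have "(shift ^^ (m + n)) x = (shift ^^ n) ((shift ^^ m) x)"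
    by (simp add: funpow_shift ac_simps)
  with Suc show ?case by (simp add: birkhoff_sum_def)
qed (simp add: birkhoff_sum_def)

lemma birkhoff_sum_mult:
  "birkhoff_sum (k * p) f x = (\<Sum>j<k. birkhoff_sum p f ((shift ^^ (j * p)) x))"
proof (induction k)
  case (Suc k)
  have "birkhoff_sum (Suc k * p) f x = birkhoff_sum (k * p + p) f x"
    by (simp add: add.commute)
  with Suc show ?case unfolding birkhoff_sum_add by simp
qed (simp add: birkhoff_sum_def)

lemma birkhoff_sum_0 [simp]: "birkhoff_sum 0 f x = 0"
  by (simp add: birkhoff_sum_def)

lemma continuous_on_coordinate: "continuous_on S (\<lambda>x::point. x i)"
  using continuous_on_product_coordinates[of i] continuous_on_subset by blast

lemma continuous_on_shift: "continuous_on S shift"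
  unfolding shift_def by (rule continuous_on_coordinatewise_then_product) (rule continuous_on_coordinate)

lemma open_coordinate: "open {x::point. x i \<in> A}"
  using open_vimage[OF Topological_Spaces.open_discrete[of A] continuous_on_coordinate[of UNIV i]]
  by (simp add: vimage_def)

lemma open_contains_agree:
  assumes "open U" "x \<in> U"
  obtains N where "\<And>z. prefix N z = prefix N x \<Longrightarrow> z \<in> U"
proof -
  obtain e where e: "e > 0" "\<And>z. shift_dist x z < e \<Longrightarrow> z \<in> U"
    using assms open_iff_shift_dist by meson
  obtain N where N: "(1/2::real) ^ N < e" using real_arch_pow_inv[of e "1/2"] e(1) by auto
  have "z \<in> U" if "prefix N z = prefix N x" for z
  proof (rule e(2))
    have "shift_dist x z \<le> (1/2) ^ N" using that by (simp add: shift_dist_le_iff prefix_eq_iff)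
    then show "shift_dist x z < e" using N by simp
  qed
  then show ?thesis by (rule that)
qed

lemma open_agree: "open {z::point. prefix n z = w}"
proof (cases "length w = n")
  case True
  have "{z::point. prefix n z = w} = (\<Inter>i\<in>{..<n}. {z. z i \<in> {w ! i}})"
    using True by (auto simp: list_eq_iff_nth_eq)
  moreover have "open (\<Inter>i\<in>{..<n}. {z::point. z i \<in> {w ! i}})"
    by (rule open_INT) (use open_coordinate in blast)+
  ultimately show ?thesis by metis
next
  case False
  then have "{z::point. prefix n z = w} = {}" by auto
  then show ?thesis by simp
qed

lemma closed_agree: "closed {z::point. prefix n z = w}"
proof (cases "length w = n")
  case True
  have "- {z::point. prefix n z = w} = (\<Union>i\<in>{..<n}. {z. z i \<in> - {w ! i}})"
    using True by (auto simp: list_eq_iff_nth_eq)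
  moreover have "open (\<Union>i\<in>{..<n}. {z::point. z i \<in> - {w ! i}})"
    by (rule open_UN) (use open_coordinate in blast)+
  ultimately show ?thesis unfolding closed_def by metis
next
  case False
  then have "{z::point. prefix n z = w} = {}" by auto
  then show ?thesis by simp
qed

text \<open>A function that reads only a prefix is locally constant.\<close>

lemma continuous_on_prefix: "continuous_on S (\<lambda>x. u (prefix n x) :: 'b::topological_space)"
proof -
  have "open ((\<lambda>x. u (prefix n x)) -` B)" for B
  proof -
    have "(\<lambda>x. u (prefix n x)) -` B = (\<Union>w\<in>u -` B. {z. prefix n z = w})" by auto
    moreover have "open (\<Union>w\<in>u -` B. {z::point. prefix n z = w})"
      by (rule open_UN) (use open_agree in blast)
    ultimately show ?thesis by metis
  qed
  then have "continuous_on UNIV (\<lambda>x. u (prefix n x))"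
    by (simp add: continuous_on_open_vimage)
  then show ?thesis by (rule continuous_on_subset) auto
qed

text \<open>Cylinders are open, so \<open>X\<close> is covered by finitely many cylinders on each of which \<open>f\<close> varies little;
  the longest of them plays the role of a Lebesgue number.\<close>

lemma uniformly_continuous_prefix:
  fixes f :: "point \<Rightarrow> real"
  assumes X: "compact X" and f: "continuous_on X f" and e: "e > 0"
  shows "\<exists>N. \<forall>x\<in>X. \<forall>x'\<in>X. prefix N x = prefix N x' \<longrightarrow> \<bar>f x - f x'\<bar> \<le> e"
proof -
  have "\<exists>n. \<forall>x'\<in>X. prefix n x' = prefix n x \<longrightarrow> \<bar>f x' - f x\<bar> < e/2" if x: "x \<in> X" for x
  proof -
    obtain A where A: "open A" "A \<inter> X = f -` ball (f x) (e/2) \<inter> X"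
      using f open_ball unfolding continuous_on_open_invariant by meson
    have "x \<in> A" using A(2) x e by auto
    with A(1) obtain n where n: "\<And>z. prefix n z = prefix n x \<Longrightarrow> z \<in> A"
      by (rule open_contains_agree) blast
    have "\<bar>f x' - f x\<bar> < e/2" if "x' \<in> X" "prefix n x' = prefix n x" for x'
    proof -
      have "x' \<in> f -` ball (f x) (e/2) \<inter> X" using n[OF that(2)] that(1) A(2) by blast
      then show ?thesis by (simp add: dist_real_def abs_minus_commute)
    qed
    then show ?thesis by blast
  qed
  then obtain n where n: "\<And>x x'. x \<in> X \<Longrightarrow> x' \<in> X \<Longrightarrow> prefix (n x) x' = prefix (n x) x \<Longrightarrow> \<bar>f x' - f x\<bar> < e/2"
    by metis
  obtain D where D: "D \<subseteq> X" "finite D" "X \<subseteq> (\<Union>a\<in>D. {z. prefix (n a) z = prefix (n a) a})"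
    by (rule compactE_image[OF X, of X "\<lambda>a. {z. prefix (n a) z = prefix (n a) a}"])
       (use open_agree in \<open>blast+\<close>)
  define N where "N = Max (insert 0 (n ` D))"
  have "\<bar>f x - f x'\<bar> \<le> e" if xx: "x \<in> X" "x' \<in> X" "prefix N x = prefix N x'" for x x'
  proof -
    obtain a where a: "a \<in> D" "prefix (n a) x = prefix (n a) a" using D(3) xx(1) by blast
    have "n a \<le> N" unfolding N_def using a(1) D(2) by simp
    then have "prefix (n a) x' = prefix (n a) a" using prefix_mono_eq[OF xx(3)] a(2) by simp
    then have "\<bar>f x' - f a\<bar> < e/2" "\<bar>f x - f a\<bar> < e/2" using n a D(1) xx by blast+
    then show ?thesis by linarith
  qed
  then show ?thesis by blast
qed


section \<open>Sublinear families and subadditive sequences\<close>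

text \<open>The error class $o(n)$, uniform in \<open>s\<close>. The additive constant makes the estimate valid for all \<open>n\<close>,
  so that estimates for different \<open>n\<close> can be combined before any limit is taken.\<close>

definition sublinear :: "'a set \<Rightarrow> (nat \<Rightarrow> 'a \<Rightarrow> real) \<Rightarrow> bool" where
  "sublinear S u \<longleftrightarrow> (\<forall>\<epsilon>>0. \<exists>C\<ge>0. \<forall>n. \<forall>s\<in>S. \<bar>u n s\<bar> \<le> \<epsilon> * real n + C)"

lemma sublinearD: "sublinear S u \<Longrightarrow> \<epsilon> > 0 \<Longrightarrow> \<exists>C\<ge>0. \<forall>n. \<forall>s\<in>S. \<bar>u n s\<bar> \<le> \<epsilon> * real n + C"
  by (simp add: sublinear_def)

lemma sublinear_sum_bound:
  assumes "sublinear S u" "sublinear S' v"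
    and "\<And>n s. s \<in> S'' \<Longrightarrow> \<exists>t\<in>S. \<exists>t'\<in>S'. \<bar>w n s\<bar> \<le> \<bar>u n t\<bar> + \<bar>v n t'\<bar>"
  shows "sublinear S'' w"
  unfolding sublinear_def
proof (intro allI impI)
  fix \<epsilon> :: real assume "\<epsilon> > 0"
  then have "\<epsilon> / 2 > 0" by simp
  from sublinearD[OF assms(1) this] obtain C where
    C: "C \<ge> 0" "\<And>n s. s \<in> S \<Longrightarrow> \<bar>u n s\<bar> \<le> \<epsilon>/2 * real n + C" by auto
  from sublinearD[OF assms(2) \<open>\<epsilon> / 2 > 0\<close>] obtain D where
    D: "D \<ge> 0" "\<And>n s. s \<in> S' \<Longrightarrow> \<bar>v n s\<bar> \<le> \<epsilon>/2 * real n + D" by auto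
  have "\<bar>w n s\<bar> \<le> \<epsilon> * real n + (C + D)" if s: "s \<in> S''" for n s
  proof -
    obtain t t' where "t \<in> S" "t' \<in> S'" "\<bar>w n s\<bar> \<le> \<bar>u n t\<bar> + \<bar>v n t'\<bar>"
      using assms(3)[OF s] by blast
    with C(2)[of t n] D(2)[of t' n] show ?thesis by simp
  qed
  then show "\<exists>C\<ge>0. \<forall>n. \<forall>s\<in>S''. \<bar>w n s\<bar> \<le> \<epsilon> * real n + C"
    using C(1) D(1) by (intro exI[of _ "C + D"]) auto
qed

lemma sublinear_bounded_by:
  assumes "sublinear S u" "\<And>n s. s \<in> S' \<Longrightarrow> \<exists>t\<in>S. \<bar>w n s\<bar> \<le> \<bar>u n t\<bar>"
  shows "sublinear S' w"
  unfolding sublinear_def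
proof (intro allI impI)
  fix \<epsilon> :: real assume "\<epsilon> > 0"
  from sublinearD[OF assms(1) this] obtain C where
    "C \<ge> 0" "\<And>n s. s \<in> S \<Longrightarrow> \<bar>u n s\<bar> \<le> \<epsilon> * real n + C" by auto
  then show "\<exists>C\<ge>0. \<forall>n. \<forall>s\<in>S'. \<bar>w n s\<bar> \<le> \<epsilon> * real n + C"
    using assms(2) by (intro exI[of _ C]) (meson order_trans)
qed

lemma sublinear_tendsto:
  assumes "sublinear S u" "s \<in> S"
  shows "(\<lambda>n. u n s / real n) \<longlonglongrightarrow> 0"
proof (rule LIMSEQ_I)
  fix r :: real assume r: "r > 0"
  then have "r / 2 > 0" by simp
  from sublinearD[OF assms(1) this] assms(2) obtain C where
    C: "C \<ge> 0" "\<And>n. \<bar>u n s\<bar> \<le> r/2 * real n + C" by auto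
  obtain N where N: "real N > 2 * C / r" using reals_Archimedean2 by blast
  have "norm (u n s / real n - 0) < r" if n: "n \<ge> Suc N" for n
  proof -
    have np: "real n > 0" using n by simp
    have "real n > 2 * C / r" using N n by simp
    then have "C < r/2 * real n" using r by (simp add: field_simps)
    then have "\<bar>u n s\<bar> < r * real n" using C(2)[of n] by (simp add: field_simps)
    then show ?thesis using np by (simp add: field_simps)
  qed
  then show "\<exists>no. \<forall>n\<ge>no. norm (u n s / real n - 0) < r" by blast
qed

text \<open>Fekete's lemma: writing \<open>n = k * m + i\<close> with \<open>i < m\<close>, subadditivity gives $u_n \le k u_m + u_i$. The
  linear lower bound makes the infimum finite.\<close>

lemma fekete:
  fixes u :: "nat \<Rightarrow> real"
  assumes sub: "\<And>m n. u (m + n) \<le> u m + u n"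
    and lower: "\<And>n. - (C * real n) \<le> u n"
  shows "\<exists>L. (\<lambda>n. u n / real n) \<longlonglongrightarrow> L \<and> (\<forall>n\<ge>1. L \<le> u n / real n)"
proof -
  define L where "L = (INF n\<in>{1..}. u n / real n)"
  have bdd: "bdd_below ((\<lambda>n. u n / real n) ` {1..})"
  proof (rule bdd_belowI2[of _ "- C"])
    fix n :: nat assume "n \<in> {1..}"
    then show "- C \<le> u n / real n" using lower[of n] by (simp add: field_simps)
  qed
  have L: "L \<le> u n / real n" if "n \<ge> 1" for n
    unfolding L_def by (rule cINF_lower[OF bdd]) (use that in simp)
  have mult: "u (k * m) \<le> real k * u m" if "k \<ge> 1" for k m
    using that
  proof (induction k rule: dec_induct)
    case (step k)
    have "u (Suc k * m) \<le> u (k * m) + u m" using sub[of "k * m" m] by (simp add: add.commute)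
    with step show ?case by (simp add: algebra_simps)
  qed simp
  have "(\<lambda>n. u n / real n) \<longlonglongrightarrow> L"
  proof (rule LIMSEQ_I)
    fix r :: real assume r: "r > 0"
    have "\<exists>m\<in>{1..}. u m / real m < L + r/2"
      using cINF_less_iff[OF _ bdd, of "L + r/2"] r unfolding L_def by auto
    then obtain m where m: "m \<ge> 1" "u m / real m < L + r/2" by auto
    \<comment> \<open>The contribution of the remainder \<open>i < m\<close> is bounded independently of \<open>n\<close>.\<close>
    define B where "B = Max ((\<lambda>i. \<bar>u i\<bar>) ` {..m}) + m * \<bar>L + r/2\<bar>"
    obtain N where N: "real N > 2 * B / r" using reals_Archimedean2 by blast
    have "norm (u n / real n - L) < r" if n: "n \<ge> Suc N" for n
    proof -
      have np: "real n > 0" "n \<ge> 1" using n by auto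
      define i where "i = n mod m"
      define k where "k = n div m"
      have nk: "n = k * m + i" by (simp add: k_def i_def)
      have im: "i < m" unfolding i_def using m by simp
      then have "\<bar>u i\<bar> \<le> Max ((\<lambda>i. \<bar>u i\<bar>) ` {..m})" by (intro Max_ge) auto
      moreover have "u n \<le> real k * real m * (L + r/2) + \<bar>u i\<bar>"
      proof (cases "k = 0")
        case True
        then show ?thesis using nk by simp
      next
        case False
        then have "u (k * m) \<le> real k * u m" by (intro mult) auto
        also have "u m \<le> real m * (L + r/2)" using m by (simp add: field_simps)
        then have "real k * u m \<le> real k * (real m * (L + r/2))" by (intro mult_left_mono) auto
        finally show ?thesis using sub[of "k * m" i] unfolding nk[symmetric] by simp
      qed
      moreover have "real k * real m * (L + r/2) \<le> real n * (L + r/2) + m * \<bar>L + r/2\<bar>"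
      proof -
        have "real k * real m = real n - real i" unfolding nk by simp
        then have "real k * real m * (L + r/2) = real n * (L + r/2) - real i * (L + r/2)"
          by (metis left_diff_distrib)
        moreover have "real i * - (L + r/2) \<le> real m * \<bar>L + r/2\<bar>"
          by (rule order_trans[OF mult_left_mono[of _ "\<bar>L + r/2\<bar>"] mult_right_mono]) (use im in auto)
        ultimately show ?thesis by (simp only: mult_minus_right)
      qed
      ultimately have "u n \<le> real n * (L + r/2) + B"
        unfolding B_def by linarith
      moreover have "real n > 2 * B / r" using N n by simp
      then have "B < r/2 * real n" using r by (simp add: field_simps)
      ultimately have "u n < real n * (L + r)" by (simp add: algebra_simps)
      then have "u n / real n < L + r" using np by (simp add: field_simps)
      then show ?thesis using L[OF np(2)] by (simp add: abs_if)
    qed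
    then show "\<exists>no. \<forall>n\<ge>no. norm (u n / real n - L) < r" by blast
  qed
  with L show ?thesis by blast
qed

section \<open>Weights of cylinders\<close>

lemma subshift_compact:
  assumes "subshift X" shows "compact X"
proof -
  obtain k where k: "\<forall>x\<in>X. \<forall>i. x i \<in> {1..k}" and X: "closed X"
    using assms unfolding subshift_def by auto
  have "compactin (product_topology (\<lambda>_. euclidean) UNIV) (PiE UNIV (\<lambda>_::nat. {1..k::nat}))"
    unfolding compactin_PiE by (simp add: finite_imp_compact)
  then have "compact (PiE UNIV (\<lambda>_::nat. {1..k::nat}))"
    by (metis compactin_euclidean_iff euclidean_product_topology)
  moreover have "X = PiE UNIV (\<lambda>_::nat. {1..k::nat}) \<inter> X" using k by auto
  ultimately show ?thesis using X compact_Int_closed by metis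
qed

lemma shift_closed_funpow:
  "shift ` X \<subseteq> X \<Longrightarrow> x \<in> X \<Longrightarrow> (shift ^^ n) x \<in> X"
  by (induction n) auto

lemma prefix_in_words: "x \<in> X \<Longrightarrow> prefix n x \<in> words n X"
  unfolding words_def lang_def occurs_def by (auto simp: prefix_def intro!: exI[of _ 0])

lemma words_eq_prefixes:
  assumes "shift ` X \<subseteq> X" "X \<noteq> {}"
  shows "words n X = prefix n ` X"
proof
  show "words n X \<subseteq> prefix n ` X"
  proof
    fix w assume w: "w \<in> words n X"
    show "w \<in> prefix n ` X"
    proof (cases "w = []")
      case True
      then show ?thesis using w assms(2) by (auto simp: words_def)
    next
      case False
      then obtain x m where x: "x \<in> X" "w = map x [m..<m + n]" and "length w = n"
        using w unfolding words_def lang_def occurs_def by auto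
      have "w = prefix n ((shift ^^ m) x)"
        unfolding x(2) by (rule nth_equalityI) (auto simp: funpow_shift ac_simps)
      then show ?thesis using shift_closed_funpow[OF assms(1) x(1)] by blast
    qed
  qed
qed (use prefix_in_words in blast)

definition cylinder_weight :: "point set \<Rightarrow> (point \<Rightarrow> real) \<Rightarrow> nat list \<Rightarrow> real" where
  "cylinder_weight X f w = (SUP x\<in>cylinder X w. exp (birkhoff_sum (length w) f x))"

definition partition_sum :: "point set \<Rightarrow> (point \<Rightarrow> real) \<Rightarrow> nat \<Rightarrow> real" where
  "partition_sum X f n = (\<Sum>w\<in>words n X. cylinder_weight X f w)"

text \<open>The topological pressure; the limit exists by Fekete's lemma (\<open>pressure_limit\<close>).\<close>

definition pressure :: "point set \<Rightarrow> (point \<Rightarrow> real) \<Rightarrow> real" where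
  "pressure X f = lim (\<lambda>n. ln (partition_sum X f n) / real n)"

locale potential =
  fixes X :: "point set" and f :: "point \<Rightarrow> real"
  assumes subshift: "subshift X" and nonempty: "X \<noteq> {}" and cont: "continuous_on X f"
begin

lemma compact: "compact X"
  by (rule subshift_compact[OF subshift])

lemma shift_closed: "shift ` X \<subseteq> X"
  using subshift by (simp add: subshift_def)

lemma funpow_closed: "x \<in> X \<Longrightarrow> (shift ^^ n) x \<in> X"
  by (rule shift_closed_funpow[OF shift_closed])

lemma words_eq: "words n X = prefix n ` X"
  by (rule words_eq_prefixes[OF shift_closed nonempty])

definition norm_sup :: real where "norm_sup = (SUP x\<in>X. \<bar>f x\<bar>)"

lemma abs_le_norm_sup: "x \<in> X \<Longrightarrow> \<bar>f x\<bar> \<le> norm_sup"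
proof -
  have "compact ((\<lambda>x. \<bar>f x\<bar>) ` X)"
    by (intro compact_continuous_image compact continuous_on_rabs cont)
  then have "bdd_above ((\<lambda>x. \<bar>f x\<bar>) ` X)"
    by (simp add: bounded_imp_bdd_above compact_imp_bounded)
  then show "x \<in> X \<Longrightarrow> \<bar>f x\<bar> \<le> norm_sup"
    unfolding norm_sup_def by (intro cSUP_upper)
qed

lemma norm_sup_nonneg: "0 \<le> norm_sup"
  using abs_le_norm_sup nonempty by (metis abs_ge_zero all_not_in_conv order_trans)

lemma birkhoff_abs: "x \<in> X \<Longrightarrow> \<bar>birkhoff_sum n f x\<bar> \<le> real n * norm_sup"
proof -
  assume x: "x \<in> X"
  have "\<bar>birkhoff_sum n f x\<bar> \<le> (\<Sum>i<n. \<bar>f ((shift ^^ i) x)\<bar>)"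
    unfolding birkhoff_sum_def by (rule sum_abs)
  also have "\<dots> \<le> (\<Sum>i<n. norm_sup)"
    by (intro sum_mono abs_le_norm_sup funpow_closed x)
  finally show ?thesis by simp
qed

lemma continuous_birkhoff: "continuous_on X (birkhoff_sum n f)"
proof -
  have "continuous_on X (\<lambda>x. f ((shift ^^ i) x))" for i
  proof (rule continuous_on_compose2[OF cont])
    show "continuous_on X (shift ^^ i)"
    proof (induction i)
      case (Suc i)
      then show ?case
        by (simp add: continuous_on_compose2[OF continuous_on_shift[of UNIV]] comp_def)
    qed (simp add: id_def)
  qed (use funpow_closed in blast)
  then show ?thesis unfolding birkhoff_sum_def by (intro continuous_on_sum) auto
qed

text \<open>Along two points that share \<open>n\<close> coordinates, all but the last \<open>N\<close> terms of the Birkhoff sums are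
  compared at points that still share \<open>N\<close> coordinates, hence are uniformly close. The last \<open>N\<close> terms
  cost a constant.\<close>

lemma distortion:
  assumes "\<epsilon> > 0"
  obtains C where "C \<ge> 0"
    "\<And>n x x'. x \<in> X \<Longrightarrow> x' \<in> X \<Longrightarrow> prefix n x = prefix n x' \<Longrightarrow>
       \<bar>birkhoff_sum n f x - birkhoff_sum n f x'\<bar> \<le> \<epsilon> * real n + C"
proof -
  obtain N where N: "\<And>x x'. x \<in> X \<Longrightarrow> x' \<in> X \<Longrightarrow> prefix N x = prefix N x' \<Longrightarrow> \<bar>f x - f x'\<bar> \<le> \<epsilon>"
    using uniformly_continuous_prefix[OF compact cont assms] by blast
  define C where "C = 2 * real N * norm_sup"
  have "\<bar>birkhoff_sum n f x - birkhoff_sum n f x'\<bar> \<le> \<epsilon> * real n + C"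
    if x: "x \<in> X" "x' \<in> X" "prefix n x = prefix n x'" for n x x'
  proof (cases "N \<le> n")
    case True
    define k where "k = n - N"
    have n: "n = k + N" using True by (simp add: k_def)
    have "\<bar>f ((shift ^^ i) x) - f ((shift ^^ i) x')\<bar> \<le> \<epsilon>" if "i < k" for i
      using x(3) that by (intro N funpow_closed x) (auto simp: prefix_eq_iff funpow_shift n)
    then have "(\<Sum>i<k. \<bar>f ((shift ^^ i) x) - f ((shift ^^ i) x')\<bar>) \<le> (\<Sum>i<k. \<epsilon>)"
      by (intro sum_mono) auto
    then have "\<bar>birkhoff_sum k f x - birkhoff_sum k f x'\<bar> \<le> \<epsilon> * real k"
      unfolding birkhoff_sum_def sum_subtractf[symmetric]
      by (intro order_trans[OF sum_abs]) (simp add: mult.commute)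
    also have "\<epsilon> * real k \<le> \<epsilon> * real n" using assms n by simp
    finally have "\<bar>birkhoff_sum k f x - birkhoff_sum k f x'\<bar> \<le> \<epsilon> * real n" .
    then show ?thesis
      using birkhoff_abs[OF funpow_closed[OF x(1)], of N k] birkhoff_abs[OF funpow_closed[OF x(2)], of N k]
      unfolding n birkhoff_sum_add C_def by linarith
  next
    case False
    then have "real n * norm_sup \<le> real N * norm_sup"
      using norm_sup_nonneg by (intro mult_right_mono) auto
    moreover have "0 \<le> \<epsilon> * real n" using assms by simp
    ultimately show ?thesis
      using birkhoff_abs[OF x(1), of n] birkhoff_abs[OF x(2), of n] unfolding C_def by linarith
  qed
  moreover have "C \<ge> 0" unfolding C_def using norm_sup_nonneg by simp
  ultimately show ?thesis using that by blast
qed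

lemma cylinder_eq: "length w = n \<Longrightarrow> cylinder X w = {x \<in> X. prefix n x = w}"
  by (auto simp: cylinder_def)

lemma compact_cylinder: "Topological_Spaces.compact (cylinder X w)"
proof -
  have "cylinder X w = X \<inter> {x. prefix (length w) x = w}" by (auto simp: cylinder_def)
  then show ?thesis by (simp add: compact_Int_closed compact closed_agree)
qed

text \<open>Cylinders are compact, so weights are values of the exponential Birkhoff sum at a point. Comparisons
  of weights can thus be made pointwise.\<close>

lemma weight_attained:
  assumes "w \<in> words n X"
  obtains x where "x \<in> X" "prefix n x = w" "cylinder_weight X f w = exp (birkhoff_sum n f x)"
    "\<And>z. z \<in> X \<Longrightarrow> prefix n z = w \<Longrightarrow> exp (birkhoff_sum n f z) \<le> cylinder_weight X f w"
proof -
  have n: "length w = n" using assms by (simp add: words_def)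
  have ne: "cylinder X w \<noteq> {}" using assms unfolding words_eq cylinder_eq[OF n] by auto
  have "continuous_on (cylinder X w) (\<lambda>x. exp (birkhoff_sum n f x))"
    by (intro continuous_on_exp continuous_on_subset[OF continuous_birkhoff]) (auto simp: cylinder_def)
  then obtain x where x: "x \<in> cylinder X w"
    "\<And>z. z \<in> cylinder X w \<Longrightarrow> exp (birkhoff_sum n f z) \<le> exp (birkhoff_sum n f x)"
    using continuous_attains_sup[OF compact_cylinder ne] by blast
  have "cylinder_weight X f w = exp (birkhoff_sum n f x)"
    unfolding cylinder_weight_def n using x by (intro cSup_eq_maximum) auto
  moreover from this x(2) have "\<And>z. z \<in> X \<Longrightarrow> prefix n z = w \<Longrightarrow> exp (birkhoff_sum n f z) \<le> cylinder_weight X f w"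
    unfolding cylinder_eq[OF n] by simp
  ultimately show ?thesis using x(1) that unfolding cylinder_eq[OF n] by blast
qed

lemma weight_ge: "x \<in> X \<Longrightarrow> exp (birkhoff_sum n f x) \<le> cylinder_weight X f (prefix n x)"
  using weight_attained[OF prefix_in_words] by metis

lemma weight_pos: "w \<in> words n X \<Longrightarrow> 0 < cylinder_weight X f w"
  by (metis exp_gt_zero weight_attained)

lemma finite_words: "finite (words n X)"
proof -
  obtain k where "\<forall>x\<in>X. \<forall>i. x i \<in> {1..k}"
    using subshift unfolding subshift_def by auto
  then have "words n X \<subseteq> {xs. set xs \<subseteq> {1..k} \<and> length xs = n}"
    unfolding words_eq by (auto simp: prefix_def)
  then show ?thesis by (rule finite_subset) (simp add: finite_lists_length_eq)
qed

lemma take_words: "w \<in> words (m + n) X \<Longrightarrow> take m w \<in> words m X"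
  unfolding words_eq by (auto simp: take_prefix)

lemma drop_words: "w \<in> words (m + n) X \<Longrightarrow> drop m w \<in> words n X"
  unfolding words_eq using funpow_closed by (auto simp: drop_prefix)

lemma sum_weight_pos: "A \<subseteq> words n X \<Longrightarrow> A \<noteq> {} \<Longrightarrow> 0 < (\<Sum>w\<in>A. cylinder_weight X f w)"
  by (rule sum_pos) (auto intro: finite_subset[OF _ finite_words] weight_pos)

text \<open>Cutting every word at position \<open>m\<close> embeds \<open>A\<close> into a product, and weights are
  submultiplicative under the cut.\<close>

lemma sum_weight_append:
  assumes A: "A \<subseteq> words (m + n) X"
  shows "(\<Sum>w\<in>A. cylinder_weight X f w) \<le>
    (\<Sum>u\<in>take m ` A. cylinder_weight X f u) * (\<Sum>v\<in>drop m ` A. cylinder_weight X f v)"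
proof -
  let ?c = "cylinder_weight X f"
  have fin: "finite A" using A finite_words finite_subset by blast
  have "?c w \<le> ?c (take m w) * ?c (drop m w)" if "w \<in> A" for w
  proof -
    have "w \<in> words (m + n) X" using A that by blast
    then obtain x where x: "x \<in> X" "prefix (m + n) x = w" "?c w = exp (birkhoff_sum (m + n) f x)"
      by (rule weight_attained)
    have "?c w = exp (birkhoff_sum m f x) * exp (birkhoff_sum n f ((shift ^^ m) x))"
      by (simp add: x(3) birkhoff_sum_add exp_add)
    also have "\<dots> \<le> ?c (prefix m x) * ?c (prefix n ((shift ^^ m) x))"
      by (intro mult_mono weight_ge x funpow_closed order.trans[OF _ weight_ge[OF x(1)]]) auto
    finally show ?thesis unfolding x(2)[symmetric] by (simp add: take_prefix drop_prefix)
  qed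
  then have "(\<Sum>w\<in>A. ?c w) \<le> (\<Sum>w\<in>A. ?c (take m w) * ?c (drop m w))" by (rule sum_mono)
  also have "\<dots> = (\<Sum>(u, v)\<in>(\<lambda>w. (take m w, drop m w)) ` A. ?c u * ?c v)"
  proof (subst sum.reindex)
    show "inj_on (\<lambda>w. (take m w, drop m w)) A"
      by (rule inj_onI) (metis append_take_drop_id prod.inject)
  qed simp
  also have "\<dots> \<le> (\<Sum>(u, v)\<in>take m ` A \<times> drop m ` A. ?c u * ?c v)"
  proof (rule sum_mono2)
    fix b assume b: "b \<in> take m ` A \<times> drop m ` A - (\<lambda>w. (take m w, drop m w)) ` A"
    then obtain w w' where w: "w \<in> A" "w' \<in> A" "b = (take m w, drop m w')" by auto
    then show "0 \<le> (case b of (u, v) \<Rightarrow> ?c u * ?c v)"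
      using weight_pos[OF take_words[OF subsetD[OF A w(1)]]] weight_pos[OF drop_words[OF subsetD[OF A w(2)]]]
      by simp
  qed (use fin in auto)
  also have "\<dots> = (\<Sum>u\<in>take m ` A. ?c u) * (\<Sum>v\<in>drop m ` A. ?c v)"
    by (simp add: sum_product sum.cartesian_product)
  finally show ?thesis .
qed

text \<open>There are at most $k^n$ words, and each has weight between $e^{-n \|f\|}$ and $e^{n \|f\|}$.\<close>

lemma sum_weight_bound:
  obtains C where "C \<ge> 0"
    "\<And>n A. A \<subseteq> words n X \<Longrightarrow> A \<noteq> {} \<Longrightarrow> \<bar>ln (\<Sum>w\<in>A. cylinder_weight X f w)\<bar> \<le> C * real n"
proof -
  obtain k where k: "k \<ge> 1" "\<forall>x\<in>X. \<forall>i. x i \<in> {1..k}"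
    using subshift unfolding subshift_def by auto
  define C where "C = ln (real k) + norm_sup"
  have "\<bar>ln (\<Sum>w\<in>A. cylinder_weight X f w)\<bar> \<le> C * real n" if A: "A \<subseteq> words n X" "A \<noteq> {}" for n A
  proof -
    let ?S = "\<Sum>w\<in>A. cylinder_weight X f w"
    have fin: "finite A" using A finite_words finite_subset by blast
    have sub: "words n X \<subseteq> {xs. set xs \<subseteq> {1..k} \<and> length xs = n}"
      using k(2) unfolding words_eq by (auto simp: prefix_def)
    have "card A \<le> card {xs. set xs \<subseteq> {1..k} \<and> length xs = n}"
      by (rule card_mono) (use A sub in \<open>auto simp: finite_lists_length_eq\<close>)
    then have "card A \<le> k ^ n" by (simp add: card_lists_length_eq)
    then have card: "real (card A) \<le> real k ^ n"
      by (metis of_nat_le_iff of_nat_power)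
    have S: "?S > 0" using sum_weight_pos A by blast
    have up: "cylinder_weight X f w \<le> exp (real n * norm_sup)"
      and lo: "exp (- (real n * norm_sup)) \<le> cylinder_weight X f w" if "w \<in> A" for w
    proof -
      have "w \<in> words n X" using A that by blast
      then obtain x where x: "x \<in> X" "cylinder_weight X f w = exp (birkhoff_sum n f x)"
        by (rule weight_attained)
      then show "cylinder_weight X f w \<le> exp (real n * norm_sup)"
        "exp (- (real n * norm_sup)) \<le> cylinder_weight X f w"
        using birkhoff_abs[OF x(1), of n] by auto
    qed
    have "?S \<le> (\<Sum>w\<in>A. exp (real n * norm_sup))" by (rule sum_mono) (rule up)
    also have "\<dots> \<le> real k ^ n * exp (real n * norm_sup)" using card by simp
    also have "\<dots> = exp (C * real n)"
      using k(1) by (simp add: C_def exp_add algebra_simps exp_of_nat_mult)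
    finally have "ln ?S \<le> C * real n" using S by (metis ln_exp ln_le_cancel_iff exp_gt_zero)
    moreover have "- (C * real n) \<le> ln ?S"
    proof -
      obtain w where w: "w \<in> A" using A by blast
      have "cylinder_weight X f w \<le> ?S"
        by (rule member_le_sum[OF w]) (use A fin weight_pos in \<open>auto intro: less_imp_le\<close>)
      then have "exp (- (real n * norm_sup)) \<le> ?S" using lo[OF w] by simp
      then have "- (real n * norm_sup) \<le> ln ?S" using S by (simp add: ln_ge_iff)
      moreover have "real n * norm_sup \<le> C * real n" unfolding C_def using k(1) by (simp add: algebra_simps)
      ultimately show ?thesis by linarith
    qed
    ultimately show ?thesis by linarith
  qed
  moreover have "C \<ge> 0" unfolding C_def using norm_sup_nonneg k(1) by simp
  ultimately show ?thesis using that by blast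
qed

text \<open>Lengthening words multiplies the sum by at most an exponential factor. A converse bound fails for
  general \<open>A\<close>: many words of length \<open>m\<close> may have no continuation in \<open>A\<close>.\<close>

lemma sum_weight_extend:
  obtains C where "C \<ge> 0"
    "\<And>m n A. A \<subseteq> words (m + n) X \<Longrightarrow> A \<noteq> {} \<Longrightarrow>
      ln (\<Sum>w\<in>A. cylinder_weight X f w) \<le> ln (\<Sum>u\<in>take m ` A. cylinder_weight X f u) + C * real n"
    "\<And>m n A. A \<subseteq> words (m + n) X \<Longrightarrow> A \<noteq> {} \<Longrightarrow>
      ln (\<Sum>w\<in>A. cylinder_weight X f w) \<le> C * real m + ln (\<Sum>v\<in>drop m ` A. cylinder_weight X f v)"
proof -
  obtain C where C: "C \<ge> 0"
    "\<And>n A. A \<subseteq> words n X \<Longrightarrow> A \<noteq> {} \<Longrightarrow> \<bar>ln (\<Sum>w\<in>A. cylinder_weight X f w)\<bar> \<le> C * real n"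
    by (rule sum_weight_bound) blast
  have *: "take m ` A \<subseteq> words m X" "drop m ` A \<subseteq> words n X" "take m ` A \<noteq> {}" "drop m ` A \<noteq> {}"
    "ln (\<Sum>w\<in>A. cylinder_weight X f w) \<le>
      ln (\<Sum>u\<in>take m ` A. cylinder_weight X f u) + ln (\<Sum>v\<in>drop m ` A. cylinder_weight X f v)"
    if A: "A \<subseteq> words (m + n) X" "A \<noteq> {}" for m n A
  proof -
    show t: "take m ` A \<subseteq> words m X" and d: "drop m ` A \<subseteq> words n X"
      using A take_words drop_words by blast+
    show "take m ` A \<noteq> {}" "drop m ` A \<noteq> {}" using A by auto
    with t d have p: "0 < (\<Sum>u\<in>take m ` A. cylinder_weight X f u)" "0 < (\<Sum>v\<in>drop m ` A. cylinder_weight X f v)"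
      using sum_weight_pos by blast+
    show "ln (\<Sum>w\<in>A. cylinder_weight X f w) \<le>
      ln (\<Sum>u\<in>take m ` A. cylinder_weight X f u) + ln (\<Sum>v\<in>drop m ` A. cylinder_weight X f v)"
      unfolding ln_mult_pos[OF p, symmetric]
      using sum_weight_append[OF A(1)] sum_weight_pos[OF A] p by (subst ln_le_cancel_iff) auto
  qed
  show ?thesis
  proof (rule that[OF C(1)])
    fix m n A assume A: "A \<subseteq> words (m + n) X" "A \<noteq> {}"
    show "ln (\<Sum>w\<in>A. cylinder_weight X f w) \<le> ln (\<Sum>u\<in>take m ` A. cylinder_weight X f u) + C * real n"
      using *[OF A] C(2)[of "drop m ` A" n] by linarith
    show "ln (\<Sum>w\<in>A. cylinder_weight X f w) \<le> C * real m + ln (\<Sum>v\<in>drop m ` A. cylinder_weight X f v)"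
      using *[OF A] C(2)[of "take m ` A" m] by linarith
  qed
qed

lemma words_nonempty: "words n X \<noteq> {}"
  unfolding words_eq using nonempty by simp

lemma partition_sum_pos: "0 < partition_sum X f n"
  unfolding partition_sum_def by (rule sum_weight_pos[OF order_refl words_nonempty])

lemma pressure_limit:
  "(\<lambda>n. ln (partition_sum X f n) / real n) \<longlonglongrightarrow> pressure X f"
  "n \<ge> 1 \<Longrightarrow> pressure X f \<le> ln (partition_sum X f n) / real n"
proof -
  obtain C where C: "C \<ge> 0"
    "\<And>n A. A \<subseteq> words n X \<Longrightarrow> A \<noteq> {} \<Longrightarrow> \<bar>ln (\<Sum>w\<in>A. cylinder_weight X f w)\<bar> \<le> C * real n"
    by (rule sum_weight_bound) blast
  have sub: "ln (partition_sum X f (m + n)) \<le> ln (partition_sum X f m) + ln (partition_sum X f n)" for m n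
  proof -
    have "partition_sum X f (m + n) \<le>
        (\<Sum>u\<in>take m ` words (m + n) X. cylinder_weight X f u) * (\<Sum>v\<in>drop m ` words (m + n) X. cylinder_weight X f v)"
      unfolding partition_sum_def by (rule sum_weight_append[OF order_refl])
    also have "\<dots> \<le> partition_sum X f m * partition_sum X f n"
      unfolding partition_sum_def using take_words drop_words weight_pos
      by (intro mult_mono sum_mono2 sum_nonneg finite_words) (auto intro: less_imp_le[OF weight_pos[OF take_words]] less_imp_le[OF weight_pos[OF drop_words]] less_imp_le)
    finally show ?thesis
      by (simp add: partition_sum_pos flip: ln_mult_pos)
  qed
  have low: "- (C * real n) \<le> ln (partition_sum X f n)" for n
    using C(2)[OF order_refl words_nonempty, of n] unfolding partition_sum_def by linarith
  obtain L where L: "(\<lambda>n. ln (partition_sum X f n) / real n) \<longlonglongrightarrow> L"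
    "\<And>n. n \<ge> 1 \<Longrightarrow> L \<le> ln (partition_sum X f n) / real n"
    using fekete[OF sub low] by blast
  have "pressure X f = L" unfolding pressure_def using L(1) by (rule limI)
  with L show "(\<lambda>n. ln (partition_sum X f n) / real n) \<longlonglongrightarrow> pressure X f"
    "n \<ge> 1 \<Longrightarrow> pressure X f \<le> ln (partition_sum X f n) / real n" by auto
qed

end

section \<open>One-block factor maps and the functions \<open>g\<^sub>n\<close>\<close>

text \<open>The words that the relative pressure counts, whereas $g_n$ counts all words over $y_1 \dots y_n$.\<close>

definition fibre_prefixes :: "point set \<Rightarrow> (point \<Rightarrow> point) \<Rightarrow> nat \<Rightarrow> point \<Rightarrow> nat list set" where
  "fibre_prefixes X \<pi> n y = prefix n ` {x \<in> X. \<pi> x = y}"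

definition fibre_sum :: "point set \<Rightarrow> (point \<Rightarrow> point) \<Rightarrow> (point \<Rightarrow> real) \<Rightarrow> nat \<Rightarrow> point \<Rightarrow> real" where
  "fibre_sum X \<pi> f n y = (\<Sum>w\<in>fibre_prefixes X \<pi> n y. cylinder_weight X f w)"

definition fibre_rate :: "point set \<Rightarrow> (nat \<Rightarrow> nat) \<Rightarrow> (point \<Rightarrow> real) \<Rightarrow> point \<Rightarrow> real" where
  "fibre_rate X \<Phi> f y = lim (\<lambda>n. ln (g_fun X \<Phi> f n y) / real n)"

locale one_block_factor = potential X f for X f +
  fixes Y :: "point set" and \<pi> :: "point \<Rightarrow> point" and \<Phi> :: "nat \<Rightarrow> nat"
  assumes subshift_Y: "subshift Y" and factor: "factor_map X Y \<pi>" and block: "one_block X \<pi> \<Phi>"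
begin

lemma factor_in: "x \<in> X \<Longrightarrow> \<pi> x \<in> Y"
  using factor by (auto simp: factor_map_def)

lemma factor_surj: assumes "y \<in> Y" obtains x where "x \<in> X" "\<pi> x = y"
  using factor assms by (auto simp: factor_map_def)

lemma continuous_factor: "continuous_on X \<pi>"
  using factor by (simp add: factor_map_def)

lemma prefix_factor: "x \<in> X \<Longrightarrow> prefix n (\<pi> x) = map \<Phi> (prefix n x)"
  using block by (auto simp: one_block_def prefix_def)

lemma factor_funpow: "x \<in> X \<Longrightarrow> \<pi> ((shift ^^ n) x) = (shift ^^ n) (\<pi> x)"
proof (induction n)
  case (Suc n)
  then show ?case using factor funpow_closed[OF Suc.prems, of n] by (simp add: factor_map_def)
qed simp

lemma funpow_closed_Y: "y \<in> Y \<Longrightarrow> (shift ^^ n) y \<in> Y"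
  using subshift_Y shift_closed_funpow unfolding subshift_def by blast

lemma fibre_words_eq: "fibre_words X \<Phi> n y = prefix n ` {x \<in> X. prefix n (\<pi> x) = prefix n y}"
  unfolding fibre_words_def words_eq by (auto simp: prefix_factor)

lemma fibre_words_subset: "fibre_words X \<Phi> n y \<subseteq> words n X"
  by (auto simp: fibre_words_def)

lemma fibre_weight_nonneg: "w \<in> fibre_words X \<Phi> n y \<Longrightarrow> 0 \<le> cylinder_weight X f w"
  using weight_pos[of w n] fibre_words_subset[of n y] by (auto intro: less_imp_le)

lemma fibre_prefixes_subset: "fibre_prefixes X \<pi> n y \<subseteq> fibre_words X \<Phi> n y"
  unfolding fibre_prefixes_def fibre_words_eq by auto

lemma fibre_prefixes_nonempty: "y \<in> Y \<Longrightarrow> fibre_prefixes X \<pi> n y \<noteq> {}"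
  unfolding fibre_prefixes_def by (auto elim: factor_surj)

lemma fibre_words_nonempty: "y \<in> Y \<Longrightarrow> fibre_words X \<Phi> n y \<noteq> {}"
  using fibre_prefixes_nonempty fibre_prefixes_subset by blast

lemma finite_fibre_words: "finite (fibre_words X \<Phi> n y)"
  by (rule finite_subset[OF fibre_words_subset finite_words])

text \<open>The supremum over all choices of \<open>E\<^sub>n(y)\<close> is attained by maximising in each cylinder
  separately.\<close>

lemma g_fun_eq: "g_fun X \<Phi> f n y = (\<Sum>w\<in>fibre_words X \<Phi> n y. cylinder_weight X f w)"
proof -
  let ?W = "fibre_words X \<Phi> n y"
  have len: "length w = n" if "w \<in> ?W" for w using that by (simp add: fibre_words_def words_def)
  have cyl: "x \<in> cylinder X w \<longleftrightarrow> x \<in> X \<and> prefix n x = w" if "w \<in> ?W" for x w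
    using len[OF that] by (auto simp: cylinder_def)
  have "\<exists>x\<in>X. prefix n x = w \<and> cylinder_weight X f w = exp (birkhoff_sum n f x)" if "w \<in> ?W" for w
    by (rule weight_attained[of w n]) (use that fibre_words_subset in auto)
  then obtain p where p: "\<And>w. w \<in> ?W \<Longrightarrow> p w \<in> X \<and> prefix n (p w) = w \<and> cylinder_weight X f w = exp (birkhoff_sum n f (p w))"
    by metis
  have le: "(\<Sum>x\<in>E. exp (birkhoff_sum n f x)) \<le> (\<Sum>w\<in>?W. cylinder_weight X f w)"
    if E: "E \<in> cylinder_choices X \<Phi> n y" for E
  proof -
    have 1: "x \<in> X" "prefix n x \<in> ?W" if "x \<in> E" for x
      using E that cyl unfolding cylinder_choices_def by blast+
    have inj: "inj_on (prefix n) E"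
    proof (rule inj_onI)
      fix x x' assume x: "x \<in> E" "x' \<in> E" "prefix n x = prefix n x'"
      have "\<exists>!z. z \<in> E \<inter> cylinder X (prefix n x)"
        using E 1(2)[OF x(1)] unfolding cylinder_choices_def by blast
      moreover have "x \<in> E \<inter> cylinder X (prefix n x)" "x' \<in> E \<inter> cylinder X (prefix n x)"
        using x 1 cyl[OF 1(2)[OF x(1)]] by auto
      ultimately show "x = x'" by blast
    qed
    have "(\<Sum>x\<in>E. exp (birkhoff_sum n f x)) \<le> (\<Sum>x\<in>E. cylinder_weight X f (prefix n x))"
      by (intro sum_mono weight_ge 1)
    also have "\<dots> = (\<Sum>w\<in>prefix n ` E. cylinder_weight X f w)"
      by (subst sum.reindex[OF inj]) simp
    also have "\<dots> \<le> (\<Sum>w\<in>?W. cylinder_weight X f w)"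
      by (intro sum_mono2 finite_fibre_words)
         (use 1 fibre_weight_nonneg in auto)
    finally show ?thesis .
  qed
  have inj: "inj_on p ?W" by (rule inj_onI) (metis p)
  have "p ` ?W \<in> cylinder_choices X \<Phi> n y"
    unfolding cylinder_choices_def
  proof (intro CollectI conjI ballI)
    show "p ` ?W \<subseteq> (\<Union>w\<in>?W. cylinder X w)" using p cyl by blast
    fix w assume w: "w \<in> ?W"
    show "\<exists>!x. x \<in> p ` ?W \<inter> cylinder X w"
    proof (rule ex1I[of _ "p w"])
      show "p w \<in> p ` ?W \<inter> cylinder X w" using w p cyl by blast
      fix x assume "x \<in> p ` ?W \<inter> cylinder X w"
      then show "x = p w" using p cyl[OF w] by auto
    qed
  qed
  moreover have "(\<Sum>x\<in>p ` ?W. exp (birkhoff_sum n f x)) = (\<Sum>w\<in>?W. cylinder_weight X f w)"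
    using p by (simp add: sum.reindex[OF inj])
  ultimately have "(\<Sum>w\<in>?W. cylinder_weight X f w) \<in>
      (\<lambda>E. \<Sum>x\<in>E. exp (birkhoff_sum n f x)) ` cylinder_choices X \<Phi> n y"
    by (metis (no_types, lifting) image_eqI)
  then show ?thesis
    unfolding g_fun_def by (rule cSup_eq_maximum) (use le in blast)
qed

lemma g_fun_cong: "prefix n y = prefix n y' \<Longrightarrow> g_fun X \<Phi> f n y = g_fun X \<Phi> f n y'"
  unfolding g_fun_eq fibre_words_def by simp

lemma g_fun_pos: "y \<in> Y \<Longrightarrow> 0 < g_fun X \<Phi> f n y"
  unfolding g_fun_eq by (rule sum_weight_pos[OF fibre_words_subset fibre_words_nonempty])

lemma fibre_sum_pos: "y \<in> Y \<Longrightarrow> 0 < fibre_sum X \<pi> f n y"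
  unfolding fibre_sum_def
  by (rule sum_weight_pos[OF order_trans[OF fibre_prefixes_subset fibre_words_subset] fibre_prefixes_nonempty])

lemma sum_weight_mono:
  assumes "A \<subseteq> B" "B \<subseteq> words n X"
  shows "(\<Sum>w\<in>A. cylinder_weight X f w) \<le> (\<Sum>w\<in>B. cylinder_weight X f w)"
proof (rule sum_mono2[OF _ assms(1)])
  show "finite B" using assms(2) finite_words finite_subset by blast
  fix w assume "w \<in> B - A"
  then have "w \<in> words n X" using assms(2) by blast
  then show "0 \<le> cylinder_weight X f w" by (rule less_imp_le[OF weight_pos])
qed

lemma fibre_sum_le_g: "fibre_sum X \<pi> f n y \<le> g_fun X \<Phi> f n y"
  unfolding fibre_sum_def g_fun_eq by (rule sum_weight_mono[OF fibre_prefixes_subset fibre_words_subset])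

lemma take_fibre_words: "take m ` fibre_words X \<Phi> (m + n) y \<subseteq> fibre_words X \<Phi> m y"
proof
  fix v assume "v \<in> take m ` fibre_words X \<Phi> (m + n) y"
  then obtain w where w: "v = take m w" "w \<in> words (m + n) X" "map \<Phi> w = prefix (m + n) y"
    by (auto simp: fibre_words_def)
  have "map \<Phi> v = prefix m y" unfolding w(1) take_map[symmetric] w(3) by (rule take_prefix)
  with take_words[OF w(2)] w(1) show "v \<in> fibre_words X \<Phi> m y" by (simp add: fibre_words_def)
qed

lemma drop_fibre_words: "drop m ` fibre_words X \<Phi> (m + n) y \<subseteq> fibre_words X \<Phi> n ((shift ^^ m) y)"
proof
  fix v assume "v \<in> drop m ` fibre_words X \<Phi> (m + n) y"
  then obtain w where w: "v = drop m w" "w \<in> words (m + n) X" "map \<Phi> w = prefix (m + n) y"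
    by (auto simp: fibre_words_def)
  have "map \<Phi> v = prefix n ((shift ^^ m) y)" unfolding w(1) drop_map[symmetric] w(3) by (rule drop_prefix)
  with drop_words[OF w(2)] w(1) show "v \<in> fibre_words X \<Phi> n ((shift ^^ m) y)" by (simp add: fibre_words_def)
qed

lemma take_fibre_prefixes: "take m ` fibre_prefixes X \<pi> (m + n) y = fibre_prefixes X \<pi> m y"
  unfolding fibre_prefixes_def image_image by (simp add: take_prefix)

lemma ln_g_submult:
  assumes y: "y \<in> Y"
  shows "ln (g_fun X \<Phi> f (m + n) y) \<le> ln (g_fun X \<Phi> f m y) + ln (g_fun X \<Phi> f n ((shift ^^ m) y))"
proof -
  have p: "0 < g_fun X \<Phi> f m y" "0 < g_fun X \<Phi> f n ((shift ^^ m) y)" "0 < g_fun X \<Phi> f (m + n) y"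
    using g_fun_pos funpow_closed_Y y by blast+
  have "g_fun X \<Phi> f (m + n) y \<le> (\<Sum>w\<in>take m ` fibre_words X \<Phi> (m + n) y. cylinder_weight X f w) *
      (\<Sum>w\<in>drop m ` fibre_words X \<Phi> (m + n) y. cylinder_weight X f w)"
    unfolding g_fun_eq by (rule sum_weight_append[OF fibre_words_subset])
  also have "\<dots> \<le> g_fun X \<Phi> f m y * g_fun X \<Phi> f n ((shift ^^ m) y)"
    unfolding g_fun_eq
    by (intro mult_mono sum_weight_mono[OF take_fibre_words fibre_words_subset]
        sum_weight_mono[OF drop_fibre_words fibre_words_subset] sum_nonneg)
      (use drop_fibre_words fibre_weight_nonneg in blast)+
  finally show ?thesis using p by (simp flip: ln_mult_pos)
qed

lemma ln_g_bound:
  obtains C where "C \<ge> 0" "\<And>n y. y \<in> Y \<Longrightarrow> \<bar>ln (g_fun X \<Phi> f n y)\<bar> \<le> C * real n"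
    "\<And>n y. y \<in> Y \<Longrightarrow> \<bar>ln (fibre_sum X \<pi> f n y)\<bar> \<le> C * real n"
proof -
  obtain C where C: "C \<ge> 0"
    "\<And>n A. A \<subseteq> words n X \<Longrightarrow> A \<noteq> {} \<Longrightarrow> \<bar>ln (\<Sum>w\<in>A. cylinder_weight X f w)\<bar> \<le> C * real n"
    by (rule sum_weight_bound) blast
  show ?thesis
    by (rule that[OF C(1)]; unfold g_fun_eq fibre_sum_def; rule C(2))
       (use fibre_words_subset fibre_words_nonempty fibre_prefixes_nonempty fibre_prefixes_subset in blast)+
qed

text \<open>One-sided control of the dependence on \<open>n\<close>. Lower increments are not controlled, because words over
  $y_1 \dots y_n$ need not extend to words over $y_1 \dots y_{n+1}$.\<close>

lemma ln_g_upper_increment: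
  obtains C where "C \<ge> 0"
    "\<And>m n y. y \<in> Y \<Longrightarrow> ln (g_fun X \<Phi> f (m + n) y) \<le> ln (g_fun X \<Phi> f m y) + C * real n"
    "\<And>m n y. y \<in> Y \<Longrightarrow> ln (g_fun X \<Phi> f (m + n) y) \<le> C * real m + ln (g_fun X \<Phi> f n ((shift ^^ m) y))"
    "\<And>m n y. y \<in> Y \<Longrightarrow> ln (fibre_sum X \<pi> f (m + n) y) \<le> ln (fibre_sum X \<pi> f m y) + C * real n"
proof -
  obtain C where C: "C \<ge> 0" "\<And>n y. y \<in> Y \<Longrightarrow> \<bar>ln (g_fun X \<Phi> f n y)\<bar> \<le> C * real n"
    by (rule ln_g_bound) blast
  obtain D where D: "D \<ge> 0"
    "\<And>m n A. A \<subseteq> words (m + n) X \<Longrightarrow> A \<noteq> {} \<Longrightarrow>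
      ln (\<Sum>w\<in>A. cylinder_weight X f w) \<le> ln (\<Sum>u\<in>take m ` A. cylinder_weight X f u) + D * real n"
    by (rule sum_weight_extend) blast
  show ?thesis
  proof (rule that[of "C + D"])
    fix m n y assume y: "y \<in> Y"
    have d: "0 \<le> D * real n" "0 \<le> D * real m" "0 \<le> C * real n" using D(1) C(1) by auto
    show "ln (g_fun X \<Phi> f (m + n) y) \<le> ln (g_fun X \<Phi> f m y) + (C + D) * real n"
      using ln_g_submult[OF y, of m n] C(2)[OF funpow_closed_Y[OF y, of m], of n] d
      by (simp add: distrib_right)
    show "ln (g_fun X \<Phi> f (m + n) y) \<le> (C + D) * real m + ln (g_fun X \<Phi> f n ((shift ^^ m) y))"
      using ln_g_submult[OF y, of m n] C(2)[OF y, of m] d by (simp add: distrib_right)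
    have "ln (fibre_sum X \<pi> f (m + n) y) \<le> ln (fibre_sum X \<pi> f m y) + D * real n"
      unfolding fibre_sum_def take_fibre_prefixes[of m n, symmetric]
      by (rule D(2)) (use fibre_prefixes_nonempty[OF y] fibre_prefixes_subset fibre_words_subset in blast)+
    then show "ln (fibre_sum X \<pi> f (m + n) y) \<le> ln (fibre_sum X \<pi> f m y) + (C + D) * real n"
      using d by (simp add: distrib_right)
  qed (use C(1) D(1) in simp)
qed

lemma potential_lift: "continuous_on Y \<theta> \<Longrightarrow> continuous_on X (\<lambda>x. f x + \<theta> (\<pi> x))"
  by (intro continuous_on_add cont continuous_on_compose2[OF _ continuous_factor]) (auto intro: factor_in)

lemma factor_lift: "continuous_on Y \<theta> \<Longrightarrow> one_block_factor X (\<lambda>x. f x + \<theta> (\<pi> x)) Y \<pi> \<Phi>"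
  by unfold_locales (auto simp: nonempty intro: subshift potential_lift subshift_Y factor block)

lemma Y_nonempty: "Y \<noteq> {}"
  using nonempty factor_in by blast

lemma potential_Y: "continuous_on Y \<theta> \<Longrightarrow> potential Y \<theta>"
  by unfold_locales (auto simp: Y_nonempty intro: subshift_Y)

lemma birkhoff_lift:
  "x \<in> X \<Longrightarrow> birkhoff_sum n (\<lambda>x. f x + \<theta> (\<pi> x)) x = birkhoff_sum n f x + birkhoff_sum n \<theta> (\<pi> x)"
  by (simp add: birkhoff_sum_def sum.distrib factor_funpow)

text \<open>Adding a potential lifted from \<open>Y\<close> multiplies \<open>g\<^sub>n\<close> by its Birkhoff weight, up to
  distortion.\<close>

lemma ln_g_lift:
  assumes \<theta>: "continuous_on Y \<theta>"
  shows "sublinear Y (\<lambda>n y. ln (g_fun X \<Phi> (\<lambda>x. f x + \<theta> (\<pi> x)) n y) - (ln (g_fun X \<Phi> f n y) + birkhoff_sum n \<theta> y))"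
  unfolding sublinear_def
proof (intro allI impI)
  fix \<epsilon> :: real assume "\<epsilon> > 0"
  interpret Y: potential Y \<theta> by (rule potential_Y[OF \<theta>])
  let ?f = "\<lambda>x. f x + \<theta> (\<pi> x)"
  interpret L: one_block_factor X ?f Y \<pi> \<Phi> by (rule factor_lift[OF \<theta>])
  obtain C where C: "C \<ge> 0" "\<And>n x x'. x \<in> Y \<Longrightarrow> x' \<in> Y \<Longrightarrow> prefix n x = prefix n x' \<Longrightarrow>
       \<bar>birkhoff_sum n \<theta> x - birkhoff_sum n \<theta> x'\<bar> \<le> \<epsilon> * real n + C"
    by (rule Y.distortion[OF \<open>\<epsilon> > 0\<close>]) blast
  have "\<bar>ln (g_fun X \<Phi> ?f n y) - (ln (g_fun X \<Phi> f n y) + birkhoff_sum n \<theta> y)\<bar> \<le> \<epsilon> * real n + C"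
    if y: "y \<in> Y" for n y
  proof -
    let ?E = "\<epsilon> * real n + C"
    have "cylinder_weight X ?f w \<le> cylinder_weight X f w * exp (birkhoff_sum n \<theta> y + ?E)"
      and "cylinder_weight X f w * exp (birkhoff_sum n \<theta> y - ?E) \<le> cylinder_weight X ?f w"
      if w: "w \<in> fibre_words X \<Phi> n y" for w
    proof -
      have ww: "w \<in> words n X" using w fibre_words_subset by blast
      have near: "\<bar>birkhoff_sum n \<theta> (\<pi> x) - birkhoff_sum n \<theta> y\<bar> \<le> ?E" if "x \<in> X" "prefix n x = w" for x
        by (rule C(2)) (use that w y in \<open>auto simp: factor_in prefix_factor fibre_words_def\<close>)
      obtain x where x: "x \<in> X" "prefix n x = w" "cylinder_weight X ?f w = exp (birkhoff_sum n ?f x)"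
        by (rule L.weight_attained[OF ww])
      have "birkhoff_sum n \<theta> (\<pi> x) \<le> birkhoff_sum n \<theta> y + ?E" using near[OF x(1,2)] by linarith
      then have "cylinder_weight X ?f w \<le> exp (birkhoff_sum n f x) * exp (birkhoff_sum n \<theta> y + ?E)"
        unfolding x(3) birkhoff_lift[OF x(1)] by (simp flip: exp_add)
      also have "\<dots> \<le> cylinder_weight X f w * exp (birkhoff_sum n \<theta> y + ?E)"
        using weight_ge[OF x(1), of n] x(2) by (intro mult_right_mono) auto
      finally show "cylinder_weight X ?f w \<le> cylinder_weight X f w * exp (birkhoff_sum n \<theta> y + ?E)" .
      obtain x' where x': "x' \<in> X" "prefix n x' = w" "cylinder_weight X f w = exp (birkhoff_sum n f x')"
        by (rule weight_attained[OF ww])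
      have "birkhoff_sum n \<theta> y - ?E \<le> birkhoff_sum n \<theta> (\<pi> x')" using near[OF x'(1,2)] by linarith
      then have "cylinder_weight X f w * exp (birkhoff_sum n \<theta> y - ?E) \<le> exp (birkhoff_sum n ?f x')"
        unfolding x'(3) birkhoff_lift[OF x'(1)] by (simp flip: exp_add)
      also have "\<dots> \<le> cylinder_weight X ?f w"
        using L.weight_ge[OF x'(1), of n] x'(2) by simp
      finally show "cylinder_weight X f w * exp (birkhoff_sum n \<theta> y - ?E) \<le> cylinder_weight X ?f w" .
    qed
    then have 1: "g_fun X \<Phi> ?f n y \<le> g_fun X \<Phi> f n y * exp (birkhoff_sum n \<theta> y + ?E)"
      and 2: "g_fun X \<Phi> f n y * exp (birkhoff_sum n \<theta> y - ?E) \<le> g_fun X \<Phi> ?f n y"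
      unfolding g_fun_eq L.g_fun_eq sum_distrib_right by (auto intro!: sum_mono)
    have p: "0 < g_fun X \<Phi> f n y" "0 < g_fun X \<Phi> ?f n y" using g_fun_pos L.g_fun_pos y by blast+
    have "ln (g_fun X \<Phi> ?f n y) \<le> ln (g_fun X \<Phi> f n y * exp (birkhoff_sum n \<theta> y + ?E))"
      using 1 p by simp
    moreover have "ln (g_fun X \<Phi> f n y * exp (birkhoff_sum n \<theta> y - ?E)) \<le> ln (g_fun X \<Phi> ?f n y)"
      using 2 p by simp
    ultimately show ?thesis using p by (simp add: ln_mult_pos)
  qed
  with C(1) show "\<exists>C\<ge>0. \<forall>n. \<forall>s\<in>Y. \<bar>ln (g_fun X \<Phi> ?f n s) - (ln (g_fun X \<Phi> f n s) + birkhoff_sum n \<theta> s)\<bar> \<le> \<epsilon> * real n + C"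
    by blast
qed

end

section \<open>Rates along periodic points and the relative pressure\<close>

lemma linear_bound_nonpos:
  fixes x B :: real
  assumes "\<And>k. k \<ge> 1 \<Longrightarrow> real k * x \<le> B"
  shows "x \<le> 0"
proof (rule ccontr)
  assume "\<not> x \<le> 0"
  then have x: "x > 0" by simp
  obtain k where k: "real k > B / x" using reals_Archimedean2 by blast
  then have "B < real (Suc k) * x" using x by (simp add: field_simps)
  with assms[of "Suc k"] show False by simp
qed

lemma tendsto_imp_sublinear:
  assumes "(\<lambda>n. u n / real n) \<longlonglongrightarrow> L"
  shows "sublinear S (\<lambda>n s. u n - L * real n)"
  unfolding sublinear_def
proof (intro allI impI)
  fix \<epsilon> :: real assume "\<epsilon> > 0"
  then obtain N where N: "\<And>n. n \<ge> N \<Longrightarrow> \<bar>u n / real n - L\<bar> < \<epsilon>"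
    using LIMSEQ_D[OF assms] by auto
  define C where "C = (\<Sum>n\<le>N. \<bar>u n - L * real n\<bar>)"
  have C: "C \<ge> 0" unfolding C_def by (simp add: sum_nonneg)
  have "\<bar>u n - L * real n\<bar> \<le> \<epsilon> * real n + C" for n
  proof (cases "n \<le> N")
    case True
    then have "\<bar>u n - L * real n\<bar> \<le> C" unfolding C_def by (intro member_le_sum) auto
    then show ?thesis using \<open>\<epsilon> > 0\<close> by (simp add: add_increasing)
  next
    case False
    then have n: "real n > 0" by simp
    have "\<bar>u n - L * real n\<bar> = \<bar>u n / real n - L\<bar> * real n"
      using n by (simp add: abs_mult[symmetric] field_simps)
    also have "\<dots> \<le> \<epsilon> * real n" using N[of n] False n by (intro mult_right_mono) auto
    finally show ?thesis using C by linarith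
  qed
  with C show "\<exists>C\<ge>0. \<forall>n. \<forall>s\<in>S. \<bar>u n - L * real n\<bar> \<le> \<epsilon> * real n + C" by blast
qed

lemma limsup_eq_of_diff_tendsto_0:
  fixes a b :: "nat \<Rightarrow> real"
  assumes "(\<lambda>n. a n - b n) \<longlonglongrightarrow> 0"
  shows "limsup (\<lambda>n. ereal (a n)) = limsup (\<lambda>n. ereal (b n))"
proof -
  have "(\<lambda>n. ereal (a n - b n)) \<longlonglongrightarrow> ereal 0" using assms by simp
  then have "limsup (\<lambda>n. ereal (a n - b n) + ereal (b n)) = ereal 0 + limsup (\<lambda>n. ereal (b n))"
    by (rule ereal_limsup_lim_add) auto
  then show ?thesis by simp
qed

lemma funpow_mult_fix: "(shift ^^ q) y = y \<Longrightarrow> (shift ^^ (j * q)) y = y"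
  by (induction j) (simp_all add: funpow_add)

lemma funpow_shift_commute: "(shift ^^ m) ((shift ^^ n) y) = (shift ^^ n) ((shift ^^ m) y)"
  by (simp add: funpow_shift ac_simps)

lemma open_prefix_pred: "open {z::point. P (prefix m z)}"
proof -
  have "{z::point. P (prefix m z)} = (\<Union>w\<in>Collect P. {z. prefix m z = w})" by auto
  moreover have "open (\<Union>w\<in>Collect P. {z::point. prefix m z = w})"
    by (rule open_UN) (use open_agree in blast)
  ultimately show ?thesis by simp
qed

lemma closed_prefix_pred: "closed {z::point. P (prefix m z)}"
proof -
  have "- {z::point. P (prefix m z)} = {z. \<not> P (prefix m z)}" by auto
  then show ?thesis unfolding closed_def using open_prefix_pred[of "\<lambda>v. \<not> P v" m] by simp
qed

context one_block_factor
begin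

text \<open>Along multiples of the period, $\log g_n(y)$ is subadditive and Fekete's lemma applies. Other \<open>n\<close> lie
  between two such multiples, and the upper increments from the multiple below and to the multiple
  above suffice.\<close>

lemma periodic_rate:
  assumes y: "y \<in> Y" and q: "q \<ge> 1" "(shift ^^ q) y = y"
  shows "(\<lambda>n. ln (g_fun X \<Phi> f n y) / real n) \<longlonglongrightarrow> fibre_rate X \<Phi> f y"
    and "j \<ge> 1 \<Longrightarrow> fibre_rate X \<Phi> f y \<le> ln (g_fun X \<Phi> f (j * q) y) / real (j * q)"
proof -
  let ?g = "\<lambda>n. ln (g_fun X \<Phi> f n y)"
  obtain B where B: "B \<ge> 0" "\<And>n y. y \<in> Y \<Longrightarrow> \<bar>ln (g_fun X \<Phi> f n y)\<bar> \<le> B * real n"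
    by (rule ln_g_bound) blast
  obtain C where C: "C \<ge> 0"
    "\<And>m n y. y \<in> Y \<Longrightarrow> ln (g_fun X \<Phi> f (m + n) y) \<le> ln (g_fun X \<Phi> f m y) + C * real n"
    by (rule ln_g_upper_increment) blast
  define u where "u = (\<lambda>j. ?g (j * q))"
  have sub: "u (i + j) \<le> u i + u j" for i j
    using ln_g_submult[OF y, of "i * q" "j * q"] funpow_mult_fix[OF q(2)]
    by (simp add: u_def add_mult_distrib)
  have low: "- (B * real q * real j) \<le> u j" for j
    using B(2)[OF y, of "j * q"] by (simp add: u_def abs_le_iff mult.commute mult.left_commute)
  obtain L where L: "(\<lambda>j. u j / real j) \<longlonglongrightarrow> L" "\<And>j. j \<ge> 1 \<Longrightarrow> L \<le> u j / real j"
    using fekete[OF sub low] by blast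
  define c where "c = L / real q"
  have Lc: "L = c * real q" using q by (simp add: c_def)
  have "sublinear {y} (\<lambda>n s. ?g n - c * real n)"
    unfolding sublinear_def
  proof (intro allI impI)
    fix \<epsilon> :: real assume e: "\<epsilon> > 0"
    obtain D where D: "D \<ge> 0" "\<And>j. \<bar>u j - L * real j\<bar> \<le> \<epsilon> * real j + D"
      using sublinearD[OF tendsto_imp_sublinear[OF L(1), of "{y}"] e] by auto
    define E where "E = D + \<epsilon> + C * real q + \<bar>c\<bar> * real q"
    have "\<bar>?g n - c * real n\<bar> \<le> \<epsilon> * real n + E" for n
    proof -
      define d r where "d = n div q" and "r = n mod q"
      have n: "n = d * q + r" and r: "r < q" using q by (auto simp: d_def r_def)
      obtain t where t: "Suc d * q = n + t" "t \<le> q"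
        using n r by (intro that[of "q - r"]) auto
      have dn: "real d \<le> real n" unfolding d_def of_nat_le_iff by (rule div_le_dividend)
      have c1: "\<bar>c * real r\<bar> \<le> \<bar>c\<bar> * real q" "\<bar>c * real t\<bar> \<le> \<bar>c\<bar> * real q"
        unfolding abs_mult using r t by (auto intro!: mult_left_mono)
      have c2: "C * real r \<le> C * real q" "C * real t \<le> C * real q"
        using r t C(1) by (auto intro!: mult_left_mono)
      have "?g n \<le> u d + C * real r" using C(2)[OF y, of "d * q" r] n by (simp add: u_def)
      moreover have "c * real n = L * real d + c * real r" unfolding Lc n by (simp add: algebra_simps)
      moreover have ed: "\<epsilon> * real d \<le> \<epsilon> * real n" using dn e by simp
      ultimately have up: "?g n - c * real n \<le> \<epsilon> * real n + E"
        using D(2)[of d] c1 c2 e unfolding E_def by linarith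
      \<comment> \<open>From below: the next multiple of \<open>q\<close> is reached from \<open>n\<close> by an upper increment.\<close>
      have "u (Suc d) \<le> ?g n + C * real t" using C(2)[OF y, of n t] t by (simp add: u_def)
      moreover have "L * real (Suc d) = c * real n + c * real t"
        unfolding Lc using t(1) by (metis (no_types, opaque_lifting) distrib_left mult.assoc mult.commute of_nat_add of_nat_mult)
      moreover have "\<epsilon> * real (Suc d) \<le> \<epsilon> * real n + \<epsilon>" using ed by (simp add: distrib_left)
      ultimately have "c * real n - ?g n \<le> \<epsilon> * real n + E"
        using D(2)[of "Suc d"] c1 c2 unfolding E_def by linarith
      with up show ?thesis by linarith
    qed
    moreover have "E \<ge> 0" unfolding E_def using D(1) e C(1) by simp
    ultimately show "\<exists>C\<ge>0. \<forall>n. \<forall>s\<in>{y}. \<bar>?g n - c * real n\<bar> \<le> \<epsilon> * real n + C" by blast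
  qed
  then have "(\<lambda>n. (?g n - c * real n) / real n) \<longlonglongrightarrow> 0" by (rule sublinear_tendsto) simp
  then have "(\<lambda>n. (?g n - c * real n) / real n + c) \<longlonglongrightarrow> 0 + c" by (intro tendsto_add) auto
  then have "(\<lambda>n. (?g n - c * real n) / real n + c) \<longlonglongrightarrow> c" by (simp only: add_0)
  then have lim: "(\<lambda>n. ?g n / real n) \<longlonglongrightarrow> c"
  proof (rule Lim_transform_eventually, intro eventually_sequentiallyI[of 1])
    fix n :: nat assume "1 \<le> n"
    then show "(?g n - c * real n) / real n + c = ?g n / real n" by (simp add: field_simps)
  qed
  then have c: "fibre_rate X \<Phi> f y = c" unfolding fibre_rate_def by (rule limI)
  with lim show "(\<lambda>n. ?g n / real n) \<longlonglongrightarrow> fibre_rate X \<Phi> f y" by simp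
  show "fibre_rate X \<Phi> f y \<le> ?g (j * q) / real (j * q)" if "j \<ge> 1"
    using L(2)[OF that] q that unfolding c Lc u_def by (simp add: field_simps)
qed

text \<open>Dropping the first symbols costs a bounded factor, so the rate does not decrease along the orbit; as
  the orbit closes up, it is constant.\<close>

lemma fibre_rate_orbit:
  assumes y: "y \<in> Y" and q: "q \<ge> 1" "(shift ^^ q) y = y"
  shows "fibre_rate X \<Phi> f ((shift ^^ i) y) = fibre_rate X \<Phi> f y"
proof -
  obtain C where C: "C \<ge> 0"
    "\<And>m n y. y \<in> Y \<Longrightarrow> ln (g_fun X \<Phi> f (m + n) y) \<le> C * real m + ln (g_fun X \<Phi> f n ((shift ^^ m) y))"
    by (rule ln_g_upper_increment) blast
  have le: "fibre_rate X \<Phi> f z \<le> fibre_rate X \<Phi> f ((shift ^^ m) z)"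
    if z: "z \<in> Y" "(shift ^^ q) z = z" for z m
  proof -
    have z': "(shift ^^ m) z \<in> Y" "(shift ^^ q) ((shift ^^ m) z) = (shift ^^ m) z"
      using funpow_closed_Y z by (auto simp: funpow_shift_commute[of q])
    have 1: "(\<lambda>n. ln (g_fun X \<Phi> f (n + m) z) / real (n + m)) \<longlonglongrightarrow> fibre_rate X \<Phi> f z"
      using periodic_rate(1)[OF z(1) q(1) z(2)] by (rule LIMSEQ_ignore_initial_segment)
    have "(\<lambda>n. (C * real m + ln (g_fun X \<Phi> f n ((shift ^^ m) z))) / real n) \<longlonglongrightarrow> 0 + fibre_rate X \<Phi> f ((shift ^^ m) z)"
      unfolding add_divide_distrib
      by (intro tendsto_add periodic_rate(1)[OF z'(1) q(1) z'(2)] lim_const_over_n)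
    moreover have "(\<lambda>n. real n / real (n + m)) \<longlonglongrightarrow> 1"
    proof -
      have "(\<lambda>n. 1 - real m * (1 / real (n + m))) \<longlonglongrightarrow> 1 - real m * 0"
        by (intro tendsto_diff tendsto_mult tendsto_const LIMSEQ_ignore_initial_segment[OF lim_1_over_n])
      then have "(\<lambda>n. 1 - real m * (1 / real (n + m))) \<longlonglongrightarrow> 1" by simp
      then show ?thesis
        proof (rule Lim_transform_eventually, intro eventually_sequentiallyI[of 1])
        fix n :: nat assume "1 \<le> n"
        then have "real (n + m) > 0" by simp
        then show "1 - real m * (1 / real (n + m)) = real n / real (n + m)"
          by (simp add: divide_simps del: of_nat_add)
      qed
    qed
    ultimately have "(\<lambda>n. (C * real m + ln (g_fun X \<Phi> f n ((shift ^^ m) z))) / real n * (real n / real (n + m)))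
        \<longlonglongrightarrow> (0 + fibre_rate X \<Phi> f ((shift ^^ m) z)) * 1"
      by (rule tendsto_mult)
    then have "(\<lambda>n. (C * real m + ln (g_fun X \<Phi> f n ((shift ^^ m) z))) / real n * (real n / real (n + m)))
        \<longlonglongrightarrow> fibre_rate X \<Phi> f ((shift ^^ m) z)"
      by (simp only: add_0 mult_1_right)
    then have 2: "(\<lambda>n. (C * real m + ln (g_fun X \<Phi> f n ((shift ^^ m) z))) / real (n + m)) \<longlonglongrightarrow> fibre_rate X \<Phi> f ((shift ^^ m) z)"
    proof (rule Lim_transform_eventually, intro eventually_sequentiallyI[of 1])
      fix n :: nat assume "1 \<le> n"
      then show "(C * real m + ln (g_fun X \<Phi> f n ((shift ^^ m) z))) / real n * (real n / real (n + m)) =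
          (C * real m + ln (g_fun X \<Phi> f n ((shift ^^ m) z))) / real (n + m)" by simp
    qed
    show ?thesis
      by (rule LIMSEQ_le[OF 1 2]) (use C(2)[OF z(1), of m] in \<open>auto intro!: exI[of _ 0] divide_right_mono simp: add.commute\<close>)
  qed
  have 1: "fibre_rate X \<Phi> f y \<le> fibre_rate X \<Phi> f ((shift ^^ i) y)" by (rule le[OF y q(2)])
  have "fibre_rate X \<Phi> f ((shift ^^ i) y) \<le> fibre_rate X \<Phi> f ((shift ^^ (q * i - i)) ((shift ^^ i) y))"
    by (rule le) (use funpow_closed_Y[OF y] q(2) in \<open>auto simp: funpow_shift_commute[of q]\<close>)
  also have "(shift ^^ (q * i - i)) ((shift ^^ i) y) = (shift ^^ (i * q)) y"
  proof -
    have "i \<le> q * i" using q(1) by simp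
    then have "i * q = (q * i - i) + i" by (simp add: mult.commute)
    then show ?thesis by (simp only: funpow_add comp_apply)
  qed
  also have "\<dots> = y" by (rule funpow_mult_fix[OF q(2)])
  finally show ?thesis using 1 by simp
qed

text \<open>By compactness, a word whose continuations follow \<open>y\<close> arbitrarily far is a prefix of a
  genuine preimage of \<open>y\<close>.\<close>

lemma extendable_words:
  assumes y: "y \<in> Y"
  obtains N0 where "\<And>N. N \<ge> N0 \<Longrightarrow> take n ` fibre_words X \<Phi> (n + N) y = fibre_prefixes X \<pi> n y"
proof -
  let ?A = "\<lambda>N. take n ` fibre_words X \<Phi> (n + N) y"
  have A_eq: "?A N = prefix n ` {x \<in> X. prefix (n + N) (\<pi> x) = prefix (n + N) y}" for N
    unfolding fibre_words_eq image_image by (simp add: take_prefix)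
  have anti: "?A N' \<subseteq> ?A N" if "N \<le> N'" for N N'
    unfolding A_eq by (rule image_mono) (use that in \<open>blast intro: prefix_mono_eq add_left_mono\<close>)
  have sub: "fibre_prefixes X \<pi> n y \<subseteq> ?A N" for N
    unfolding A_eq fibre_prefixes_def by (rule image_mono) blast
  have "\<exists>N. w \<notin> ?A N" if w: "w \<notin> fibre_prefixes X \<pi> n y" for w
  proof (rule ccontr)
    assume "\<not> (\<exists>N. w \<notin> ?A N)"
    then have all: "w \<in> ?A N" for N by blast
    let ?F = "\<lambda>N. {z. prefix n z = w \<and> map \<Phi> (prefix (n + N) z) = prefix (n + N) y}"
    have "X \<inter> (\<Inter>N\<in>UNIV. ?F N) \<noteq> {}"
    proof (rule compact_imp_fip_image[OF compact])
      show "closed (?F N)" for N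
        using closed_prefix_pred[of "\<lambda>v. take n v = w \<and> map \<Phi> v = prefix (n + N) y" "n + N"]
        by (simp add: take_prefix)
      fix I :: "nat set" assume I: "finite I" "I \<subseteq> UNIV"
      define M where "M = Max (insert 0 I)"
      obtain x where x: "x \<in> X" "prefix (n + M) (\<pi> x) = prefix (n + M) y" "w = prefix n x"
        using all[of M] unfolding A_eq by blast
      have "x \<in> ?F N" if "N \<in> I" for N
      proof -
        have "N \<le> M" unfolding M_def using I(1) that by simp
        then have "prefix (n + N) (\<pi> x) = prefix (n + N) y" using prefix_mono_eq[OF x(2)] by simp
        then show ?thesis using x(1,3) by (simp add: prefix_factor)
      qed
      then show "X \<inter> (\<Inter>N\<in>I. ?F N) \<noteq> {}" using x(1) by blast
    qed
    then obtain x where x: "x \<in> X" "prefix n x = w" "\<And>N. prefix (n + N) (\<pi> x) = prefix (n + N) y"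
      by (auto simp: prefix_factor)
    have "\<pi> x i = y i" for i using x(3)[of "Suc i"] by (simp add: prefix_eq_iff)
    then have "\<pi> x = y" by (rule ext)
    with w x show False by (auto simp: fibre_prefixes_def)
  qed
  then obtain N where N: "\<And>w. w \<notin> fibre_prefixes X \<pi> n y \<Longrightarrow> w \<notin> ?A (N w)" by metis
  define N0 where "N0 = Max (insert 0 (N ` (words n X)))"
  show ?thesis
  proof (rule that[of N0])
    fix M assume M: "N0 \<le> M"
    have "w \<in> fibre_prefixes X \<pi> n y" if w: "w \<in> ?A M" for w
    proof (rule ccontr)
      assume nw: "w \<notin> fibre_prefixes X \<pi> n y"
      have "w \<in> words n X" using w unfolding A_eq words_eq by auto
      then have "N w \<le> N0" unfolding N0_def using finite_words by simp
      then have "w \<in> ?A (N w)" using anti[of "N w" M] M w by (meson order_trans subsetD)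
      then show False using N[OF nw] by blast
    qed
    then show "?A M = fibre_prefixes X \<pi> n y" using sub by blast
  qed
qed

text \<open>This interpolates between $g_n$, which is the case \<open>N = 0\<close>, and \<open>fibre_sum\<close>, which is reached for large
  \<open>N\<close>. Unlike the latter it reads only finitely many coordinates of \<open>y\<close>.\<close>

definition ext_sum :: "nat \<Rightarrow> nat \<Rightarrow> point \<Rightarrow> real" where
  "ext_sum n N y = (\<Sum>w\<in>take n ` fibre_words X \<Phi> (n + N) y. cylinder_weight X f w)"

lemma ext_words_subset: "take n ` fibre_words X \<Phi> (n + N) y \<subseteq> words n X"
  using take_fibre_words fibre_words_subset by (rule order_trans)

lemma ext_sum_pos: "y \<in> Y \<Longrightarrow> 0 < ext_sum n N y"
  unfolding ext_sum_def
  by (rule sum_weight_pos[OF ext_words_subset]) (simp add: fibre_words_nonempty)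

text \<open>Cutting a word over \<open>y\<close> of length \<open>k * n + N\<close> into blocks of length \<open>n\<close>, every block is
  followed by at least \<open>N\<close> more symbols over the orbit of \<open>y\<close>.\<close>

lemma ln_g_le_sum_ext:
  obtains C where "C \<ge> 0"
    "\<And>k n N y. y \<in> Y \<Longrightarrow> ln (g_fun X \<Phi> f (k * n + N) y) \<le>
       (\<Sum>j<k. ln (ext_sum n N ((shift ^^ (j * n)) y))) + C * real N"
proof -
  obtain C where C: "C \<ge> 0" "\<And>n y. y \<in> Y \<Longrightarrow> \<bar>ln (g_fun X \<Phi> f n y)\<bar> \<le> C * real n"
    by (rule ln_g_bound) blast
  have step: "ln (g_fun X \<Phi> f (n + (k * n + N)) y) \<le>
      ln (ext_sum n N y) + ln (g_fun X \<Phi> f (k * n + N) ((shift ^^ n) y))" if y: "y \<in> Y" for k n N y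
  proof -
    let ?m = "k * n + N"
    have p: "0 < ext_sum n N y" "0 < g_fun X \<Phi> f ?m ((shift ^^ n) y)" "0 < g_fun X \<Phi> f (n + ?m) y"
      using ext_sum_pos g_fun_pos funpow_closed_Y y by blast+
    have "take n ` fibre_words X \<Phi> (n + ?m) y \<subseteq> take n ` fibre_words X \<Phi> (n + N) y"
    proof -
      have "take n ` fibre_words X \<Phi> (n + ?m) y = take n ` take (n + N) ` fibre_words X \<Phi> ((n + N) + k * n) y"
        unfolding image_image by (simp add: ac_simps)
      also have "\<dots> \<subseteq> take n ` fibre_words X \<Phi> (n + N) y" by (intro image_mono take_fibre_words)
      finally show ?thesis .
    qed
    note t = this
    have "g_fun X \<Phi> f (n + ?m) y \<le> (\<Sum>w\<in>take n ` fibre_words X \<Phi> (n + ?m) y. cylinder_weight X f w) *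
      (\<Sum>w\<in>drop n ` fibre_words X \<Phi> (n + ?m) y. cylinder_weight X f w)"
      unfolding g_fun_eq by (rule sum_weight_append[OF fibre_words_subset])
    also have "\<dots> \<le> ext_sum n N y * g_fun X \<Phi> f ?m ((shift ^^ n) y)"
    proof (intro mult_mono)
      show "0 \<le> ext_sum n N y" using p by simp
      show "(\<Sum>w\<in>take n ` fibre_words X \<Phi> (n + ?m) y. cylinder_weight X f w) \<le> ext_sum n N y"
        unfolding ext_sum_def by (rule sum_weight_mono[OF t ext_words_subset])
      show "(\<Sum>w\<in>drop n ` fibre_words X \<Phi> (n + ?m) y. cylinder_weight X f w) \<le> g_fun X \<Phi> f ?m ((shift ^^ n) y)"
        unfolding g_fun_eq by (rule sum_weight_mono[OF drop_fibre_words fibre_words_subset])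
      show "0 \<le> (\<Sum>w\<in>drop n ` fibre_words X \<Phi> (n + ?m) y. cylinder_weight X f w)"
        by (rule sum_nonneg) (use drop_fibre_words fibre_weight_nonneg in blast)
    qed
    finally show ?thesis using p by (simp flip: ln_mult_pos)
  qed
  have "ln (g_fun X \<Phi> f (k * n + N) y) \<le> (\<Sum>j<k. ln (ext_sum n N ((shift ^^ (j * n)) y))) + C * real N"
    if "y \<in> Y" for k n N y
    using that
  proof (induction k arbitrary: y)
    case 0
    then show ?case using C(2)[of y N] by simp
  next
    case (Suc k)
    have eq: "(shift ^^ (j * n)) ((shift ^^ n) y) = (shift ^^ (Suc j * n)) y" for j
      by (simp add: funpow_shift ac_simps)
    have "ln (g_fun X \<Phi> f (Suc k * n + N) y) \<le> ln (ext_sum n N y) + ln (g_fun X \<Phi> f (k * n + N) ((shift ^^ n) y))"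
      using step[OF Suc.prems, of n k N] by (simp add: ac_simps)
    moreover have "ln (g_fun X \<Phi> f (k * n + N) ((shift ^^ n) y)) \<le>
        (\<Sum>j<k. ln (ext_sum n N ((shift ^^ (Suc j * n)) y))) + C * real N"
      using Suc.IH[OF funpow_closed_Y[OF Suc.prems, of n]] unfolding eq .
    moreover have "ln (ext_sum n N y) + (\<Sum>j<k. ln (ext_sum n N ((shift ^^ (Suc j * n)) y))) =
        (\<Sum>j<Suc k. ln (ext_sum n N ((shift ^^ (j * n)) y)))"
      by (subst sum.lessThan_Suc_shift) simp
    ultimately show ?case by linarith
  qed
  then show ?thesis using that C(1) by blast
qed

text \<open>A long word over the periodic point is cut into blocks whose length is a multiple of the period. All
  blocks lie over the same prefix, and each continues far enough to be a prefix of a full preimage.\<close>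

lemma fibre_rate_le_fibre_sum:
  assumes y: "y \<in> Y" and q: "q \<ge> 1" "(shift ^^ q) y = y" and j: "j \<ge> 1"
  shows "fibre_rate X \<Phi> f y \<le> ln (fibre_sum X \<pi> f (j * q) y) / real (j * q)"
proof -
  let ?n = "j * q" and ?r = "fibre_rate X \<Phi> f y"
  obtain N0 where N0: "\<And>N. N \<ge> N0 \<Longrightarrow> take ?n ` fibre_words X \<Phi> (?n + N) y = fibre_prefixes X \<pi> ?n y"
    by (rule extendable_words[OF y]) blast
  \<comment> \<open>A multiple of \<open>q\<close>, so that the total length \<open>k * ?n + N\<close> is one as well.\<close>
  define N where "N = N0 * q"
  have "N0 \<le> N" using q by (simp add: N_def)
  then have e: "ext_sum ?n N y = fibre_sum X \<pi> f ?n y"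
    unfolding ext_sum_def fibre_sum_def by (simp add: N0)
  obtain C where C: "C \<ge> 0" "\<And>k n N y. y \<in> Y \<Longrightarrow> ln (g_fun X \<Phi> f (k * n + N) y) \<le>
       (\<Sum>j<k. ln (ext_sum n N ((shift ^^ (j * n)) y))) + C * real N"
    by (rule ln_g_le_sum_ext) blast
  have "real k * (?r * real ?n - ln (fibre_sum X \<pi> f ?n y)) \<le> C * real N - ?r * real N" if k: "k \<ge> 1" for k
  proof -
    have fx: "(shift ^^ (i * ?n)) y = y" for i
      using funpow_mult_fix[OF q(2), of "i * j"] by (simp add: mult.assoc)
    have eq: "k * ?n + N = (k * j + N0) * q" by (simp add: N_def algebra_simps)
    have "k * j + N0 \<ge> 1" using k j by (cases k; cases j) auto
    moreover from this q have "0 < real ((k * j + N0) * q)" unfolding of_nat_0_less_iff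
      by (intro mult_pos_pos) linarith+
    ultimately have "?r * real (k * ?n + N) \<le> ln (g_fun X \<Phi> f (k * ?n + N) y)"
      using periodic_rate(2)[OF y q, of "k * j + N0"] unfolding eq by (simp only: pos_le_divide_eq)
    also have "\<dots> \<le> real k * ln (fibre_sum X \<pi> f ?n y) + C * real N"
      using C(2)[OF y, of k ?n N] unfolding fx e by simp
    finally show ?thesis by (simp add: algebra_simps)
  qed
  then have "?r * real ?n - ln (fibre_sum X \<pi> f ?n y) \<le> 0" by (rule linear_bound_nonpos)
  moreover have "real ?n > 0" using j q by simp
  ultimately show ?thesis by (simp add: pos_le_divide_eq)
qed

lemma separated_prefix_inj:
  assumes "separated n \<delta> E" "(1/2) ^ K \<le> \<delta>"
  shows "inj_on (prefix (n + K)) E"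
proof (rule inj_onI, rule ccontr)
  fix x x' assume x: "x \<in> E" "x' \<in> E" "prefix (n + K) x = prefix (n + K) x'" "x \<noteq> x'"
  then obtain i where i: "i < n" "shift_dist ((shift ^^ i) x) ((shift ^^ i) x') > \<delta>"
    using assms(1) unfolding separated_def by blast
  have "shift_dist ((shift ^^ i) x) ((shift ^^ i) x') \<le> (1/2) ^ K"
    using x(3) i(1) by (simp add: shift_dist_le_iff funpow_shift prefix_eq_iff)
  then show False using i(2) assms(2) by linarith
qed

text \<open>Since \<open>\<delta> < 1/2\<close>, points with different prefixes of length \<open>n\<close> are separated. Conversely, if
  $2^{-K} \le \delta$, separated points differ in their first \<open>n + K\<close> symbols, and the \<open>K\<close> extra symbols
  change the sums by a bounded factor only.\<close>

lemma rel_pressure_n_sublinear: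
  assumes y: "y \<in> Y" and \<delta>: "0 < \<delta>" "\<delta> < 1/2"
  shows "sublinear {y} (\<lambda>n y. ln (rel_pressure_n X \<pi> f n \<delta> y) - ln (fibre_sum X \<pi> f n y))"
  unfolding sublinear_def
proof (intro allI impI)
  fix \<epsilon> :: real assume e: "\<epsilon> > 0"
  obtain K where K: "(1/2::real) ^ K \<le> \<delta>"
    using real_arch_pow_inv[of \<delta> "1/2"] \<delta>(1) by (auto intro: less_imp_le)
  obtain C where C: "C \<ge> 0"
    "\<And>m n y. y \<in> Y \<Longrightarrow> ln (fibre_sum X \<pi> f (m + n) y) \<le> ln (fibre_sum X \<pi> f m y) + C * real n"
    by (rule ln_g_upper_increment) blast
  obtain D where D: "D \<ge> 0" "\<And>n x x'. x \<in> X \<Longrightarrow> x' \<in> X \<Longrightarrow> prefix n x = prefix n x' \<Longrightarrow>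
       \<bar>birkhoff_sum n f x - birkhoff_sum n f x'\<bar> \<le> \<epsilon> * real n + D"
    by (rule distortion[OF e]) blast
  define B where "B = real K * norm_sup + C * real K"
  have B: "B \<ge> 0" unfolding B_def using norm_sup_nonneg C(1) by simp
  let ?F = "{x \<in> X. \<pi> x = y}"
  have bound: "\<bar>ln (rel_pressure_n X \<pi> f n \<delta> y) - ln (fibre_sum X \<pi> f n y)\<bar> \<le> \<epsilon> * real n + (B + D)" for n
  proof -
    let ?q = "fibre_sum X \<pi> f n y"
    have qpos: "0 < ?q" by (rule fibre_sum_pos[OF y])
    have up: "(\<Sum>x\<in>E. exp (birkhoff_sum n f x)) \<le> exp B * ?q" if E: "E \<subseteq> ?F" "separated n \<delta> E" for E
    proof -
      note inj = separated_prefix_inj[OF E(2) K]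
      have "(\<Sum>x\<in>E. exp (birkhoff_sum n f x)) \<le> (\<Sum>x\<in>E. exp (real K * norm_sup) * cylinder_weight X f (prefix (n + K) x))"
      proof (rule sum_mono)
        fix x assume "x \<in> E"
        then have x: "x \<in> X" using E by auto
        have "birkhoff_sum n f x \<le> real K * norm_sup + birkhoff_sum (n + K) f x"
          using birkhoff_abs[OF funpow_closed[OF x], of K n] by (simp add: birkhoff_sum_add)
        then have "exp (birkhoff_sum n f x) \<le> exp (real K * norm_sup) * exp (birkhoff_sum (n + K) f x)"
          by (simp flip: exp_add)
        also have "\<dots> \<le> exp (real K * norm_sup) * cylinder_weight X f (prefix (n + K) x)"
          using weight_ge[OF x] by simp
        finally show "exp (birkhoff_sum n f x) \<le> exp (real K * norm_sup) * cylinder_weight X f (prefix (n + K) x)" .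
      qed
      also have "\<dots> = exp (real K * norm_sup) * (\<Sum>w\<in>prefix (n + K) ` E. cylinder_weight X f w)"
        by (simp add: sum_distrib_left sum.reindex[OF inj])
      also have "(\<Sum>w\<in>prefix (n + K) ` E. cylinder_weight X f w) \<le> fibre_sum X \<pi> f (n + K) y"
        unfolding fibre_sum_def
        by (rule sum_weight_mono[of _ _ "n + K"])
           (use E fibre_prefixes_subset fibre_words_subset in \<open>auto simp: fibre_prefixes_def intro: prefix_in_words\<close>)
      also have "fibre_sum X \<pi> f (n + K) y \<le> exp (C * real K) * ?q"
      proof -
        have "fibre_sum X \<pi> f (n + K) y = exp (ln (fibre_sum X \<pi> f (n + K) y))"
          using fibre_sum_pos[OF y] by simp
        also have "\<dots> \<le> exp (ln ?q + C * real K)" using C(2)[OF y] by simp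
        finally show ?thesis using qpos by (simp add: exp_add mult.commute)
      qed
      finally show ?thesis by (simp add: B_def exp_add)
    qed
    have Pup: "rel_pressure_n X \<pi> f n \<delta> y \<le> exp B * ?q"
      unfolding rel_pressure_n_def
      by (rule cSUP_least) (use up in \<open>auto simp: separated_def intro!: exI[of _ "{}"]\<close>)
    have "\<exists>x\<in>?F. prefix n x = w" if "w \<in> fibre_prefixes X \<pi> n y" for w
      using that by (auto simp: fibre_prefixes_def)
    then obtain p where p: "\<And>w. w \<in> fibre_prefixes X \<pi> n y \<Longrightarrow> p w \<in> ?F \<and> prefix n (p w) = w" by metis
    let ?E = "p ` fibre_prefixes X \<pi> n y"
    have sep: "separated n \<delta> ?E"
      unfolding separated_def
    proof (intro ballI impI)
      fix x x' assume x: "x \<in> ?E" "x' \<in> ?E" "x \<noteq> x'"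
      then have "prefix n x \<noteq> prefix n x'" using p by auto
      then obtain i where i: "i < n" "x i \<noteq> x' i" by (auto simp: prefix_eq_iff)
      have "\<not> shift_dist ((shift ^^ i) x) ((shift ^^ i) x') \<le> (1/2) ^ 1"
        unfolding shift_dist_le_iff using i by (auto simp: funpow_shift)
      then show "\<exists>i<n. shift_dist ((shift ^^ i) x) ((shift ^^ i) x') > \<delta>" using i \<delta>(2) by auto
    qed
    have inj: "inj_on p (fibre_prefixes X \<pi> n y)" by (rule inj_onI) (metis p)
    have "exp (- (\<epsilon> * real n + D)) * ?q \<le> (\<Sum>w\<in>fibre_prefixes X \<pi> n y. exp (birkhoff_sum n f (p w)))"
      unfolding fibre_sum_def sum_distrib_left
    proof (rule sum_mono)
      fix w assume w: "w \<in> fibre_prefixes X \<pi> n y"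
      then have "w \<in> words n X" using fibre_prefixes_subset fibre_words_subset by blast
      then obtain x where x: "x \<in> X" "prefix n x = w" "cylinder_weight X f w = exp (birkhoff_sum n f x)"
        by (rule weight_attained)
      have "\<bar>birkhoff_sum n f x - birkhoff_sum n f (p w)\<bar> \<le> \<epsilon> * real n + D"
        by (rule D(2)) (use x p[OF w] in auto)
      then show "exp (- (\<epsilon> * real n + D)) * cylinder_weight X f w \<le> exp (birkhoff_sum n f (p w))"
        unfolding x(3) by (simp flip: exp_add)
    qed
    also have "\<dots> = (\<Sum>x\<in>?E. exp (birkhoff_sum n f x))" by (simp add: sum.reindex[OF inj])
    also have "\<dots> \<le> rel_pressure_n X \<pi> f n \<delta> y"
      unfolding rel_pressure_n_def
      by (rule cSUP_upper) (use p sep up in \<open>auto intro!: bdd_aboveI2\<close>)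
    finally have Plo: "exp (- (\<epsilon> * real n + D)) * ?q \<le> rel_pressure_n X \<pi> f n \<delta> y" .
    have Ppos: "0 < rel_pressure_n X \<pi> f n \<delta> y"
      using Plo qpos by (meson exp_gt_zero less_le_trans mult_pos_pos)
    have "ln (rel_pressure_n X \<pi> f n \<delta> y) \<le> ln (exp B * ?q)" using Pup Ppos qpos by simp
    moreover have "ln (exp (- (\<epsilon> * real n + D)) * ?q) \<le> ln (rel_pressure_n X \<pi> f n \<delta> y)"
      using Plo Ppos qpos by (subst ln_le_cancel_iff) auto
    ultimately have *: "ln (rel_pressure_n X \<pi> f n \<delta> y) - ln ?q \<le> B"
      "- (\<epsilon> * real n + D) \<le> ln (rel_pressure_n X \<pi> f n \<delta> y) - ln ?q"
      using qpos by (simp_all add: ln_mult_pos)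
    have "0 \<le> \<epsilon> * real n" using e by simp
    with * B D(1) show ?thesis by linarith
  qed
  with B D(1) show "\<exists>C\<ge>0. \<forall>n. \<forall>s\<in>{y}. \<bar>ln (rel_pressure_n X \<pi> f n \<delta> s) - ln (fibre_sum X \<pi> f n s)\<bar> \<le> \<epsilon> * real n + C"
    by (intro exI[of _ "B + D"]) simp
qed

text \<open>The previous estimate does not see \<open>\<delta>\<close> on the exponential scale, so the limit \<open>\<delta> \<rightarrow> 0\<close> is that of an
  eventually constant function.\<close>

lemma rel_pressure_eq:
  assumes y: "y \<in> Y"
  shows "rel_pressure X \<pi> f y = limsup (\<lambda>n. ereal (ln (fibre_sum X \<pi> f n y) / real n))"
proof -
  let ?L = "limsup (\<lambda>n. ereal (ln (fibre_sum X \<pi> f n y) / real n))"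
  have "rel_pressure_delta X \<pi> f \<delta> y = ?L" if "0 < \<delta>" "\<delta> < 1/2" for \<delta>
    unfolding rel_pressure_delta_def
    by (rule limsup_eq_of_diff_tendsto_0)
       (use sublinear_tendsto[OF rel_pressure_n_sublinear[OF y that]] in \<open>simp add: diff_divide_distrib\<close>)
  then have "eventually (\<lambda>\<delta>. rel_pressure_delta X \<pi> f \<delta> y = ?L) (at_right 0)"
    unfolding eventually_at_right_field by (intro exI[of _ "1/2"]) auto
  then have "((\<lambda>\<delta>. rel_pressure_delta X \<pi> f \<delta> y) \<longlongrightarrow> ?L) (at_right 0)"
    by (rule tendsto_eventually)
  then show ?thesis
    unfolding rel_pressure_def by (intro tendsto_Lim) (auto simp: trivial_limit_at_right_real)
qed

text \<open>The words that continue are among all words over \<open>y\<close>; the reverse estimate is available along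
  multiples of the period.\<close>

lemma rel_pressure_periodic:
  assumes y: "y \<in> Y" and q: "q \<ge> 1" "(shift ^^ q) y = y"
  shows "rel_pressure X \<pi> f y = ereal (fibre_rate X \<Phi> f y)"
  unfolding rel_pressure_eq[OF y]
proof (rule antisym)
  let ?a = "\<lambda>n. ereal (ln (fibre_sum X \<pi> f n y) / real n)"
  have "limsup ?a \<le> limsup (\<lambda>n. ereal (ln (g_fun X \<Phi> f n y) / real n))"
  proof (intro Limsup_mono always_eventually allI)
    fix n
    have "ln (fibre_sum X \<pi> f n y) \<le> ln (g_fun X \<Phi> f n y)"
      using fibre_sum_le_g[of n y] fibre_sum_pos[OF y, of n] g_fun_pos[OF y, of n] by simp
    then show "?a n \<le> ereal (ln (g_fun X \<Phi> f n y) / real n)" by (simp add: divide_right_mono)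
  qed
  also have "\<dots> = ereal (fibre_rate X \<Phi> f y)"
    by (rule lim_imp_Limsup) (use periodic_rate(1)[OF y q] in auto)
  finally show "limsup ?a \<le> ereal (fibre_rate X \<Phi> f y)" .
  define r where "r = (\<lambda>j. Suc j * q)"
  have r: "strict_mono r" unfolding r_def by (rule strict_monoI) (use q in auto)
  have "ereal (fibre_rate X \<Phi> f y) \<le> limsup (?a \<circ> r)"
  proof (rule le_Limsup)
    have "fibre_rate X \<Phi> f y \<le> ln (fibre_sum X \<pi> f (r j) y) / real (r j)" for j
      unfolding r_def by (rule fibre_rate_le_fibre_sum[OF y q]) simp
    then show "\<forall>\<^sub>F j in sequentially. ereal (fibre_rate X \<Phi> f y) \<le> (?a \<circ> r) j"
      by (intro always_eventually allI) simp
  qed simp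
  also have "\<dots> \<le> limsup ?a" by (rule limsup_subseq_mono[OF r])
  finally show "ereal (fibre_rate X \<Phi> f y) \<le> limsup ?a" .
qed

end

section \<open>Free concatenation in irreducible shifts of finite type\<close>

definition concat_point :: "nat \<Rightarrow> (nat \<Rightarrow> nat list) \<Rightarrow> point" where
  "concat_point p \<omega> i = \<omega> (i div p) ! (i mod p)"

lemma concat_point_shift:
  "p \<ge> 1 \<Longrightarrow> (shift ^^ (j * p)) (concat_point p \<omega>) = concat_point p (\<lambda>i. \<omega> (i + j))"
  by (simp add: funpow_shift concat_point_def fun_eq_iff add.commute)

lemma concat_point_prefix:
  "length (\<omega> 0) = p \<Longrightarrow> prefix p (concat_point p \<omega>) = \<omega> 0"
  by (rule nth_equalityI) (auto simp: concat_point_def)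

lemma concat_point_block:
  assumes "p \<ge> 1" "length (\<omega> j) = p"
  shows "prefix p ((shift ^^ (j * p)) (concat_point p \<omega>)) = \<omega> j"
  using concat_point_prefix[of "\<lambda>i. \<omega> (i + j)"] assms by (simp add: concat_point_shift)

lemma one_step_SFT_transitions:
  assumes "one_step_SFT X"
  shows "subshift X" "\<exists>R. X = {x. \<forall>i. R (x i) (x (Suc i))}"
proof -
  obtain k F where k: "k \<ge> 1" and F: "\<And>w. w \<in> F \<Longrightarrow> length w \<le> 2"
    and X: "X = {x. (\<forall>i. x i \<in> {1..k}) \<and> (\<forall>w\<in>F. \<not> occurs w x)}"
    using assms unfolding one_step_SFT_def by auto
  \<comment> \<open>The empty word occurs in every sequence: forbidding it makes the shift empty.\<close>
  define R where "R = (\<lambda>a b. a \<in> {1..k} \<and> [] \<notin> F \<and> [a] \<notin> F \<and> [a, b] \<notin> F)"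
  have occ: "occurs [] x" "occurs [a] x \<longleftrightarrow> (\<exists>i. x i = a)"
    "occurs [a, b] x \<longleftrightarrow> (\<exists>i. x i = a \<and> x (Suc i) = b)" for a b and x :: point
    unfolding occurs_def by (auto simp: upt_rec)
  have cases: "w = [] \<or> (\<exists>a. w = [a]) \<or> (\<exists>a b. w = [a, b])" if "w \<in> F" for w
  proof (cases w)
    case (Cons a v)
    then show ?thesis using F[OF that] by (cases v) auto
  qed simp
  have XR: "X = {x. \<forall>i. R (x i) (x (Suc i))}"
  proof (intro set_eqI iffI)
    fix x assume "x \<in> X"
    then show "x \<in> {x. \<forall>i. R (x i) (x (Suc i))}"
      unfolding X R_def using occ by blast
  next
    fix x assume "x \<in> {x. \<forall>i. R (x i) (x (Suc i))}"
    then have R: "R (x i) (x (Suc i))" for i by blast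
    have "\<not> occurs w x" if "w \<in> F" for w
      using cases[OF that] that R occ unfolding R_def by metis
    then show "x \<in> X" unfolding X using R unfolding R_def by blast
  qed
  then show "\<exists>R. X = {x. \<forall>i. R (x i) (x (Suc i))}" by blast
  have "closed {x::point. R (x i) (x (Suc i))}" for i
    using closed_prefix_pred[of "\<lambda>w. R (w ! i) (w ! Suc i)" "Suc (Suc i)"] by simp
  then have "closed (\<Inter>i. {x::point. R (x i) (x (Suc i))})" by (intro closed_INT) auto
  moreover have "(\<Inter>i. {x::point. R (x i) (x (Suc i))}) = X" unfolding XR by auto
  ultimately have "closed X" by simp
  moreover have "shift ` X \<subseteq> X" unfolding XR shift_def by auto
  ultimately show "subshift X" unfolding subshift_def using k X by auto
qed

text \<open>Admissibility in a one-step shift only concerns neighbouring symbols. Hence one fixed word leading from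
  \<open>b\<close> back to \<open>a\<close> makes all blocks that begin with \<open>a\<close> and end with \<open>b\<close> freely concatenable.\<close>

lemma connecting_words:
  assumes sft: "one_step_SFT X" and irr: "irreducible_shift X"
  obtains L :: nat and c :: "nat \<Rightarrow> nat \<Rightarrow> nat list" where
    "\<And>a b. length (c a b) \<le> L"
    "\<And>a b n V \<omega>. n \<ge> 1 \<Longrightarrow> V \<subseteq> {w \<in> words n X. hd w = a \<and> last w = b} \<Longrightarrow> (\<And>i. \<omega> i \<in> V) \<Longrightarrow>
       concat_point (n + length (c a b)) (\<lambda>i. \<omega> i @ c a b) \<in> X"
proof (cases "X = {}")
  case True
  show ?thesis
  proof (rule that[of "\<lambda>_ _. []" 0])
    fix a b n V \<omega> assume "n \<ge> (1::nat)" "V \<subseteq> {w \<in> words n X. hd w = a \<and> last w = b}" "\<And>i::nat. \<omega> i \<in> V"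
    then have "\<omega> 0 \<in> words n X" by blast
    then show "concat_point (n + length []) (\<lambda>i. \<omega> i @ []) \<in> X"
      using \<open>n \<ge> 1\<close> True by (auto simp: words_def lang_def)
  qed simp
next
  case False
  note sub = one_step_SFT_transitions(1)[OF sft]
  obtain R where XR: "X = {x. \<forall>i. R (x i) (x (Suc i))}"
    using one_step_SFT_transitions(2)[OF sft] by blast
  have sc: "shift ` X \<subseteq> X" using sub by (simp add: subshift_def)
  obtain k where k: "\<forall>x\<in>X. \<forall>i. x i \<in> {1..k}" using sub unfolding subshift_def by auto
  have succ: "successively R (prefix n x)" if "x \<in> X" for n x
    using that unfolding XR successively_conv_nth by simp
  have "\<exists>c. successively R ([b] @ c @ [a])" if ab: "[a] \<in> lang X" "[b] \<in> lang X" for a b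
  proof -
    obtain c where "[b] @ c @ [a] \<in> lang X" using irr ab unfolding irreducible_shift_def by blast
    then have "[b] @ c @ [a] \<in> words (length ([b] @ c @ [a])) X" by (simp add: words_def)
    then obtain x where "x \<in> X" "[b] @ c @ [a] = prefix (length ([b] @ c @ [a])) x"
      unfolding words_eq_prefixes[OF sc False] by blast
    then show ?thesis using succ by metis
  qed
  then obtain c0 where c0: "\<And>a b. [a] \<in> lang X \<Longrightarrow> [b] \<in> lang X \<Longrightarrow> successively R ([b] @ c0 a b @ [a])"
    by metis
  \<comment> \<open>Outside the alphabet the empty word keeps the lengths bounded.\<close>
  define c where "c a b = (if a \<in> {1..k} \<and> b \<in> {1..k} then c0 a b else [])" for a b
  define L where "L = Max ((\<lambda>(a, b). length (c0 a b)) ` ({1..k} \<times> {1..k}) \<union> {0})"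
  have L: "length (c a b) \<le> L" for a b
    unfolding c_def L_def by (auto intro!: Max_ge)
  show ?thesis
  proof (rule that[OF L])
    fix a b n V \<omega>
    assume n: "n \<ge> (1::nat)" and V: "V \<subseteq> {w \<in> words n X. hd w = a \<and> last w = b}"
      and \<omega>: "\<And>i::nat. \<omega> i \<in> V"
    let ?v = "\<lambda>i. \<omega> i @ c a b"
    have w: "\<omega> i \<in> words n X" "hd (\<omega> i) = a" "last (\<omega> i) = b" "length (\<omega> i) = n" "\<omega> i \<noteq> []"
      "successively R (\<omega> i)" for i
    proof -
      show 1: "\<omega> i \<in> words n X" "hd (\<omega> i) = a" "last (\<omega> i) = b" using \<omega> V by auto
      then show 2: "length (\<omega> i) = n" by (simp add: words_def)
      with n show "\<omega> i \<noteq> []" by auto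
      show "successively R (\<omega> i)" using 1(1) succ unfolding words_eq_prefixes[OF sc False] by auto
    qed
    obtain x where x: "x \<in> X" "\<omega> 0 = prefix n x" using w(1)[of 0] unfolding words_eq_prefixes[OF sc False] by auto
    have ab: "a = x 0" "b = x (n - 1)"
      using w(2,3,5)[of 0] n unfolding x(2) by (auto simp: hd_conv_nth last_conv_nth)
    have "[a] = prefix 1 x" "[b] = prefix 1 ((shift ^^ (n - 1)) x)"
      unfolding ab by (auto simp: prefix_def funpow_shift)
    then have "[a] \<in> lang X" "[b] \<in> lang X"
      using prefix_in_words[OF x(1), of 1] prefix_in_words[OF shift_closed_funpow[OF sc x(1)], of 1 "n - 1"]
      by (auto simp: words_def)
    moreover have "a \<in> {1..k}" "b \<in> {1..k}" unfolding ab using k x(1) by blast+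
    ultimately have s: "successively R ([b] @ c a b @ [a])" using c0 by (simp add: c_def)
    then have s1: "successively R (([b] @ c a b) @ [a])" by simp
    have block: "successively R (?v i)" for i
      using s w(3,5,6)[of i] unfolding successively_append_iff by (auto simp: hd_append split: if_splits)
    have link: "R (last (?v i)) (hd (?v j))" for i j
      using s1 w(2,3,5) unfolding successively_append_iff by (auto simp: last_append)
    let ?p = "n + length (c a b)"
    have p: "?p \<ge> 1" "length (?v i) = ?p" for i using n w(4) by auto
    show "concat_point ?p ?v \<in> X"
      unfolding XR
    proof (intro CollectI allI)
      fix i
      let ?d = "i div ?p" and ?r = "i mod ?p"
      have r: "?r < ?p" using p(1) by (intro mod_less_divisor) linarith
      show "R (concat_point ?p ?v i) (concat_point ?p ?v (Suc i))"
      proof (cases "Suc ?r < ?p")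
        case True
        then have "Suc i mod ?p = Suc ?r" by (simp add: mod_Suc)
        moreover from True have "Suc i div ?p = ?d" by (simp add: div_Suc \<open>Suc i mod ?p = Suc ?r\<close>)
        ultimately show ?thesis
          using block[of ?d] True p(2)[of ?d] unfolding concat_point_def successively_conv_nth by metis
      next
        case False
        then have e: "?r = ?p - 1" using r by linarith
        then have "Suc i mod ?p = 0" using p(1) by (simp add: mod_Suc)
        moreover from this have "Suc i div ?p = Suc ?d" by (simp add: div_Suc)
        ultimately show ?thesis
          using link[of ?d "Suc ?d"] p w(5) e unfolding concat_point_def
          by (simp add: last_conv_nth hd_conv_nth)
      qed
    qed
  qed
qed

lemma pigeonhole_sum:
  fixes s :: "'a \<Rightarrow> real"
  assumes "finite A" "finite K" "K \<noteq> {}" "\<kappa> ` A \<subseteq> K"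
  obtains k where "k \<in> K" "sum s A \<le> real (card K) * sum s {x \<in> A. \<kappa> x = k}"
proof -
  have "\<exists>k\<in>K. sum s A / card K \<le> sum s {x \<in> A. \<kappa> x = k}"
  proof (rule ccontr)
    assume "\<not> ?thesis"
    then have "(\<Sum>k\<in>K. sum s {x \<in> A. \<kappa> x = k}) < (\<Sum>k\<in>K. sum s A / card K)"
      using assms by (intro sum_strict_mono) auto
    also have "\<dots> = sum s A" using assms by simp
    also have "(\<Sum>k\<in>K. sum s {x \<in> A. \<kappa> x = k}) = sum s A" by (rule sum.group[OF assms(1,2,4)])
    finally show False by simp
  qed
  then obtain k where "k \<in> K" "sum s A / card K \<le> sum s {x \<in> A. \<kappa> x = k}" by blast
  with that assms show ?thesis by (simp add: field_simps card_gt_0_iff)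
qed

locale sft_factor = one_block_factor X f Y \<pi> \<Phi> for X f Y \<pi> \<Phi> +
  assumes sft: "one_step_SFT X" and irreducible: "irreducible_shift X"
begin

text \<open>The words over $y_1 \dots y_n$ with the most favourable pair of end symbols carry a fixed proportion of
  $g_n(y)$. Concatenated freely, they all lie over one periodic point \<open>y'\<close>, where the weights of the
  concatenations multiply.\<close>

lemma periodic_approximation:
  assumes e: "\<epsilon> > 0"
  obtains C :: real and L :: nat where "C \<ge> 0"
    "\<And>n y. n \<ge> 1 \<Longrightarrow> y \<in> Y \<Longrightarrow> \<exists>y' q. y' \<in> Y \<and> n \<le> q \<and> q \<le> n + L \<and> (shift ^^ q) y' = y' \<and>
       prefix n y' = prefix n y \<and>
       (\<forall>j. real j * (ln (g_fun X \<Phi> f n y) - \<epsilon> * real n - C) \<le> ln (g_fun X \<Phi> f (j * q) y'))"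
proof -
  obtain L c where L: "\<And>a b. length (c a b) \<le> L" and c:
    "\<And>a b n V \<omega>. n \<ge> 1 \<Longrightarrow> V \<subseteq> {w \<in> words n X. hd w = a \<and> last w = b} \<Longrightarrow> (\<And>i. \<omega> i \<in> V) \<Longrightarrow>
       concat_point (n + length (c a b)) (\<lambda>i. \<omega> i @ c a b) \<in> X"
    by (rule connecting_words[OF sft irreducible]) blast
  obtain D where D: "D \<ge> 0" "\<And>n x x'. x \<in> X \<Longrightarrow> x' \<in> X \<Longrightarrow> prefix n x = prefix n x' \<Longrightarrow>
       \<bar>birkhoff_sum n f x - birkhoff_sum n f x'\<bar> \<le> \<epsilon> * real n + D"
    by (rule distortion[OF e]) blast
  obtain k where k: "k \<ge> 1" "\<forall>x\<in>X. \<forall>i. x i \<in> {1..k}" using subshift unfolding subshift_def by auto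
  define K where "K = {1..k} \<times> {1..k}"
  have K: "finite K" "K \<noteq> {}" "card K \<ge> 1" using k(1) by (auto simp: K_def Suc_le_eq card_gt_0_iff)
  \<comment> \<open>Distortion within the blocks, the connecting words, and the choice of the end symbols.\<close>
  define C where "C = D + real L * norm_sup + ln (real (card K))"
  have "C \<ge> 0" unfolding C_def using D(1) norm_sup_nonneg K(3) by simp
  moreover have "\<exists>y' q. y' \<in> Y \<and> n \<le> q \<and> q \<le> n + L \<and> (shift ^^ q) y' = y' \<and> prefix n y' = prefix n y \<and>
       (\<forall>j. real j * (ln (g_fun X \<Phi> f n y) - \<epsilon> * real n - C) \<le> ln (g_fun X \<Phi> f (j * q) y'))"
    if n: "n \<ge> 1" and y: "y \<in> Y" for n y
  proof -
    let ?W = "fibre_words X \<Phi> n y" and ?c = "cylinder_weight X f"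
    have "(\<lambda>w. (hd w, last w)) ` ?W \<subseteq> K"
    proof
      fix ab assume "ab \<in> (\<lambda>w. (hd w, last w)) ` ?W"
      then obtain x where "x \<in> X" "ab = (hd (prefix n x), last (prefix n x))"
        unfolding fibre_words_eq by auto
      moreover have "prefix n x \<noteq> []" using n by (metis length_prefix list.size(3) not_one_le_zero)
      ultimately show "ab \<in> K" using k(2) n by (simp add: K_def hd_conv_nth last_conv_nth)
    qed
    then obtain ab where ab: "sum ?c ?W \<le> real (card K) * sum ?c {w \<in> ?W. (hd w, last w) = ab}"
      by (rule pigeonhole_sum[OF finite_fibre_words K(1,2)])
    obtain a b where ab_eq: "ab = (a, b)" by fastforce
    define V where "V = {w \<in> ?W. hd w = a \<and> last w = b}"
    have gV: "g_fun X \<Phi> f n y \<le> real (card K) * sum ?c V"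
      using ab unfolding g_fun_eq ab_eq V_def by simp
    have V: "V \<subseteq> {w \<in> words n X. hd w = a \<and> last w = b}"
      unfolding V_def using fibre_words_subset by blast
    have Vne: "V \<noteq> {}" using gV g_fun_pos[OF y, of n] by auto
    then obtain w0 where w0: "w0 \<in> V" by blast
    have finV: "finite V" unfolding V_def using finite_fibre_words by simp
    have lenV: "length w = n" "map \<Phi> w = prefix n y" if "w \<in> V" for w
      using that by (auto simp: V_def fibre_words_def words_def)
    define q where "q = n + length (c a b)"
    have q: "n \<le> q" "q \<le> n + L" "q \<ge> 1" using L n by (auto simp: q_def)
    define y' where "y' = concat_point q (\<lambda>_. prefix n y @ map \<Phi> (c a b))"
    define P where "P \<omega> = concat_point q (\<lambda>i. \<omega> i @ c a b)" for \<omega>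
    have P: "P \<omega> \<in> X" "\<pi> (P \<omega>) = y'" "\<And>j. prefix n ((shift ^^ (j * q)) (P \<omega>)) = \<omega> j"
      if \<omega>: "\<And>i. \<omega> i \<in> V" for \<omega>
    proof -
      show PX: "P \<omega> \<in> X" unfolding P_def q_def by (rule c[OF n V \<omega>])
      show "\<pi> (P \<omega>) = y'"
      proof
        fix i
        have i: "i mod q < q" using q(3) by simp
        have "\<pi> (P \<omega>) i = \<Phi> ((\<omega> (i div q) @ c a b) ! (i mod q))"
          using block PX unfolding one_block_def P_def concat_point_def by simp
        also have "\<dots> = map \<Phi> (\<omega> (i div q) @ c a b) ! (i mod q)"
          using i lenV(1)[OF \<omega>, of "i div q"] by (subst nth_map) (auto simp: q_def)
        also have "map \<Phi> (\<omega> (i div q) @ c a b) = prefix n y @ map \<Phi> (c a b)"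
          using lenV(2)[OF \<omega>] by simp
        finally show "\<pi> (P \<omega>) i = y' i" by (simp add: y'_def concat_point_def)
      qed
      fix j
      have "prefix q ((shift ^^ (j * q)) (P \<omega>)) = \<omega> j @ c a b"
        unfolding P_def by (rule concat_point_block) (use q lenV(1)[OF \<omega>] in \<open>auto simp: q_def\<close>)
      then show "prefix n ((shift ^^ (j * q)) (P \<omega>)) = \<omega> j"
        using lenV(1)[OF \<omega>, of j] by (simp add: q_def prefix_add)
    qed
    have P0: "P (\<lambda>_. w0) \<in> X" "\<pi> (P (\<lambda>_. w0)) = y'" using P[of "\<lambda>_. w0"] w0 by auto
    have y'Y: "y' \<in> Y" using P0 factor_in by blast
    have per: "(shift ^^ q) y' = y'"
      using concat_point_shift[OF q(3), of 1] by (simp add: y'_def)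
    have pre: "prefix n y' = prefix n y"
      using P[of "\<lambda>_. w0"] w0 prefix_factor[OF P0(1), of n] P(3)[of "\<lambda>_. w0" 0] lenV(2)[OF w0] by simp
    have main: "real j * (ln (g_fun X \<Phi> f n y) - \<epsilon> * real n - C) \<le> ln (g_fun X \<Phi> f (j * q) y')" for j
    proof -
      define \<beta> where "\<beta> = exp (- (\<epsilon> * real n + D + real L * norm_sup))"
      \<comment> \<open>Only \<open>j\<close> blocks are counted; any block of \<open>V\<close> completes them to a point.\<close>
      define ext where "ext \<omega> i = (if i < j then \<omega> i else w0)" for \<omega> :: "nat \<Rightarrow> nat list" and i
      let ?\<Omega> = "PiE {..<j} (\<lambda>_. V)"
      have extV: "ext \<omega> i \<in> V" if "\<omega> \<in> ?\<Omega>" for \<omega> i using that w0 by (auto simp: ext_def)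
      have fin\<Omega>: "finite ?\<Omega>" using finV by (intro finite_PiE) auto
      let ?h = "\<lambda>\<omega>. prefix (j * q) (P (ext \<omega>))"
      have inj: "inj_on ?h ?\<Omega>"
      proof (rule inj_onI)
        fix \<omega> \<omega>' assume o: "\<omega> \<in> ?\<Omega>" "\<omega>' \<in> ?\<Omega>" "?h \<omega> = ?h \<omega>'"
        show "\<omega> = \<omega>'"
        proof (rule PiE_ext[OF o(1,2)])
          fix i assume i: "i \<in> {..<j}"
          have "i * q + n \<le> Suc i * q" using q by simp
          also have "\<dots> \<le> j * q" using i by (intro mult_le_mono1) simp
          finally have "prefix (i * q + n) (P (ext \<omega>)) = prefix (i * q + n) (P (ext \<omega>'))"
            using prefix_mono_eq[OF o(3)] by blast
          then have "prefix n ((shift ^^ (i * q)) (P (ext \<omega>))) = prefix n ((shift ^^ (i * q)) (P (ext \<omega>')))"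
            by (metis drop_prefix)
          then have "ext \<omega> i = ext \<omega>' i" using P(3)[of "ext \<omega>"] P(3)[of "ext \<omega>'"] extV o by metis
          then show "\<omega> i = \<omega>' i" using i by (simp add: ext_def)
        qed
      qed
      have "(\<beta> * sum ?c V) ^ j = (\<Prod>i<j. \<Sum>w\<in>V. \<beta> * ?c w)" by (simp add: sum_distrib_left)
      also have "\<dots> = (\<Sum>\<omega>\<in>?\<Omega>. \<Prod>i<j. \<beta> * ?c (\<omega> i))" by (rule prod_sum_PiE) (use finV in auto)
      also have "\<dots> \<le> (\<Sum>\<omega>\<in>?\<Omega>. ?c (?h \<omega>))"
      proof (rule sum_mono)
        fix \<omega> assume o: "\<omega> \<in> ?\<Omega>"
        let ?x = "P (ext \<omega>)"
        have x: "?x \<in> X" "\<And>i. prefix n ((shift ^^ (i * q)) ?x) = ext \<omega> i" using P[of "ext \<omega>"] extV[OF o] by auto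
        have "(\<Prod>i<j. \<beta> * ?c (\<omega> i)) \<le> (\<Prod>i<j. exp (birkhoff_sum q f ((shift ^^ (i * q)) ?x)))"
        proof (rule prod_mono, rule conjI)
          fix i assume i: "i \<in> {..<j}"
          have ww: "\<omega> i \<in> words n X" using o i V by auto
          then show "0 \<le> \<beta> * ?c (\<omega> i)" using weight_pos by (simp add: \<beta>_def less_imp_le)
          obtain x' where x': "x' \<in> X" "prefix n x' = \<omega> i" "?c (\<omega> i) = exp (birkhoff_sum n f x')"
            by (rule weight_attained[OF ww])
          let ?z = "(shift ^^ (i * q)) ?x"
          have z: "?z \<in> X" by (rule funpow_closed[OF x(1)])
          have "\<bar>birkhoff_sum n f x' - birkhoff_sum n f ?z\<bar> \<le> \<epsilon> * real n + D"
            by (rule D(2)[OF x'(1) z]) (use x'(2) x(2)[of i] i in \<open>simp add: ext_def\<close>)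
          moreover have "\<bar>birkhoff_sum (length (c a b)) f ((shift ^^ n) ?z)\<bar> \<le> real L * norm_sup"
            using birkhoff_abs[OF funpow_closed[OF z], of "length (c a b)" n]
              mult_right_mono[of "real (length (c a b))" "real L" norm_sup] L norm_sup_nonneg by fastforce
          ultimately have "birkhoff_sum n f x' - (\<epsilon> * real n + D + real L * norm_sup) \<le> birkhoff_sum q f ?z"
            unfolding q_def birkhoff_sum_add by linarith
          then show "\<beta> * ?c (\<omega> i) \<le> exp (birkhoff_sum q f ?z)"
            unfolding x'(3) \<beta>_def by (simp flip: exp_add)
        qed
        also have "\<dots> = exp (birkhoff_sum (j * q) f ?x)"
          by (simp add: birkhoff_sum_mult exp_sum)
        also have "\<dots> \<le> ?c (?h \<omega>)" by (rule weight_ge[OF x(1)])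
        finally show "(\<Prod>i<j. \<beta> * ?c (\<omega> i)) \<le> ?c (?h \<omega>)" .
      qed
      also have "\<dots> = sum ?c (?h ` ?\<Omega>)" by (simp add: sum.reindex[OF inj])
      also have "\<dots> \<le> g_fun X \<Phi> f (j * q) y'"
        unfolding g_fun_eq
      proof (rule sum_weight_mono[OF _ fibre_words_subset])
        show "?h ` ?\<Omega> \<subseteq> fibre_words X \<Phi> (j * q) y'"
        proof (rule image_subsetI)
          fix \<omega> assume "\<omega> \<in> ?\<Omega>"
          then have "P (ext \<omega>) \<in> X" "\<pi> (P (ext \<omega>)) = y'" using P(1,2)[of "ext \<omega>"] extV by auto
          then show "?h \<omega> \<in> fibre_words X \<Phi> (j * q) y'" unfolding fibre_words_eq by blast
        qed
      qed
      finally have 1: "(\<beta> * sum ?c V) ^ j \<le> g_fun X \<Phi> f (j * q) y'" .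
      have \<beta>: "\<beta> > 0" by (simp add: \<beta>_def)
      have cV: "sum ?c V > 0" by (rule sum_weight_pos[of V n]) (use V Vne in auto)
      have g: "0 < g_fun X \<Phi> f n y" by (rule g_fun_pos[OF y])
      have "ln (g_fun X \<Phi> f n y) \<le> ln (real (card K) * sum ?c V)" using gV g by simp
      also have "\<dots> = ln (real (card K)) + ln (sum ?c V)" using K(3) cV by (simp add: ln_mult_pos)
      finally have "ln (g_fun X \<Phi> f n y) - \<epsilon> * real n - C \<le> ln (\<beta> * sum ?c V)"
        using \<beta> cV by (simp add: ln_mult_pos C_def \<beta>_def)
      then have "real j * (ln (g_fun X \<Phi> f n y) - \<epsilon> * real n - C) \<le> real j * ln (\<beta> * sum ?c V)"
        by (rule mult_left_mono) simp
      also have "\<dots> = ln ((\<beta> * sum ?c V) ^ j)" using \<beta> cV by (simp add: ln_realpow)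
      also have "\<dots> \<le> ln (g_fun X \<Phi> f (j * q) y')"
        using 1 \<beta> cV g_fun_pos[OF y'Y] by (subst ln_le_cancel_iff) auto
      finally show ?thesis .
    qed
    show ?thesis using y'Y q per pre main by blast
  qed
  ultimately show ?thesis using that by blast
qed

text \<open>An exceptionally large value would be repeated along a nearby periodic point; an exceptionally small
  one would, by submultiplicativity, make the rate of that periodic point negative.\<close>

lemma sublinear_of_periodic:
  assumes per: "\<And>y. y \<in> Y \<Longrightarrow> periodic y \<Longrightarrow> (\<lambda>n. ln (g_fun X \<Phi> f n y) / real n) \<longlonglongrightarrow> 0"
  shows "sublinear Y (\<lambda>n y. ln (g_fun X \<Phi> f n y))"
  unfolding sublinear_def
proof (intro allI impI)
  fix \<epsilon> :: real assume e: "\<epsilon> > 0"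
  obtain C :: real and L :: nat where C: "C \<ge> 0" and approx:
    "\<And>n y. n \<ge> 1 \<Longrightarrow> y \<in> Y \<Longrightarrow> \<exists>y' q. y' \<in> Y \<and> n \<le> q \<and> q \<le> n + L \<and> (shift ^^ q) y' = y' \<and>
       prefix n y' = prefix n y \<and>
       (\<forall>j. real j * (ln (g_fun X \<Phi> f n y) - \<epsilon> * real n - C) \<le> ln (g_fun X \<Phi> f (j * q) y'))"
    by (rule periodic_approximation[OF e]) blast
  obtain B where B: "B \<ge> 0"
    "\<And>m n y. y \<in> Y \<Longrightarrow> ln (g_fun X \<Phi> f (m + n) y) \<le> ln (g_fun X \<Phi> f m y) + B * real n"
    by (rule ln_g_upper_increment) blast
  obtain A where A: "A \<ge> 0" "\<And>n y. y \<in> Y \<Longrightarrow> \<bar>ln (g_fun X \<Phi> f n y)\<bar> \<le> A * real n"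
    by (rule ln_g_bound) blast
  have "\<bar>ln (g_fun X \<Phi> f n y)\<bar> \<le> \<epsilon> * real n + (C + B * real L)" if y: "y \<in> Y" for n y
  proof (cases "n = 0")
    case True
    then show ?thesis using A(2)[OF y, of 0] C B(1) by simp
  next
    case False
    then have n: "n \<ge> 1" by simp
    obtain y' q where y': "y' \<in> Y" "n \<le> q" "q \<le> n + L" "(shift ^^ q) y' = y'" "prefix n y' = prefix n y"
      and growth: "\<And>j. real j * (ln (g_fun X \<Phi> f n y) - \<epsilon> * real n - C) \<le> ln (g_fun X \<Phi> f (j * q) y')"
      using approx[OF n y] by blast
    have q: "q \<ge> 1" using n y'(2) by simp
    have "periodic y'" unfolding periodic_def using q y'(4) by blast
    note lim = per[OF y'(1) this]
    have rate: "fibre_rate X \<Phi> f y' = 0"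
      by (rule LIMSEQ_unique[OF periodic_rate(1)[OF y'(1) q y'(4)] lim])
    have "0 \<le> ln (g_fun X \<Phi> f q y')"
      using periodic_rate(2)[OF y'(1) q y'(4), of 1] q unfolding rate by (simp add: zero_le_divide_iff)
    also have "\<dots> \<le> ln (g_fun X \<Phi> f n y') + B * real (q - n)"
      using B(2)[OF y'(1), of n "q - n"] y'(2) by simp
    also have "ln (g_fun X \<Phi> f n y') = ln (g_fun X \<Phi> f n y)" by (simp add: g_fun_cong[OF y'(5)])
    finally have "0 \<le> ln (g_fun X \<Phi> f n y) + B * real (q - n)" .
    moreover have "B * real (q - n) \<le> B * real L" using y'(3) B(1) by (intro mult_left_mono) auto
    ultimately have low: "- (B * real L) \<le> ln (g_fun X \<Phi> f n y)" by linarith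
    let ?x = "ln (g_fun X \<Phi> f n y) - \<epsilon> * real n - C"
    have "?x \<le> 0"
    proof (rule ccontr)
      assume "\<not> ?x \<le> 0"
      then have x: "?x > 0" by simp
      have "sublinear {y'} (\<lambda>n y. ln (g_fun X \<Phi> f n y') - 0 * real n)"
        by (rule tendsto_imp_sublinear[OF lim])
      moreover have "?x / (2 * real q) > 0" using x q by simp
      ultimately obtain D where D: "\<And>m. \<bar>ln (g_fun X \<Phi> f m y')\<bar> \<le> ?x / (2 * real q) * real m + D"
        using sublinearD by fastforce
      have "real j * (?x / 2) \<le> D" for j
      proof -
        have "?x / (2 * real q) * real (j * q) = real j * ?x / 2" using q by simp
        then show ?thesis using D[of "j * q"] growth[of j] by linarith
      qed
      then have "?x / 2 \<le> 0" by (rule linear_bound_nonpos)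
      with x show False by simp
    qed
    moreover have "0 \<le> \<epsilon> * real n" "0 \<le> B * real L" using e B(1) by auto
    ultimately show ?thesis using low C unfolding abs_le_iff by linarith
  qed
  moreover have "C + B * real L \<ge> 0" using C B(1) by simp
  ultimately show "\<exists>C\<ge>0. \<forall>n. \<forall>y\<in>Y. \<bar>ln (g_fun X \<Phi> f n y)\<bar> \<le> \<epsilon> * real n + C" by blast
qed

end

section \<open>Entropy of finite-valued observables\<close>

text \<open>The entropy of the partition into the level sets of \<open>Z\<close>. With observables in place of partitions, joins
  become pairs and refinements become functions.\<close>

definition ent :: "'a measure \<Rightarrow> ('a \<Rightarrow> 'b) \<Rightarrow> real" where
  "ent M Z = - (\<Sum>v\<in>Z ` space M. measure M (Z -` {v} \<inter> space M) * ln (measure M (Z -` {v} \<inter> space M)))"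

lemma ent_superset:
  assumes "finite S" "Z ` space M \<subseteq> S"
  shows "ent M Z = - (\<Sum>v\<in>S. measure M (Z -` {v} \<inter> space M) * ln (measure M (Z -` {v} \<inter> space M)))"
proof -
  have "(\<Sum>v\<in>Z ` space M. measure M (Z -` {v} \<inter> space M) * ln (measure M (Z -` {v} \<inter> space M))) =
      (\<Sum>v\<in>S. measure M (Z -` {v} \<inter> space M) * ln (measure M (Z -` {v} \<inter> space M)))"
  proof (rule sum.mono_neutral_left[OF assms], intro ballI)
    fix v assume "v \<in> S - Z ` space M"
    then have "Z -` {v} \<inter> space M = {}" by auto
    then show "measure M (Z -` {v} \<inter> space M) * ln (measure M (Z -` {v} \<inter> space M)) = 0" by simp
  qed
  then show ?thesis by (simp add: ent_def)
qed

context prob_space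
begin

lemma ent_eq_entropy:
  assumes "simple_function M Z"
  shows "ent M Z = prob_space.entropy M (exp 1) (count_space (Z ` space M)) Z"
proof -
  interpret information_space M "exp 1" by unfold_locales simp
  show ?thesis
    unfolding entropy_simple_distributed[OF simple_distributedI[OF assms measure_nonneg refl]]
    by (simp add: ent_def log_def)
qed

lemma ent_pair_le:
  assumes "simple_function M Z" "simple_function M W"
  shows "ent M (\<lambda>x. (Z x, W x)) \<le> ent M Z + ent M W"
proof -
  interpret information_space M "exp 1" by unfold_locales simp
  show ?thesis
    using entropy_chain_rule[OF assms] conditional_entropy_less_eq_entropy[OF assms(2,1)]
    by (simp add: ent_eq_entropy assms simple_function_Pair)
qed

lemma ent_comp_le:
  assumes "simple_function M Z"
  shows "ent M (\<lambda>x. F (Z x)) \<le> ent M Z"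
proof -
  interpret information_space M "exp 1" by unfold_locales simp
  have "ent M (F \<circ> Z) \<le> ent M Z"
    using entropy_data_processing[OF assms, of F] assms
    by (simp add: ent_eq_entropy simple_function_compose)
  then show ?thesis by (simp only: comp_def)
qed

lemma ent_cong: "(\<And>x. x \<in> space M \<Longrightarrow> Z x = W x) \<Longrightarrow> ent M Z = ent M W"
proof -
  assume eq: "\<And>x. x \<in> space M \<Longrightarrow> Z x = W x"
  then have "Z ` space M = W ` space M" "\<And>v. Z -` {v} \<inter> space M = W -` {v} \<inter> space M" by auto
  then show ?thesis by (simp add: ent_def)
qed

lemma ent_factor_le:
  assumes "simple_function M W" "\<And>x. x \<in> space M \<Longrightarrow> Z x = F (W x)"
  shows "ent M Z \<le> ent M W"
  using ent_comp_le[OF assms(1), of F] ent_cong[of Z "\<lambda>x. F (W x)"] assms(2) by simp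

lemma sum_prob_fibres: "simple_function M Z \<Longrightarrow> (\<Sum>v\<in>Z ` space M. measure M (Z -` {v} \<inter> space M)) = 1"
proof -
  assume Z: "simple_function M Z"
  have "(\<Sum>v\<in>Z ` space M. measure M (Z -` {v} \<inter> space M)) = measure M (\<Union>v\<in>Z ` space M. Z -` {v} \<inter> space M)"
    by (rule finite_measure_finite_Union[symmetric])
       (use simple_functionD[OF Z] in \<open>auto simp: disjoint_family_on_def\<close>)
  also have "(\<Union>v\<in>Z ` space M. Z -` {v} \<inter> space M) = space M" by auto
  finally show ?thesis by (simp add: prob_space)
qed

lemma ent_nonneg: "simple_function M Z \<Longrightarrow> 0 \<le> ent M Z"
proof -
  have "p * ln p \<le> 0" if "0 \<le> p" "p \<le> 1" for p :: real
    using that by (cases "p = 0") (auto intro: mult_nonneg_nonpos)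
  then show ?thesis unfolding ent_def by (simp add: sum_nonpos)
qed

lemma integral_simple:
  fixes u :: "'b \<Rightarrow> real"
  assumes Z: "simple_function M Z"
  shows "integrable M (\<lambda>x. u (Z x))"
    and "(\<integral>x. u (Z x) \<partial>M) = (\<Sum>v\<in>Z ` space M. u v * measure M (Z -` {v} \<inter> space M))"
proof -
  have eq: "u (Z x) = (\<Sum>v\<in>Z ` space M. u v * indicator (Z -` {v} \<inter> space M) x)" if "x \<in> space M" for x
  proof -
    have "(\<Sum>v\<in>Z ` space M. u v * indicator (Z -` {v} \<inter> space M) x) = (\<Sum>v\<in>Z ` space M. if v = Z x then u v else 0)"
      using that by (intro sum.cong) (auto simp: indicator_def)
    then show ?thesis using that simple_functionD(1)[OF Z] by simp
  qed
  have int: "integrable M (\<lambda>x. u v * indicator (Z -` {v} \<inter> space M) x)" for v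
    by (intro integrable_mult_right integrable_real_indicator simple_functionD(2)[OF Z])
       (simp add: less_top[symmetric])
  show "integrable M (\<lambda>x. u (Z x))"
    by (subst Bochner_Integration.integrable_cong[OF refl eq]) (auto intro: int)
  have "(\<integral>x. u (Z x) \<partial>M) = (\<integral>x. (\<Sum>v\<in>Z ` space M. u v * indicator (Z -` {v} \<inter> space M) x) \<partial>M)"
    by (rule Bochner_Integration.integral_cong[OF refl eq])
  also have "\<dots> = (\<Sum>v\<in>Z ` space M. u v * measure M (Z -` {v} \<inter> space M))"
    using simple_functionD(2)[OF Z] int by (subst Bochner_Integration.integral_sum) auto
  finally show "(\<integral>x. u (Z x) \<partial>M) = (\<Sum>v\<in>Z ` space M. u v * measure M (Z -` {v} \<inter> space M))" .
qed

text \<open>The variational characterisation of finite partition sums, from \<open>ln t \<le> t - 1\<close>.\<close>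

lemma gibbs_inequality:
  assumes Z: "simple_function M Z"
  shows "ent M Z + (\<integral>x. s (Z x) \<partial>M) \<le> ln (\<Sum>v\<in>Z ` space M. exp (s v))"
proof -
  let ?p = "\<lambda>v. measure M (Z -` {v} \<inter> space M)"
  define W where "W = (\<Sum>v\<in>Z ` space M. exp (s v))"
  have fin: "finite (Z ` space M)" by (rule simple_functionD(1)[OF Z])
  have W: "W > 0" unfolding W_def by (rule sum_pos[OF fin]) (use not_empty in auto)
  have "?p v * (s v - ln (?p v) - ln W) \<le> exp (s v) / W - ?p v" for v
  proof (cases "?p v = 0")
    case False
    then have p: "?p v > 0" using measure_nonneg[of M "Z -` {v} \<inter> space M"] by linarith
    have "s v - ln (?p v) - ln W = ln (exp (s v) / (W * ?p v))"
      using p W by (simp add: ln_div ln_mult_pos)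
    also have "\<dots> \<le> exp (s v) / (W * ?p v) - 1" using p W by (intro ln_le_minus_one) simp
    finally have "?p v * (s v - ln (?p v) - ln W) \<le> ?p v * (exp (s v) / (W * ?p v) - 1)"
      by (rule mult_left_mono) simp
    also have "\<dots> = exp (s v) / W - ?p v" using p W by (simp add: field_simps)
    finally show ?thesis .
  qed (use W in simp)
  then have "(\<Sum>v\<in>Z ` space M. ?p v * (s v - ln (?p v) - ln W)) \<le> (\<Sum>v\<in>Z ` space M. exp (s v) / W - ?p v)"
    by (rule sum_mono)
  also have "\<dots> = 0"
    using W sum_prob_fibres[OF Z] by (simp add: sum_subtractf sum_divide_distrib[symmetric] W_def[symmetric])
  finally have "(\<Sum>v\<in>Z ` space M. s v * ?p v) - (\<Sum>v\<in>Z ` space M. ?p v * ln (?p v)) - ln W * (\<Sum>v\<in>Z ` space M. ?p v) \<le> 0"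
    by (simp add: algebra_simps sum_subtractf sum.distrib sum_distrib_left)
  then show ?thesis
    unfolding integral_simple(2)[OF Z] ent_def sum_prob_fibres[OF Z] W_def[symmetric] by simp
qed

text \<open>Both terms come from \<open>ln s \<le> s - 1\<close>, at $s = t^{-1/2}$ for $-t \ln t$ and at $s = (1-t)^{-1}$ for
  $-(1-t) \ln (1-t)$.\<close>

lemma ent_indicator_le:
  assumes "D \<in> sets M"
  shows "simple_function M (\<lambda>x. x \<in> D)" "ent M (\<lambda>x. x \<in> D) \<le> 2 * sqrt (measure M D) + measure M D"
proof -
  have pre: "(\<lambda>x. x \<in> D) -` {True} \<inter> space M = D" "(\<lambda>x. x \<in> D) -` {False} \<inter> space M = space M - D"
    using sets.sets_into_space[OF assms] by auto
  then have "(\<lambda>x. x \<in> D) -` {v} \<inter> space M \<in> sets M" for v using assms by (cases v) auto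
  then show "simple_function M (\<lambda>x. x \<in> D)"
    unfolding simple_function_def using finite_subset[OF subset_UNIV[of "(\<lambda>x. x \<in> D) ` space M"]] by auto
  let ?t = "measure M D"
  have "ent M (\<lambda>x. x \<in> D) = - (?t * ln ?t) + - ((1 - ?t) * ln (1 - ?t))"
    by (subst ent_superset[of UNIV]) (auto simp: UNIV_bool pre prob_compl[OF assms])
  moreover have "- (?t * ln ?t) \<le> 2 * sqrt ?t"
  proof (cases "?t = 0")
    case False
    then have t: "?t > 0" using measure_nonneg[of M D] by linarith
    have "ln (1 / sqrt ?t) \<le> 1 / sqrt ?t" using t ln_le_minus_one[of "1 / sqrt ?t"] by simp
    moreover have "ln (1 / sqrt ?t) = - ln ?t / 2" using t by (simp add: ln_div ln_sqrt)
    ultimately have "- ln ?t \<le> 2 / sqrt ?t" by simp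
    then have "?t * - ln ?t \<le> ?t * (2 / sqrt ?t)" using t by (intro mult_left_mono) auto
    also have "\<dots> = 2 * sqrt ?t" using t by (simp add: field_simps)
    finally show ?thesis by simp
  qed simp
  moreover have "- ((1 - ?t) * ln (1 - ?t)) \<le> ?t"
  proof (cases "?t = 1")
    case False
    then have t: "1 - ?t > 0" using prob_le_1[of D] by linarith
    have "- ln (1 - ?t) = ln (1 / (1 - ?t))" using t by (simp add: ln_div)
    also have "\<dots> \<le> 1 / (1 - ?t) - 1" using t by (intro ln_le_minus_one) simp
    finally have "(1 - ?t) * - ln (1 - ?t) \<le> (1 - ?t) * (1 / (1 - ?t) - 1)"
      using t by (intro mult_left_mono) auto
    also have "\<dots> = ?t" using t by (simp add: field_simps)
    finally show ?thesis by simp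
  qed simp
  ultimately show "ent M (\<lambda>x. x \<in> D) \<le> 2 * sqrt ?t + ?t" by linarith
qed

text \<open>The pattern of memberships is determined by the individual memberships, whose entropies add up.\<close>

lemma ent_membership_le:
  assumes "finite P" "\<And>A. A \<in> P \<Longrightarrow> D A \<in> sets M"
  shows "simple_function M (\<lambda>x. {A \<in> P. x \<in> D A}) \<and>
    ent M (\<lambda>x. {A \<in> P. x \<in> D A}) \<le> (\<Sum>A\<in>P. 2 * sqrt (measure M (D A)) + measure M (D A))"
  using assms
proof (induction P rule: finite_induct)
  case empty
  have "(\<lambda>x. {}) -` {{}} \<inter> space M = space M" by auto
  then have "ent M (\<lambda>x. {} :: 'b set) = 0"
    by (subst ent_superset[of "{{}}"]) (auto simp: prob_space)
  then show ?case by simp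
next
  case (insert B P)
  let ?e = "\<lambda>x. {A \<in> P. x \<in> D A}" and ?e' = "\<lambda>x. {A \<in> insert B P. x \<in> D A}"
  have IH: "simple_function M ?e" "ent M ?e \<le> (\<Sum>A\<in>P. 2 * sqrt (measure M (D A)) + measure M (D A))"
    using insert by auto
  note B = ent_indicator_le[OF insert.prems[of B, simplified]]
  have eq: "?e' x = (\<lambda>(E, b). if b then insert B E else E) (?e x, x \<in> D B)" for x by auto
  have sf: "simple_function M (\<lambda>x. (?e x, x \<in> D B))" by (rule simple_function_Pair[OF IH(1) B(1)])
  have "simple_function M ?e'" unfolding eq by (rule simple_function_compose1[OF sf])
  moreover have "ent M ?e' \<le> ent M (\<lambda>x. (?e x, x \<in> D B))" by (rule ent_factor_le[where F = "\<lambda>(E, b). if b then insert B E else E", OF sf eq])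
  moreover have "\<dots> \<le> ent M ?e + ent M (\<lambda>x. x \<in> D B)" by (rule ent_pair_le[OF IH(1) B(1)])
  ultimately show ?case using IH(2) B(2) insert.hyps by simp
qed

end


section \<open>Entropy rates of measure-preserving maps\<close>

definition names :: "('a \<Rightarrow> 'a) \<Rightarrow> ('a \<Rightarrow> 'b) \<Rightarrow> nat \<Rightarrow> 'a \<Rightarrow> 'b list" where
  "names T Z n x = map (\<lambda>i. Z ((T ^^ i) x)) [0..<n]"

lemma names_add: "names T Z (m + n) x = names T Z m x @ names T Z n ((T ^^ m) x)"
  unfolding names_def by (rule nth_equalityI) (auto simp: nth_append funpow_add[symmetric, THEN fun_cong, simplified] add.commute)

definition ent_rate :: "'a measure \<Rightarrow> ('a \<Rightarrow> 'a) \<Rightarrow> ('a \<Rightarrow> 'b) \<Rightarrow> real" where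
  "ent_rate M T Z = lim (\<lambda>n. ent M (names T Z n) / real n)"

definition fibres :: "'a measure \<Rightarrow> ('a \<Rightarrow> 'b) \<Rightarrow> 'a set set" where
  "fibres M Z = (\<lambda>v. Z -` {v} \<inter> space M) ` Z ` space M"

lemma partition_entropy_fibres: "partition_entropy M (fibres M Z) = ent M Z"
proof -
  have "inj_on (\<lambda>v. Z -` {v} \<inter> space M) (Z ` space M)" by (rule inj_onI) blast
  then show ?thesis unfolding partition_entropy_def fibres_def ent_def by (simp add: sum.reindex)
qed

locale measure_preserving = prob_space M for M :: "'a measure" +
  fixes T :: "'a \<Rightarrow> 'a"
  assumes T [measurable]: "T \<in> measurable M M" and invariant: "distr M M T = M"
begin

lemma funpow_T [measurable]: "(T ^^ n) \<in> measurable M M"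
  by (induction n) (auto simp: comp_def intro: measurable_compose)

lemma space_T: "x \<in> space M \<Longrightarrow> (T ^^ n) x \<in> space M"
  by (rule measurable_space[OF funpow_T])

lemma distr_funpow: "distr M M (T ^^ n) = M"
proof (induction n)
  case (Suc n)
  have "distr M M (T ^^ Suc n) = distr (distr M M (T ^^ n)) M T"
    by (subst distr_distr) auto
  then show ?case using Suc invariant by metis
qed (simp add: distr_id2 id_def)

lemma integral_T: "u \<in> borel_measurable M \<Longrightarrow> (\<integral>x. u ((T ^^ n) x) \<partial>M) = (\<integral>x. u x \<partial>M :: real)"
  using integral_distr[OF funpow_T, of u n] by (simp add: distr_funpow)

lemma simple_comp_T: "simple_function M Z \<Longrightarrow> simple_function M (\<lambda>x. Z ((T ^^ n) x))"
  using simple_function_comp[OF funpow_T, of Z n] by (simp add: comp_def)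

lemma ent_comp_T:
  assumes Z: "simple_function M Z"
  shows "ent M (\<lambda>x. Z ((T ^^ n) x)) = ent M Z"
proof -
  have "measure M ((\<lambda>x. Z ((T ^^ n) x)) -` {v} \<inter> space M) = measure M (Z -` {v} \<inter> space M)" for v
  proof -
    have "measure M (Z -` {v} \<inter> space M) = measure (distr M M (T ^^ n)) (Z -` {v} \<inter> space M)"
      by (simp add: distr_funpow)
    also have "\<dots> = measure M ((T ^^ n) -` (Z -` {v} \<inter> space M) \<inter> space M)"
      by (rule measure_distr[OF funpow_T simple_functionD(2)[OF Z]])
    also have "(T ^^ n) -` (Z -` {v} \<inter> space M) \<inter> space M = (\<lambda>x. Z ((T ^^ n) x)) -` {v} \<inter> space M"
      using space_T by auto
    finally show ?thesis by simp
  qed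
  moreover have "(\<lambda>x. Z ((T ^^ n) x)) ` space M \<subseteq> Z ` space M" using space_T by auto
  ultimately show ?thesis
    using ent_superset[OF simple_functionD(1)[OF Z], where M = M and Z = "\<lambda>x. Z ((T ^^ n) x)"]
    by (simp only: ent_def[of M Z])
qed

lemma simple_names:
  assumes Z: "simple_function M Z" shows "simple_function M (names T Z n)"
proof (induction n)
  case 0
  then show ?case by (simp add: names_def)
next
  case (Suc n)
  have "names T Z (Suc n) = (\<lambda>x. (\<lambda>(l, v). l @ [v]) (names T Z n x, Z ((T ^^ n) x)))"
    by (auto simp: names_def)
  moreover have "simple_function M (\<lambda>x. (\<lambda>(l, v). l @ [v]) (names T Z n x, Z ((T ^^ n) x)))"
    by (rule simple_function_compose1[OF simple_function_Pair[OF Suc simple_comp_T[OF Z]]])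
  ultimately show ?case by (simp only:)
qed

lemma ent_names_subadditive:
  assumes Z: "simple_function M Z"
  shows "ent M (names T Z (m + n)) \<le> ent M (names T Z m) + ent M (names T Z n)"
proof -
  note s = simple_names[OF Z]
  have "ent M (names T Z (m + n)) \<le> ent M (\<lambda>x. (names T Z m x, names T Z n ((T ^^ m) x)))"
    by (rule ent_factor_le[where F = "\<lambda>(a, b). a @ b", OF simple_function_Pair[OF s simple_comp_T[OF s]]])
       (simp add: names_add)
  also have "\<dots> \<le> ent M (names T Z m) + ent M (\<lambda>x. names T Z n ((T ^^ m) x))"
    by (rule ent_pair_le[OF s simple_comp_T[OF s]])
  also have "ent M (\<lambda>x. names T Z n ((T ^^ m) x)) = ent M (names T Z n)" by (rule ent_comp_T[OF s])
  finally show ?thesis .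
qed

lemma ent_rate_limit:
  assumes Z: "simple_function M Z"
  shows "(\<lambda>n. ent M (names T Z n) / real n) \<longlonglongrightarrow> ent_rate M T Z"
    and "n \<ge> 1 \<Longrightarrow> ent_rate M T Z \<le> ent M (names T Z n) / real n"
proof -
  have "- (0 * real n) \<le> ent M (names T Z n)" for n using ent_nonneg[OF simple_names[OF Z]] by simp
  then obtain L where L: "(\<lambda>n. ent M (names T Z n) / real n) \<longlonglongrightarrow> L"
    "\<And>n. n \<ge> 1 \<Longrightarrow> L \<le> ent M (names T Z n) / real n"
    using fekete[of "\<lambda>n. ent M (names T Z n)", OF ent_names_subadditive[OF Z]] by blast
  have "ent_rate M T Z = L" unfolding ent_rate_def using L(1) by (rule limI)
  with L show "(\<lambda>n. ent M (names T Z n) / real n) \<longlonglongrightarrow> ent_rate M T Z"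
    "n \<ge> 1 \<Longrightarrow> ent_rate M T Z \<le> ent M (names T Z n) / real n" by auto
qed

lemma iterated_join_fibres: "iterated_join M T (fibres M Z) n = fibres M (names T Z n)"
proof (intro set_eqI iffI)
  fix S assume "S \<in> iterated_join M T (fibres M Z) n"
  then obtain c where S: "S = {x \<in> space M. \<forall>i<n. (T ^^ i) x \<in> c i}" "S \<noteq> {}"
    and c: "\<And>i. i < n \<Longrightarrow> c i \<in> fibres M Z"
    unfolding iterated_join_def by blast
  obtain x where x: "x \<in> S" using S(2) by blast
  have "z \<in> c i \<longleftrightarrow> z \<in> space M \<and> Z z = Z ((T ^^ i) x)" if "i < n" for i z
    using c[OF that] x that unfolding S(1) fibres_def by auto
  then have "S = names T Z n -` {names T Z n x} \<inter> space M"
    unfolding S(1) using space_T by (auto simp: names_def)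
  moreover have "x \<in> space M" using x S(1) by blast
  ultimately show "S \<in> fibres M (names T Z n)" unfolding fibres_def by blast
next
  fix S assume "S \<in> fibres M (names T Z n)"
  then obtain x where x: "x \<in> space M" "S = names T Z n -` {names T Z n x} \<inter> space M"
    unfolding fibres_def by blast
  let ?c = "\<lambda>i. Z -` {Z ((T ^^ i) x)} \<inter> space M"
  have eq: "S = {z \<in> space M. \<forall>i<n. (T ^^ i) z \<in> ?c i}" unfolding x(2) using space_T by (auto simp: names_def)
  have ne: "S \<noteq> {}" using x by auto
  have c: "\<forall>i<n. ?c i \<in> fibres M Z" unfolding fibres_def using space_T[OF x(1)] by blast
  show "S \<in> iterated_join M T (fibres M Z) n"
    unfolding iterated_join_def by (rule DiffI, rule CollectI, rule exI[of _ ?c]) (use eq ne c in simp_all)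
qed

lemma measure_entropy_ge:
  assumes Z: "simple_function M Z"
  shows "ereal (ent_rate M T Z) \<le> measure_entropy M T"
proof -
  have "finite_partition M (fibres M Z)"
    unfolding finite_partition_def fibres_def partition_on_def disjoint_def
    using simple_functionD[OF Z] by auto
  moreover have "lim (\<lambda>n. partition_entropy M (iterated_join M T (fibres M Z) n) / real n) = ent_rate M T Z"
    unfolding iterated_join_fibres partition_entropy_fibres ent_rate_def ..
  ultimately show ?thesis unfolding measure_entropy_def by (intro SUP_upper2) auto
qed

text \<open>Every finite partition consists of the level sets of the map that sends a point to its atom.\<close>

lemma measure_entropy_le:
  assumes "\<And>Z :: 'a \<Rightarrow> 'a set. simple_function M Z \<Longrightarrow> finite (Z ` space M) \<Longrightarrow> (\<And>x. x \<in> space M \<Longrightarrow> Z x \<in> sets M) \<Longrightarrow>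
     (\<And>x A. x \<in> space M \<Longrightarrow> A \<in> Z ` space M \<Longrightarrow> x \<in> A \<longleftrightarrow> Z x = A) \<Longrightarrow> ent_rate M T Z \<le> c"
  shows "measure_entropy M T \<le> ereal c"
  unfolding measure_entropy_def
proof (rule SUP_least)
  fix P assume "P \<in> {P. finite_partition M P}"
  then have P: "finite P" "P \<subseteq> sets M" "\<Union>P = space M" "disjoint P" "{} \<notin> P"
    unfolding finite_partition_def partition_on_def by auto
  define Z where "Z x = (THE A. A \<in> P \<and> x \<in> A)" for x
  have Z: "Z x = A" if "A \<in> P" "x \<in> A" for x A
    unfolding Z_def by (rule the_equality) (use P(4) that in \<open>auto simp: disjoint_def\<close>)
  have ZP: "Z x \<in> P" "x \<in> Z x" if "x \<in> space M" for x
    using Z that P(3) by blast+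
  have im: "Z ` space M = P"
  proof
    show "P \<subseteq> Z ` space M"
    proof
      fix A assume A: "A \<in> P"
      then obtain x where "x \<in> A" using P(5) by (cases "A = {}") auto
      then show "A \<in> Z ` space M" using Z[OF A] A P(3) by blast
    qed
  qed (use ZP in auto)
  have pre: "Z -` {A} \<inter> space M = A" if "A \<in> P" for A
    using Z[OF that] ZP that P(3) by auto
  have sf: "simple_function M Z"
    unfolding simple_function_def im using P(1,2) pre by auto
  have fib: "fibres M Z = P" unfolding fibres_def im by (simp add: pre)
  have "ent_rate M T Z \<le> c"
  proof (rule assms[OF sf])
    show "finite (Z ` space M)" by (simp add: im P(1))
    show "Z x \<in> sets M" if "x \<in> space M" for x using ZP(1)[OF that] P(2) by blast
    show "x \<in> A \<longleftrightarrow> Z x = A" if "x \<in> space M" "A \<in> Z ` space M" for x A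
      using Z ZP(2) that unfolding im by metis
  qed
  moreover have "lim (\<lambda>n. partition_entropy M (iterated_join M T P n) / real n) = ent_rate M T Z"
    unfolding fib[symmetric] iterated_join_fibres partition_entropy_fibres ent_rate_def ..
  ultimately show "ereal (lim (\<lambda>n. partition_entropy M (iterated_join M T P n) / real n)) \<le> ereal c" by simp
qed

text \<open>By stationarity and subadditivity, the names of \<open>E\<close> of length \<open>n\<close> have entropy at most \<open>n\<close> times that
  of \<open>E\<close>. The intended \<open>E\<close> is an error pattern that is almost constant.\<close>

lemma ent_rate_perturb:
  assumes W: "simple_function M W" and E: "simple_function M E" and Z: "simple_function M Z"
    and F: "\<And>x. x \<in> space M \<Longrightarrow> Z x = F (W x) (E x)"
  shows "ent_rate M T Z \<le> ent_rate M T W + ent M E"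
proof -
  have nE: "ent M (names T E n) \<le> real n * ent M E" for n
  proof (induction n)
    case 0
    have "ent M (names T E 0) = 0"
    proof -
      have "names T E 0 -` {[]} \<inter> space M = space M" "names T E 0 ` space M \<subseteq> {[]}"
        by (auto simp: names_def)
      then show ?thesis by (subst ent_superset[of "{[]}"]) (simp_all add: prob_space)
    qed
    then show ?case by simp
  next
    case (Suc n)
    have "names T E 1 = (\<lambda>x. [E x])" by (auto simp: names_def)
    then have "ent M (names T E 1) \<le> ent M E" using ent_comp_le[OF E, of "\<lambda>v. [v]"] by simp
    then show ?case using ent_names_subadditive[OF E, of n 1] Suc by (simp add: algebra_simps)
  qed
  have "ent M (names T Z n) / real n \<le> ent M (names T W n) / real n + ent M E" if "n \<ge> 1" for n
  proof -
    have "ent M (names T Z n) \<le> ent M (\<lambda>x. (names T W n x, names T E n x))"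
    proof (rule ent_factor_le[where F = "\<lambda>(a, b). map2 F a b", OF simple_function_Pair[OF simple_names[OF W] simple_names[OF E]]])
      fix x assume "x \<in> space M"
      then show "names T Z n x = (\<lambda>(a, b). map2 F a b) (names T W n x, names T E n x)"
        by (simp add: names_def map2_map_map F space_T)
    qed
    also have "\<dots> \<le> ent M (names T W n) + ent M (names T E n)"
      by (rule ent_pair_le[OF simple_names[OF W] simple_names[OF E]])
    also have "\<dots> \<le> ent M (names T W n) + real n * ent M E" using nE by simp
    finally show ?thesis using that by (simp add: field_simps)
  qed
  then show ?thesis
    by (intro LIMSEQ_le[OF ent_rate_limit(1)[OF Z] tendsto_add[OF ent_rate_limit(1)[OF W] tendsto_const]])
       (auto intro: exI[of _ 1])
qed

text \<open>A name of length \<open>n\<close> in terms of blocks of length \<open>N\<close> is read off from \<open>n + N\<close> symbols.\<close>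

lemma ent_rate_names_le:
  assumes Z: "simple_function M Z"
  shows "ent_rate M T (names T Z N) \<le> ent_rate M T Z"
proof -
  note sN = simple_names[OF Z]
  have "ent M (names T (names T Z N) n) / real n \<le> ent M (names T Z n) / real n + ent M (names T Z N) / real n" for n
  proof -
    have "ent M (names T (names T Z N) n) \<le> ent M (names T Z (n + N))"
    proof (rule ent_factor_le[OF sN, where F = "\<lambda>l. map (\<lambda>i. take N (drop i l)) [0..<n]"])
      fix x assume "x \<in> space M"
      have "take N (drop i (names T Z (n + N) x)) = names T Z N ((T ^^ i) x)" if "i < n" for i
      proof -
        have "n + N = i + (N + (n - i))" using that by simp
        then have "names T Z (n + N) x = names T Z i x @ names T Z N ((T ^^ i) x) @ names T Z (n - i) ((T ^^ N) ((T ^^ i) x))"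
          by (simp only: names_add)
        then show ?thesis by (simp add: names_def)
      qed
      then show "names T (names T Z N) n x = map (\<lambda>i. take N (drop i (names T Z (n + N) x))) [0..<n]"
        unfolding names_def[of T "names T Z N"] by simp
    qed
    also have "\<dots> \<le> ent M (names T Z n) + ent M (names T Z N)" by (rule ent_names_subadditive[OF Z])
    finally show ?thesis by (simp add: divide_right_mono flip: add_divide_distrib)
  qed
  moreover have "(\<lambda>n. ent M (names T Z n) / real n + ent M (names T Z N) / real n) \<longlonglongrightarrow> ent_rate M T Z + 0"
    by (intro tendsto_add ent_rate_limit(1)[OF Z] lim_const_over_n)
  ultimately have "ent_rate M T (names T Z N) \<le> ent_rate M T Z + 0"
    by (intro LIMSEQ_le[OF ent_rate_limit(1)[OF sN]]) auto
  then show ?thesis by simp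
qed

end

section \<open>Invariant measures of a subshift\<close>

lemma sets_borel_cylinders:
  "sets (borel :: point measure) = sigma_sets UNIV {{z. prefix n z = w} |n w. True}"
proof
  let ?G = "{{z::point. prefix n z = w} |n w. True}"
  have "U \<in> sigma_sets UNIV ?G" if U: "open U" for U :: "point set"
  proof -
    let ?I = "{(n, w). {z::point. prefix n z = w} \<subseteq> U}"
    have "U = (\<Union>(n, w)\<in>?I. {z. prefix n z = w})"
    proof
      show "U \<subseteq> (\<Union>(n, w)\<in>?I. {z. prefix n z = w})"
      proof
        fix x assume "x \<in> U"
        with U obtain N where "\<And>z. prefix N z = prefix N x \<Longrightarrow> z \<in> U"
          by (rule open_contains_agree) blast
        then show "x \<in> (\<Union>(n, w)\<in>?I. {z. prefix n z = w})" by blast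
      qed
    qed auto
    moreover have "(\<Union>i\<in>?I. {z. prefix (fst i) z = snd i}) \<in> sigma_sets UNIV ?G"
      by (rule sigma_sets_UNION) auto
    ultimately show ?thesis by (simp add: case_prod_unfold)
  qed
  then show "sets borel \<subseteq> sigma_sets UNIV ?G"
    unfolding sets_borel by (intro sigma_sets_mono) auto
  have "?G \<subseteq> sets borel" using borel_open[OF open_agree] by auto
  then show "sigma_sets UNIV ?G \<subseteq> sets borel"
    using sets.sigma_sets_subset[of ?G borel] by simp
qed

lemma measurable_shift_restrict:
  assumes "shift ` X \<subseteq> X"
  shows "shift \<in> measurable (restrict_space borel X) (restrict_space borel X)"
  by (rule measurable_restrict_space3)
     (use assms in \<open>auto intro!: borel_measurable_continuous_onI continuous_on_shift\<close>)

locale shift_measure =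
  fixes X :: "point set" and \<mu> :: "point measure"
  assumes subshift: "subshift X" and invariant_measure: "\<mu> \<in> invariant_measures X"
begin

lemma sets_eq: "sets \<mu> = sets (restrict_space borel X)"
  using invariant_measure by (simp add: invariant_measures_def)

lemma space_eq: "space \<mu> = X"
  using sets_eq_imp_space_eq[OF sets_eq] by (simp add: space_restrict_space)

sublocale measure_preserving \<mu> shift
proof -
  have ps: "prob_space \<mu>" and inv: "distr \<mu> \<mu> shift = \<mu>"
    using invariant_measure by (auto simp: invariant_measures_def)
  have "shift ` X \<subseteq> X" using subshift by (simp add: subshift_def)
  then have "shift \<in> measurable \<mu> \<mu>"
    unfolding measurable_cong_sets[OF sets_eq sets_eq] by (rule measurable_shift_restrict)
  with ps inv show "measure_preserving \<mu> shift"
    by (simp add: measure_preserving_def measure_preserving_axioms_def)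
qed

lemma nonempty: "X \<noteq> {}"
  using not_empty space_eq by simp

lemma measurable_continuous: "continuous_on X u \<Longrightarrow> u \<in> borel_measurable \<mu>"
  for u :: "point \<Rightarrow> 'b::topological_space"
  unfolding measurable_cong_sets[OF sets_eq refl] by (rule borel_measurable_continuous_on_restrict)

lemma measurable_agree: "{x \<in> X. P (prefix n x)} \<in> sets \<mu>"
proof -
  have "{x \<in> X. P (prefix n x)} = X \<inter> {x. P (prefix n x)}" by auto
  then show ?thesis
    unfolding sets_eq sets_restrict_space using borel_open[OF open_prefix_pred[of P n]] by blast
qed

lemma integrable_continuous:
  assumes "continuous_on X u"
  shows "integrable \<mu> (u :: point \<Rightarrow> real)"
proof -
  interpret potential X u by unfold_locales (auto simp: subshift nonempty assms)
  show ?thesis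
    by (rule integrable_const_bound[of _ norm_sup])
       (use abs_le_norm_sup measurable_continuous[OF assms] in \<open>auto simp: space_eq intro!: AE_I2\<close>)
qed

lemma simple_symbol: "simple_function \<mu> (\<lambda>x. x 0)"
  and names_symbol: "names shift (\<lambda>x. x 0) n = prefix n"
proof -
  obtain k where k: "\<forall>x\<in>X. \<forall>i. x i \<in> {1..k}" using subshift unfolding subshift_def by auto
  show "simple_function \<mu> (\<lambda>x. x 0)"
    unfolding simple_function_def space_eq
  proof
    show "finite ((\<lambda>x. x 0) ` X)" by (rule finite_subset[of _ "{1..k}"]) (use k in auto)
    have "(\<lambda>x. x 0) -` {a} \<inter> X = {x \<in> X. prefix 1 x = [a]}" for a by (auto simp: prefix_def)
    then show "\<forall>a\<in>(\<lambda>x. x 0) ` X. (\<lambda>x. x 0) -` {a} \<inter> X \<in> sets \<mu>"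
      using measurable_agree[of "\<lambda>w. w = [_]" 1] by simp
  qed
  show "names shift (\<lambda>x. x 0) n = prefix n"
    by (auto simp: names_def prefix_def funpow_shift)
qed

lemma simple_prefix: "simple_function \<mu> (prefix n)"
  using simple_names[OF simple_symbol] by (simp add: names_symbol)

text \<open>The sets that can be approximated by finite unions of cylinders form a $\sigma$-algebra. For a
  countable union, finitely many of its members already have nearly full measure.\<close>

lemma cylinder_approximation:
  assumes "A \<in> sets \<mu>" "\<delta> > 0"
  shows "\<exists>N W. measure \<mu> (sym_diff A {x \<in> X. prefix N x \<in> W}) < \<delta>"
proof -
  let ?C = "\<lambda>N W. {x \<in> X. prefix N x \<in> W}"
  have C: "?C N W \<in> sets \<mu>" for N W by (rule measurable_agree)
  obtain B where B: "B \<in> sets borel" "A = X \<inter> B"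
    using assms(1) unfolding sets_eq sets_restrict_space by blast
  have meas: "X \<inter> B \<in> sets \<mu>" if "B \<in> sets borel" for B
    using that unfolding sets_eq sets_restrict_space by blast
  from B(1) have "\<forall>\<delta>>0. \<exists>N W. measure \<mu> (sym_diff (X \<inter> B) (?C N W)) < \<delta>"
    unfolding sets_borel_cylinders
  proof (induction rule: sigma_sets.induct)
    case (Basic a)
    then obtain n w where a: "a = {z. prefix n z = w}" by auto
    then have "sym_diff (X \<inter> a) (?C n {w}) = {}" by auto
    then have "measure \<mu> (sym_diff (X \<inter> a) (?C n {w})) = 0" by (simp only: measure_empty)
    then show ?case by (intro allI impI exI[of _ n] exI[of _ "{w}"]) linarith
  next
    case Empty
    have "sym_diff (X \<inter> {}) (?C 0 {}) = {}" by auto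
    then have "measure \<mu> (sym_diff (X \<inter> {}) (?C 0 {})) = 0" by (simp only: measure_empty)
    then show ?case by (intro allI impI exI[of _ 0] exI[of _ "{}"]) linarith
  next
    case (Compl a)
    have eq: "sym_diff (X \<inter> (UNIV - a)) (?C N (- W)) = sym_diff (X \<inter> a) (?C N W)" for N W by auto
    show ?case
    proof (intro allI impI)
      fix \<delta> :: real assume "\<delta> > 0"
      then obtain N W where "measure \<mu> (sym_diff (X \<inter> a) (?C N W)) < \<delta>" using Compl.IH by blast
      then have "measure \<mu> (sym_diff (X \<inter> (UNIV - a)) (?C N (- W))) < \<delta>" by (simp only: eq)
      then show "\<exists>N W. measure \<mu> (sym_diff (X \<inter> (UNIV - a)) (?C N W)) < \<delta>" by blast
    qed
  next
    case (Union a)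
    show ?case
    proof (intro allI impI)
      fix \<delta> :: real assume \<delta>: "\<delta> > 0"
      have am: "X \<inter> a i \<in> sets \<mu>" for i using Union.hyps meas unfolding sets_borel_cylinders by blast
      define U where "U m = (\<Union>i<m. X \<inter> a i)" for m
      have Um: "U m \<in> sets \<mu>" for m unfolding U_def by (rule sets.finite_UN) (use am in auto)
      have "incseq U" unfolding U_def by (rule monoI) (auto intro: less_le_trans)
      then have lim: "(\<lambda>m. measure \<mu> (U m)) \<longlonglongrightarrow> measure \<mu> (\<Union>m. U m)"
        using Um by (intro finite_Lim_measure_incseq) auto
      have UU: "(\<Union>m. U m) = X \<inter> (\<Union>i. a i)" unfolding U_def by (auto intro: lessI)
      obtain m where "norm (measure \<mu> (U m) - measure \<mu> (\<Union>m. U m)) < \<delta> / 2"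
        using LIMSEQ_D[OF lim half_gt_zero[OF \<delta>]] by blast
      then have m: "\<bar>measure \<mu> (U m) - measure \<mu> (X \<inter> (\<Union>i. a i))\<bar> < \<delta> / 2"
        unfolding UU by simp
      have sub: "U m \<subseteq> X \<inter> (\<Union>i. a i)" using UU by blast
      have Us: "X \<inter> (\<Union>i. a i) \<in> sets \<mu>" unfolding UU[symmetric] by (rule sets.countable_UN) (use Um in auto)
      have d1: "measure \<mu> (X \<inter> (\<Union>i. a i) - U m) < \<delta> / 2"
        using finite_measure_Diff[OF Us Um sub] m by linarith
      define \<eta> where "\<eta> = \<delta> / (2 * real (Suc m))"
      have \<eta>: "\<eta> > 0" using \<delta> by (simp add: \<eta>_def)
      have "\<forall>i. \<exists>N W. measure \<mu> (sym_diff (X \<inter> a i) (?C N W)) < \<eta>" using Union.IH \<eta> by blast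
      then obtain N W where NW: "\<And>i. measure \<mu> (sym_diff (X \<inter> a i) (?C (N i) (W i))) < \<eta>"
        unfolding choice_iff by blast
      define M where "M = Max (insert 0 (N ` {..<m}))"
      define V where "V = {w. \<exists>i<m. take (N i) w \<in> W i}"
      have NM: "N i \<le> M" if "i < m" for i unfolding M_def using that by simp
      have take: "take (N i) (prefix M x) = prefix (N i) x" if "i < m" for i x
        using take_prefix[of "N i" "M - N i" x] NM[OF that] by simp
      have CV: "?C M V = (\<Union>i<m. ?C (N i) (W i))" unfolding V_def using take by auto
      have "sym_diff (X \<inter> (\<Union>i. a i)) (?C M V) \<subseteq>
          (X \<inter> (\<Union>i. a i) - U m) \<union> (\<Union>i<m. sym_diff (X \<inter> a i) (?C (N i) (W i)))"
        unfolding CV U_def by auto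
      then have "measure \<mu> (sym_diff (X \<inter> (\<Union>i. a i)) (?C M V)) \<le>
          measure \<mu> ((X \<inter> (\<Union>i. a i) - U m) \<union> (\<Union>i<m. sym_diff (X \<inter> a i) (?C (N i) (W i))))"
        by (rule finite_measure_mono) (intro sets.Un sets.Diff sets.finite_UN Us Um am C finite_lessThan)
      also have "\<dots> \<le> measure \<mu> (X \<inter> (\<Union>i. a i) - U m) + measure \<mu> (\<Union>i<m. sym_diff (X \<inter> a i) (?C (N i) (W i)))"
        by (rule measure_Un_le; intro sets.Un sets.Diff sets.finite_UN Us Um am C finite_lessThan)
      also have "measure \<mu> (\<Union>i<m. sym_diff (X \<inter> a i) (?C (N i) (W i))) \<le>
          (\<Sum>i<m. measure \<mu> (sym_diff (X \<inter> a i) (?C (N i) (W i))))"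
        by (rule measure_UNION_le) (intro sets.Un sets.Diff am C finite_lessThan)+
      also have "\<dots> \<le> (\<Sum>i<m. \<eta>)" using NW by (intro sum_mono) (auto intro: less_imp_le)
      also have "\<dots> \<le> \<delta> / 2" using \<delta> by (simp add: \<eta>_def field_simps)
      finally have "measure \<mu> (sym_diff (X \<inter> (\<Union>i. a i)) (?C M V)) < \<delta>" using d1 by linarith
      then show "\<exists>N W. measure \<mu> (sym_diff (X \<inter> (\<Union>i. a i)) (?C N W)) < \<delta>" by blast
    qed
  qed
  with B(2) assms(2) show ?thesis by blast
qed

text \<open>The symbols generate: every finite partition is nearly a function of finitely many symbols, and
  the pattern of the mistakes has small entropy.\<close>

lemma entropy_le_symbol_rate: "measure_entropy \<mu> shift \<le> ereal (ent_rate \<mu> shift (\<lambda>x. x 0))"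
proof (rule measure_entropy_le)
  fix Z :: "point \<Rightarrow> point set"
  assume Z: "simple_function \<mu> Z" "finite (Z ` space \<mu>)" "\<And>x. x \<in> space \<mu> \<Longrightarrow> Z x \<in> sets \<mu>"
    and ZA: "\<And>x A. x \<in> space \<mu> \<Longrightarrow> A \<in> Z ` space \<mu> \<Longrightarrow> x \<in> A \<longleftrightarrow> Z x = A"
  let ?P = "Z ` space \<mu>"
  show "ent_rate \<mu> shift Z \<le> ent_rate \<mu> shift (\<lambda>x. x 0)"
  proof (rule field_le_epsilon)
    fix e :: real assume e: "e > 0"
    define c where "c = 3 * real (Suc (card ?P))"
    \<comment> \<open>Errors of measure below \<open>t\<^sup>2\<close> have entropy at most \<open>2 * t + t\<^sup>2 \<le> 3 * t\<close> for each atom.\<close>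
    define t where "t = min 1 (e / c)"
    have c: "c > 0" by (simp add: c_def)
    have t: "t > 0" "t \<le> 1" using e c by (auto simp: t_def)
    have "c * t \<le> c * (e / c)" using c by (intro mult_left_mono) (auto simp: t_def)
    then have ct: "c * t \<le> e" using c by simp
    have "\<forall>A\<in>?P. \<exists>N W. measure \<mu> (sym_diff A {x \<in> X. prefix N x \<in> W}) < t\<^sup>2"
    proof
      fix A assume "A \<in> ?P"
      then have "A \<in> sets \<mu>" using Z(3) by blast
      then show "\<exists>N W. measure \<mu> (sym_diff A {x \<in> X. prefix N x \<in> W}) < t\<^sup>2"
        by (rule cylinder_approximation) (use t in simp)
    qed
    then obtain N W where NW: "\<And>A. A \<in> ?P \<Longrightarrow> measure \<mu> (sym_diff A {x \<in> X. prefix (N A) x \<in> W A}) < t\<^sup>2"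
      unfolding bchoice_iff by blast
    define D where "D A = sym_diff A {x \<in> X. prefix (N A) x \<in> W A}" for A
    have D: "D A \<in> sets \<mu>" if "A \<in> ?P" for A
      unfolding D_def using Z(3) that measurable_agree by auto
    define E where "E x = {A \<in> ?P. x \<in> D A}" for x
    have E: "simple_function \<mu> E" "ent \<mu> E \<le> (\<Sum>A\<in>?P. 2 * sqrt (measure \<mu> (D A)) + measure \<mu> (D A))"
      unfolding E_def using ent_membership_le[OF Z(2) D] by auto
    have "2 * sqrt (measure \<mu> (D A)) + measure \<mu> (D A) \<le> 3 * t" if "A \<in> ?P" for A
    proof -
      have m: "measure \<mu> (D A) \<le> t\<^sup>2" using NW[OF that] by (simp add: D_def)
      have "sqrt (measure \<mu> (D A)) \<le> t" using real_sqrt_le_mono[OF m] t by simp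
      moreover have "t\<^sup>2 \<le> t" using t by (simp add: power2_eq_square)
      ultimately show ?thesis using m by linarith
    qed
    then have "(\<Sum>A\<in>?P. 2 * sqrt (measure \<mu> (D A)) + measure \<mu> (D A)) \<le> (\<Sum>A\<in>?P. 3 * t)"
      by (rule sum_mono)
    also have "\<dots> \<le> c * t" using t by (simp add: c_def algebra_simps)
    also have "\<dots> \<le> e" by (rule ct)
    finally have Ee: "ent \<mu> E \<le> e" using E(2) by linarith
    define M where "M = Max (insert 0 (N ` ?P))"
    define F where "F w S = (THE A. A \<in> ?P \<and> ((A \<in> S) \<noteq> (take (N A) w \<in> W A)))" for w S
    have "Z x = F (prefix M x) (E x)" if x: "x \<in> space \<mu>" for x
    proof -
      have key: "((A \<in> E x) \<noteq> (take (N A) (prefix M x) \<in> W A)) \<longleftrightarrow> Z x = A" if A: "A \<in> ?P" for A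
      proof -
        have "N A \<le> M" unfolding M_def using A Z(2) by simp
        then have "take (N A) (prefix M x) = prefix (N A) x"
          using take_prefix[of "N A" "M - N A" x] by simp
        then show ?thesis
          unfolding ZA[OF x A, symmetric] using A x by (auto simp: E_def D_def space_eq)
      qed
      have "F (prefix M x) (E x) = Z x"
        unfolding F_def by (rule the_equality) (use key x in auto)
      then show ?thesis by simp
    qed
    then have "ent_rate \<mu> shift Z \<le> ent_rate \<mu> shift (prefix M) + ent \<mu> E"
      by (rule ent_rate_perturb[OF simple_prefix E(1) Z(1)])
    moreover have "ent_rate \<mu> shift (prefix M) \<le> ent_rate \<mu> shift (\<lambda>x. x 0)"
      using ent_rate_names_le[OF simple_symbol, of M] by (simp add: names_symbol)
    ultimately show "ent_rate \<mu> shift Z \<le> ent_rate \<mu> shift (\<lambda>x. x 0) + e" using Ee by linarith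
  qed
qed

lemma integral_birkhoff:
  assumes u: "continuous_on X u"
  shows "(\<integral>x. birkhoff_sum n u x \<partial>\<mu>) = real n * (\<integral>x. u x \<partial>\<mu>)"
    and "integrable \<mu> (birkhoff_sum n u)"
proof -
  interpret potential X u by unfold_locales (auto simp: subshift nonempty u)
  show "integrable \<mu> (birkhoff_sum n u)" by (rule integrable_continuous[OF continuous_birkhoff])
  have "integrable \<mu> (\<lambda>x. u ((shift ^^ i) x))" for i
    by (rule integrable_const_bound[of _ norm_sup])
       (use abs_le_norm_sup funpow_closed measurable_continuous[OF u] in
         \<open>auto simp: space_eq intro!: AE_I2 measurable_compose[OF funpow_T]\<close>)
  then show "(\<integral>x. birkhoff_sum n u x \<partial>\<mu>) = real n * (\<integral>x. u x \<partial>\<mu>)"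
    unfolding birkhoff_sum_def
    by (simp add: Bochner_Integration.integral_sum integral_T measurable_continuous u)
qed

text \<open>One half of the variational principle, from the finite Gibbs inequality applied to the words of length
  \<open>n\<close> with their logarithmic weights.\<close>

lemma entropy_plus_integral_le:
  assumes u: "continuous_on X u"
  shows "measure_entropy \<mu> shift + ereal (\<integral>x. u x \<partial>\<mu>) \<le> ereal (pressure X u)"
proof -
  interpret potential X u by unfold_locales (auto simp: subshift nonempty u)
  let ?r = "ent_rate \<mu> shift (\<lambda>x. x 0)" and ?I = "\<integral>x. u x \<partial>\<mu>"
  have le: "?r + ?I \<le> ln (partition_sum X u n) / real n" if n: "n \<ge> 1" for n
  proof -
    let ?s = "\<lambda>w. ln (cylinder_weight X u w)"
    have "ent \<mu> (prefix n) + real n * ?I \<le> ent \<mu> (prefix n) + (\<integral>x. ?s (prefix n x) \<partial>\<mu>)"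
      unfolding integral_birkhoff(1)[OF u, symmetric]
    proof (intro add_left_mono integral_mono integral_birkhoff(2)[OF u] integral_simple(1)[OF simple_prefix])
      fix x assume "x \<in> space \<mu>"
      then have "exp (birkhoff_sum n u x) \<le> cylinder_weight X u (prefix n x)"
        by (intro weight_ge) (simp add: space_eq)
      then show "birkhoff_sum n u x \<le> ?s (prefix n x)"
        using ln_ge_iff less_le_trans[OF exp_gt_zero] by blast
    qed
    also have "\<dots> \<le> ln (\<Sum>w\<in>prefix n ` space \<mu>. exp (?s w))" by (rule gibbs_inequality[OF simple_prefix])
    also have "(\<Sum>w\<in>prefix n ` space \<mu>. exp (?s w)) = partition_sum X u n"
      unfolding partition_sum_def words_eq space_eq by (rule sum.cong) (auto simp: weight_pos[OF prefix_in_words])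
    finally have "ent \<mu> (prefix n) + real n * ?I \<le> ln (partition_sum X u n)" .
    then have "(ent \<mu> (prefix n) + real n * ?I) / real n \<le> ln (partition_sum X u n) / real n"
      by (rule divide_right_mono) simp
    then have "ent \<mu> (prefix n) / real n + ?I \<le> ln (partition_sum X u n) / real n"
      using n by (simp add: add_divide_distrib)
    moreover have "?r \<le> ent \<mu> (prefix n) / real n"
      using ent_rate_limit(2)[OF simple_symbol n] by (simp add: names_symbol)
    ultimately show ?thesis by linarith
  qed
  have "?r + ?I \<le> pressure X u"
    by (rule LIMSEQ_le_const[OF pressure_limit(1)]) (use le in blast)
  then have "ereal ?r + ereal ?I \<le> ereal (pressure X u)" by simp
  then show ?thesis using entropy_le_symbol_rate by (meson add_right_mono order_trans)
qed

end

text \<open>The average over the phases \<open>j < p\<close> is realised as the law of a random point seen from a uniformly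
  random phase. Moving it by one step replaces phase \<open>0\<close> by phase \<open>p\<close>, which has the same law.\<close>

lemma average_invariant:
  assumes sub: "subshift X" and ps: "prob_space \<kappa>" and sets: "sets \<kappa> = sets (restrict_space borel X)"
    and p: "p \<ge> 1" and inv: "distr \<kappa> \<kappa> (shift ^^ p) = \<kappa>"
  obtains \<nu> where "\<nu> \<in> invariant_measures X"
    "\<And>u C. u \<in> borel_measurable \<kappa> \<Longrightarrow> (\<And>x. x \<in> X \<Longrightarrow> \<bar>u x\<bar> \<le> C) \<Longrightarrow>
       (\<integral>x. u x \<partial>\<nu>) = (\<Sum>j<p. \<integral>x. u ((shift ^^ j) x) \<partial>\<kappa>) / real p"
    "\<And>A. A \<in> sets \<kappa> \<Longrightarrow> measure \<nu> A = (\<Sum>j<p. measure \<kappa> ((shift ^^ j) -` A \<inter> X)) / real p"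
proof -
  interpret prob_space \<kappa> by (rule ps)
  have space: "space \<kappa> = X" using sets_eq_imp_space_eq[OF sets] by (simp add: space_restrict_space)
  have sc: "shift ` X \<subseteq> X" using sub by (simp add: subshift_def)
  have T: "shift \<in> measurable \<kappa> \<kappa>"
    unfolding measurable_cong_sets[OF sets sets] by (rule measurable_shift_restrict[OF sc])
  have Tn: "(shift ^^ n) \<in> measurable \<kappa> \<kappa>" for n
  proof (induction n)
    case (Suc n)
    then show ?case unfolding funpow.simps by (rule measurable_comp[OF _ T])
  qed (simp add: id_def)
  let ?N = "measure_pmf (pmf_of_set {..<p})"
  have "0 \<in> {..<p}" using p by simp
  then have S: "{..<p} \<noteq> {}" "finite {..<p}" by (blast, simp)
  interpret P: pair_prob_space ?N \<kappa> ..
  let ?G = "\<lambda>(j, x). (shift ^^ j) x"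
  have G: "?G \<in> measurable (?N \<Otimes>\<^sub>M \<kappa>) \<kappa>"
  proof -
    have "?G \<in> measurable (count_space UNIV \<Otimes>\<^sub>M \<kappa>) \<kappa>"
      by (rule measurable_pair_measure_countable1) (use Tn in auto)
    then show ?thesis
      by (subst measurable_cong_sets[OF sets_pair_measure_cong[OF sets_measure_pmf_count_space refl] refl])
  qed
  define \<nu> where "\<nu> = distr (?N \<Otimes>\<^sub>M \<kappa>) \<kappa> ?G"
  have psn: "prob_space \<nu>" unfolding \<nu>_def by (rule P.prob_space_distr[OF G])
  have sn: "sets \<nu> = sets \<kappa>" by (simp add: \<nu>_def)
  have int: "(\<integral>x. u x \<partial>\<nu>) = (\<Sum>j<p. \<integral>x. u ((shift ^^ j) x) \<partial>\<kappa>) / real p"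
    if u: "u \<in> borel_measurable \<kappa>" and C: "\<And>x. x \<in> X \<Longrightarrow> \<bar>u x\<bar> \<le> C" for u :: "point \<Rightarrow> real" and C
  proof -
    have "(\<integral>x. u x \<partial>\<nu>) = (\<integral>z. u (?G z) \<partial>(?N \<Otimes>\<^sub>M \<kappa>))"
      unfolding \<nu>_def by (rule integral_distr[OF G u])
    also have "\<dots> = (\<integral>j. (\<integral>x. u (?G (j, x)) \<partial>\<kappa>) \<partial>?N)"
    proof (rule P.integral_fst'[symmetric])
      show "integrable (?N \<Otimes>\<^sub>M \<kappa>) (\<lambda>z. u (?G z))"
        by (rule P.integrable_const_bound[of _ C])
           (use measurable_compose[OF G u] C shift_closed_funpow[OF sc] in
             \<open>auto intro!: AE_I2 simp: space_pair_measure space\<close>)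
    qed
    also have "\<dots> = (\<Sum>j<p. \<integral>x. u ((shift ^^ j) x) \<partial>\<kappa>) / real p"
      by (subst integral_pmf_of_set[OF S]) simp
    finally show ?thesis .
  qed
  have meas: "measure \<nu> A = (\<Sum>j<p. measure \<kappa> ((shift ^^ j) -` A \<inter> X)) / real p" if A: "A \<in> sets \<kappa>" for A
  proof -
    interpret n: prob_space \<nu> by (rule psn)
    have pre: "(\<lambda>x. indicator A ((shift ^^ j) x) :: real) = indicator ((shift ^^ j) -` A)" for j
      by (auto simp: indicator_def)
    have "measure \<nu> A = (\<integral>x. indicator A x \<partial>\<nu>)"
      using A sn n.emeasure_finite by (subst Bochner_Integration.integral_indicator) (auto simp: sets.Int_space_eq2)
    also have "\<dots> = (\<Sum>j<p. \<integral>x. indicator A ((shift ^^ j) x) \<partial>\<kappa>) / real p"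
      by (rule int[of _ 1]) (use A in \<open>auto simp: indicator_def\<close>)
    also have "(\<lambda>j. \<integral>x. indicator A ((shift ^^ j) x) \<partial>\<kappa>) = (\<lambda>j. measure \<kappa> ((shift ^^ j) -` A \<inter> X))"
      unfolding pre by (simp add: space)
    finally show ?thesis .
  qed
  have "distr \<nu> \<nu> shift = \<nu>"
  proof (rule measure_eqI)
    fix A assume "A \<in> Sigma_Algebra.sets (distr \<nu> \<nu> shift)"
    then have A: "A \<in> Sigma_Algebra.sets \<kappa>" by (simp add: sn)
    interpret n: prob_space \<nu> by (rule psn)
    have Tnu: "shift \<in> measurable \<nu> \<nu>" unfolding measurable_cong_sets[OF sn sn] by (rule T)
    have spn: "space \<nu> = X" using sets_eq_imp_space_eq[OF sn] space by simp
    let ?a = "\<lambda>j. measure \<kappa> ((shift ^^ j) -` A \<inter> X)"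
    have B: "shift -` A \<inter> X \<in> Sigma_Algebra.sets \<kappa>" using measurable_sets[OF T A] by (simp add: space)
    have "measure \<kappa> ((shift ^^ j) -` (shift -` A \<inter> X) \<inter> X) = ?a (Suc j)" for j
    proof -
      have "(shift ^^ j) -` (shift -` A \<inter> X) \<inter> X = (shift ^^ Suc j) -` A \<inter> X"
        using shift_closed_funpow[OF sc] by auto
      then show ?thesis by simp
    qed
    then have "measure \<nu> (shift -` A \<inter> X) = (\<Sum>j<p. ?a (Suc j)) / real p"
      by (simp add: meas[OF B])
    also have "(\<Sum>j<p. ?a (Suc j)) = (\<Sum>j<p. ?a j) + (?a p - ?a 0)"
      using sum.lessThan_Suc_shift[of ?a p] sum.lessThan_Suc[of ?a p] by linarith
    also have "?a p = ?a 0"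
    proof -
      have "measure \<kappa> A = measure (distr \<kappa> \<kappa> (shift ^^ p)) A" by (simp add: inv)
      also have "\<dots> = ?a p" using measure_distr[OF Tn A, of p] by (simp add: space)
      moreover have "A \<inter> X = A" using sets.sets_into_space[OF A] space by auto
      ultimately show ?thesis by simp
    qed
    finally have "measure \<nu> (shift -` A \<inter> X) = measure \<nu> A" by (simp add: meas[OF A])
    then show "emeasure (distr \<nu> \<nu> shift) A = emeasure \<nu> A"
      using emeasure_distr[OF Tnu, of A] A by (simp add: sn spn n.emeasure_eq_measure)
  qed simp
  then have "\<nu> \<in> invariant_measures X"
    unfolding invariant_measures_def using psn sn sets by simp
  then show ?thesis using int meas that by blast
qed

section \<open>Measures of nearly maximal free energy\<close>

text \<open>For a random block with probabilities proportional to \<open>exp (S v)\<close>, the entropy plus the mean of \<open>S\<close> is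
  the logarithm of the normalising sum, which is the largest possible value.\<close>

definition block_measure :: "nat list set \<Rightarrow> (nat list \<Rightarrow> real) \<Rightarrow> nat list measure" where
  "block_measure V S = point_measure V (\<lambda>v. ennreal (exp (S v) / (\<Sum>v\<in>V. exp (S v))))"

definition concat_law :: "point set \<Rightarrow> nat \<Rightarrow> nat list set \<Rightarrow> (nat list \<Rightarrow> real) \<Rightarrow> point measure" where
  "concat_law Y p V S = distr (PiM UNIV (\<lambda>_. block_measure V S)) (restrict_space borel Y) (concat_point p)"

text \<open>Blocks that can be concatenated freely within \<open>Y\<close>. The bound \<open>S v\<close> has to hold for the Birkhoff sum at
  every continuation of the block \<open>v\<close>.\<close>

locale block_system = potential Y \<phi> for Y \<phi> +
  fixes p :: nat and V :: "nat list set" and S :: "nat list \<Rightarrow> real"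
  assumes p: "p \<ge> 1" and finite_V: "finite V" and V_nonempty: "V \<noteq> {}"
    and length_V: "\<And>v. v \<in> V \<Longrightarrow> length v = p"
    and concat_in: "\<And>\<omega>. (\<And>i. \<omega> i \<in> V) \<Longrightarrow> concat_point p \<omega> \<in> Y"
    and S_le: "\<And>y. y \<in> Y \<Longrightarrow> prefix p y \<in> V \<Longrightarrow> S (prefix p y) \<le> birkhoff_sum p \<phi> y"
begin

definition W :: real where "W = (\<Sum>v\<in>V. exp (S v))"

lemma W_pos: "W > 0"
  unfolding W_def by (rule sum_pos[OF finite_V V_nonempty]) simp

abbreviation "Q1 \<equiv> block_measure V S"
abbreviation "Q \<equiv> PiM (UNIV :: nat set) (\<lambda>_. Q1)"
abbreviation "law \<equiv> concat_law Y p V S"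

lemma space_Q1: "space Q1 = V" and sets_Q1: "sets Q1 = Pow V"
  by (simp_all add: block_measure_def space_point_measure sets_point_measure)

lemma prob_Q1: "prob_space Q1"
proof -
  have "(\<Sum>v\<in>V. ennreal (exp (S v) / W)) = ennreal (\<Sum>v\<in>V. exp (S v) / W)"
    using W_pos by (intro sum_ennreal) simp
  also have "(\<Sum>v\<in>V. exp (S v) / W) = 1"
    using W_pos by (simp add: sum_divide_distrib[symmetric] W_def[symmetric])
  finally show ?thesis
    unfolding block_measure_def W_def[symmetric] by (intro prob_space_point_measure finite_V) auto
qed

sublocale Q: product_prob_space "\<lambda>_::nat. Q1" UNIV
  by (rule product_prob_spaceI) (rule prob_Q1)

lemma space_Q: "\<omega> \<in> space Q \<Longrightarrow> \<omega> i \<in> V"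
  by (auto simp: space_PiM space_Q1)

lemma measurable_concat: "concat_point p \<in> measurable Q (restrict_space borel Y)"
proof (rule measurable_restrict_space2)
  show "concat_point p \<in> space Q \<rightarrow> Y" using concat_in space_Q by auto
  have "(\<lambda>\<omega>. concat_point p \<omega> i) \<in> measurable Q borel" for i
  proof -
    have "(\<lambda>\<omega>. \<omega> (i div p)) \<in> measurable Q Q1" by (rule measurable_component_singleton) simp
    moreover have "(\<lambda>v. v ! (i mod p)) \<in> measurable Q1 borel" by (simp add: block_measure_def)
    ultimately show ?thesis unfolding concat_point_def by (rule measurable_compose)
  qed
  then have "concat_point p \<in> measurable Q (PiM UNIV (\<lambda>_. borel))"
    by (intro measurable_PiM_single') (auto simp: space_PiM)
  then show "concat_point p \<in> measurable Q borel"
    by (simp add: measurable_cong_sets[OF refl sets_PiM_equal_borel])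
qed

lemma law_prob: "prob_space law" and law_sets: "sets law = sets (restrict_space borel Y)"
  unfolding concat_law_def by (auto intro: Q.prob_space_distr measurable_concat)

lemma law_invariant: "distr law law (shift ^^ p) = law"
proof -
  have re: "distr Q Q (\<lambda>\<omega> i. \<omega> (Suc i)) = Q"
    using distr_PiM_reindex[of UNIV "\<lambda>_. Q1" Suc UNIV] prob_Q1 by (simp add: restrict_def)
  have m: "(\<lambda>\<omega> i. \<omega> (Suc i)) \<in> measurable Q Q"
    by (rule measurable_PiM_single') (auto simp: space_PiM intro: measurable_component_singleton)
  have s: "shift \<in> measurable (restrict_space borel Y) (restrict_space borel Y)"
    by (rule measurable_shift_restrict[OF shift_closed])
  have sp: "(shift ^^ n) \<in> measurable (restrict_space borel Y) (restrict_space borel Y)" for n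
  proof (induction n)
    case (Suc n)
    then show ?case unfolding funpow.simps by (rule measurable_comp[OF _ s])
  qed (simp add: id_def)
  have "distr law law (shift ^^ p) = distr law (restrict_space borel Y) (shift ^^ p)"
    by (rule distr_cong) (simp_all add: law_sets)
  also have "\<dots> = distr Q (restrict_space borel Y) (\<lambda>\<omega>. (shift ^^ p) (concat_point p \<omega>))"
    unfolding concat_law_def by (subst distr_distr[OF sp measurable_concat]) (simp add: comp_def)
  also have "(\<lambda>\<omega>. (shift ^^ p) (concat_point p \<omega>)) = (\<lambda>\<omega>. concat_point p (\<lambda>i. \<omega> (Suc i)))"
    using concat_point_shift[OF p, of 1] by (simp add: fun_eq_iff)
  also have "distr Q (restrict_space borel Y) \<dots> = distr (distr Q Q (\<lambda>\<omega> i. \<omega> (Suc i))) (restrict_space borel Y) (concat_point p)"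
    by (subst distr_distr[OF measurable_concat m]) (simp add: comp_def)
  finally show ?thesis unfolding re concat_law_def .
qed

lemma prob_block: "measure Q1 ({b} \<inter> V) = (if b \<in> V then exp (S b) / W else 0)"
proof (cases "b \<in> V")
  case True
  then show ?thesis
    unfolding block_measure_def W_def[symmetric] measure_def
    using W_pos by (simp add: emeasure_point_measure_finite[OF finite_V])
qed simp

text \<open>A Gibbs-type upper bound: at least \<open>K\<close> complete blocks can be read off from \<open>p * (K + 1)\<close>
  consecutive coordinates, whatever the phase \<open>j\<close>.\<close>

lemma law_cylinder_le:
  assumes y: "y \<in> Y" and j: "j < p" and m: "m = p * Suc K"
  shows "measure law ((shift ^^ j) -` {z \<in> Y. prefix m z = prefix m y} \<inter> Y) \<le>
    exp (birkhoff_sum m \<phi> y + real p * norm_sup) / W ^ K"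
proof -
  let ?A = "(shift ^^ j) -` {z \<in> Y. prefix m z = prefix m y} \<inter> Y"
  \<comment> \<open>The start of the first complete block, as seen from phase \<open>j\<close>.\<close>
  define z where "z = (shift ^^ (p - j)) y"
  define b where "b i = prefix p ((shift ^^ (i * p)) z)" for i
  have z: "z \<in> Y" unfolding z_def by (rule funpow_closed[OF y])
  have Acl: "?A = Y \<inter> {x. drop j (prefix (j + m) x) = prefix m y}"
    using funpow_closed by (auto simp: drop_prefix)
  then have Am: "?A \<in> sets (restrict_space borel Y)"
    unfolding sets_restrict_space using borel_open[OF open_prefix_pred[of "\<lambda>w. drop j w = prefix m y" "j + m"]]
    by blast
  have "measure law ?A = measure Q (concat_point p -` ?A \<inter> space Q)"
    unfolding concat_law_def by (rule measure_distr[OF measurable_concat Am])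
  also have "\<dots> \<le> measure Q {\<omega> \<in> space Q. \<forall>i\<in>{1..K}. \<omega> i \<in> {b (i - 1)} \<inter> V}"
  proof (rule Q.finite_measure_mono)
    show "{\<omega> \<in> space Q. \<forall>i\<in>{1..K}. \<omega> i \<in> {b (i - 1)} \<inter> V} \<in> sets Q"
    proof (rule sets.sets_Collect_finite_All)
      show "{\<omega> \<in> space Q. \<omega> i \<in> {b (i - 1)} \<inter> V} \<in> sets Q" for i
        by (rule sets_Collect_single) (auto simp: sets_Q1)
    qed simp
    show "concat_point p -` ?A \<inter> space Q \<subseteq> {\<omega> \<in> space Q. \<forall>i\<in>{1..K}. \<omega> i \<in> {b (i - 1)} \<inter> V}"
    proof (intro subsetI CollectI conjI ballI)
      fix \<omega> i assume \<omega>: "\<omega> \<in> concat_point p -` ?A \<inter> space Q" and i: "i \<in> {1..K}"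
      have V: "\<omega> l \<in> V" for l using \<omega> space_Q by blast
      have eq: "prefix m ((shift ^^ j) (concat_point p \<omega>)) = prefix m y" using \<omega> by auto
      have "\<omega> i = prefix p ((shift ^^ (i * p)) (concat_point p \<omega>))"
        using concat_point_block[OF p length_V[OF V]] by simp
      also have "\<dots> = b (i - 1)"
        unfolding prefix_eq_iff b_def z_def
      proof (intro allI impI)
        fix l assume l: "l < p"
        obtain i' where i': "i = Suc i'" using i by (cases i) auto
        have "i' * p + p \<le> K * p" using i i' by (metis Suc_le_eq atLeastAtMost_iff mult_Suc mult_le_mono1 add.commute)
        moreover have "m = K * p + p" "p - j \<le> p" unfolding m by simp_all
        ultimately have lt: "l + i' * p + (p - j) < m" using l by linarith
        have e: "l + i' * p + (p - j) + j = l + i * p" using i' j by simp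
        have "(shift ^^ (i * p)) (concat_point p \<omega>) l = (shift ^^ j) (concat_point p \<omega>) (l + i' * p + (p - j))"
          by (simp add: funpow_shift e)
        also have "\<dots> = y (l + i' * p + (p - j))" using eq lt by (simp add: prefix_eq_iff)
        also have "\<dots> = (shift ^^ ((i - 1) * p)) ((shift ^^ (p - j)) y) l" by (simp add: funpow_shift i')
        finally show "(shift ^^ (i * p)) (concat_point p \<omega>) l = (shift ^^ ((i - 1) * p)) ((shift ^^ (p - j)) y) l" .
      qed
      finally show "\<omega> i \<in> {b (i - 1)} \<inter> V" using V[of i] by simp
    qed auto
  qed
  also have "\<dots> = (\<Prod>i\<in>{1..K}. measure Q1 ({b (i - 1)} \<inter> V))"
  proof -
    have "emeasure Q {\<omega> \<in> space Q. \<forall>i\<in>{1..K}. \<omega> i \<in> {b (i - 1)} \<inter> V} =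
        (\<Prod>i\<in>{1..K}. emeasure Q1 ({b (i - 1)} \<inter> V))"
      by (rule Q.emeasure_PiM_Collect) (auto simp: sets_Q1)
    then show ?thesis
      unfolding Q.emeasure_eq_measure Q.M.emeasure_eq_measure
      by (simp add: prod_ennreal measure_nonneg prod_nonneg)
  qed
  also have "\<dots> = (\<Prod>i<K. measure Q1 ({b i} \<inter> V))"
    by (rule prod.reindex_bij_witness[of _ Suc "\<lambda>i. i - 1"]) auto
  also have "\<dots> \<le> (\<Prod>i<K. exp (birkhoff_sum p \<phi> ((shift ^^ (i * p)) z)) / W)"
  proof (rule prod_mono, rule conjI)
    fix i
    have "S (b i) \<le> birkhoff_sum p \<phi> ((shift ^^ (i * p)) z)" if "b i \<in> V"
      using S_le[OF funpow_closed[OF z]] that unfolding b_def by blast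
    then show "measure Q1 ({b i} \<inter> V) \<le> exp (birkhoff_sum p \<phi> ((shift ^^ (i * p)) z)) / W"
      unfolding prob_block using W_pos by (auto intro: divide_right_mono)
  qed simp
  also have "\<dots> = exp (birkhoff_sum (K * p) \<phi> z) / W ^ K"
    by (simp add: prod_dividef birkhoff_sum_mult exp_sum)
  also have "\<dots> \<le> exp (birkhoff_sum m \<phi> y + real p * norm_sup) / W ^ K"
  proof -
    have "m = (p - j) + (K * p + j)" using m j by (simp add: algebra_simps)
    then have "birkhoff_sum m \<phi> y = birkhoff_sum (p - j) \<phi> y +
        (birkhoff_sum (K * p) \<phi> z + birkhoff_sum j \<phi> ((shift ^^ (K * p)) z))"
      by (simp only: birkhoff_sum_add z_def)
    moreover have "real p * norm_sup = real (p - j) * norm_sup + real j * norm_sup"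
      using j by (simp flip: distrib_right of_nat_add)
    ultimately have "birkhoff_sum (K * p) \<phi> z \<le> birkhoff_sum m \<phi> y + real p * norm_sup"
      using birkhoff_abs[OF y, of "p - j"] birkhoff_abs[OF funpow_closed[OF z], of j "K * p"] by linarith
    then show ?thesis using W_pos by (intro divide_right_mono) auto
  qed
  finally show ?thesis .
qed

text \<open>Averaged over the phases, the cylinder bound says that $-\ln \nu[w] + S_m \phi \ge K \ln W - c$ on
  every cylinder \<open>[w]\<close> of positive measure, where \<open>m = p * (K + 1)\<close>. Integrating and dividing by \<open>m\<close> gives
  entropy plus energy at least $(\ln W) / p$.\<close>

lemma exists_measure:
  obtains \<nu> where "\<nu> \<in> invariant_measures Y"
    "ereal (ln W / real p) \<le> measure_entropy \<nu> shift + ereal (\<integral>y. \<phi> y \<partial>\<nu>)"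
proof -
  obtain \<nu> where inv: "\<nu> \<in> invariant_measures Y" and avg:
    "\<And>A. A \<in> sets law \<Longrightarrow> measure \<nu> A = (\<Sum>j<p. measure law ((shift ^^ j) -` A \<inter> Y)) / real p"
    by (rule average_invariant[OF subshift law_prob law_sets p law_invariant]) blast
  interpret \<nu>: shift_measure Y \<nu> by unfold_locales (use inv subshift in auto)
  let ?I = "\<integral>y. \<phi> y \<partial>\<nu>" and ?r = "ent_rate \<nu> shift (\<lambda>x. x 0)"
  have bound: "real K * ln W - real p * norm_sup \<le> ent \<nu> (prefix (p * Suc K)) + real (p * Suc K) * ?I" for K
  proof -
    let ?m = "p * Suc K"
    let ?P = "\<lambda>w. measure \<nu> (prefix ?m -` {w} \<inter> space \<nu>)"
    define c where "c = real K * ln W - real p * norm_sup"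
    \<comment> \<open>A lower bound for the Birkhoff sum on \<open>[w]\<close>; its value on null words does not enter the integral.\<close>
    define u where "u w = (if ?P w > 0 then c + ln (?P w) else - (real ?m * norm_sup))" for w
    have u: "u (prefix ?m y) \<le> birkhoff_sum ?m \<phi> y" if y: "y \<in> Y" for y
    proof (cases "?P (prefix ?m y) > 0")
      case True
      have cyl: "prefix ?m -` {prefix ?m y} \<inter> space \<nu> = {z \<in> Y. prefix ?m z = prefix ?m y}"
        by (auto simp: \<nu>.space_eq)
      have "{z \<in> Y. prefix ?m z = prefix ?m y} \<in> sets law"
        using \<nu>.measurable_agree[of "\<lambda>w. w = prefix ?m y" ?m] by (simp add: \<nu>.sets_eq law_sets)
      then have "?P (prefix ?m y) =
          (\<Sum>j<p. measure law ((shift ^^ j) -` {z \<in> Y. prefix ?m z = prefix ?m y} \<inter> Y)) / real p"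
        unfolding cyl by (rule avg)
      also have "\<dots> \<le> (\<Sum>j<p. exp (birkhoff_sum ?m \<phi> y + real p * norm_sup) / W ^ K) / real p"
        by (intro divide_right_mono sum_mono law_cylinder_le[OF y]) auto
      also have "\<dots> = exp (birkhoff_sum ?m \<phi> y + real p * norm_sup) / W ^ K" using p by simp
      finally have "ln (?P (prefix ?m y)) \<le> ln (exp (birkhoff_sum ?m \<phi> y + real p * norm_sup) / W ^ K)"
        using True W_pos by (subst ln_le_cancel_iff) auto
      then show ?thesis using True W_pos by (simp add: u_def c_def ln_div ln_realpow)
    next
      case False
      then show ?thesis using birkhoff_abs[OF y, of ?m] by (simp add: u_def abs_le_iff)
    qed
    have "(\<Sum>w\<in>prefix ?m ` space \<nu>. (c + ln (?P w)) * ?P w) =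
        c * (\<Sum>w\<in>prefix ?m ` space \<nu>. ?P w) + (\<Sum>w\<in>prefix ?m ` space \<nu>. ?P w * ln (?P w))"
      unfolding sum_distrib_left sum.distrib[symmetric] by (simp only: distrib_right mult.commute[of "ln _"])
    then have "c - ent \<nu> (prefix ?m) = (\<Sum>w\<in>prefix ?m ` space \<nu>. (c + ln (?P w)) * ?P w)"
      unfolding \<nu>.sum_prob_fibres[OF \<nu>.simple_prefix] ent_def by simp
    also have "\<dots> = (\<Sum>w\<in>prefix ?m ` space \<nu>. u w * ?P w)"
    proof (rule sum.cong[OF refl])
      fix w
      have "?P w = 0 \<or> ?P w > 0" using measure_nonneg[of \<nu> "prefix ?m -` {w} \<inter> space \<nu>"] by linarith
      then show "(c + ln (?P w)) * ?P w = u w * ?P w" by (auto simp: u_def)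
    qed
    also have "\<dots> = (\<integral>y. u (prefix ?m y) \<partial>\<nu>)" by (rule \<nu>.integral_simple(2)[OF \<nu>.simple_prefix, symmetric])
    also have "\<dots> \<le> (\<integral>y. birkhoff_sum ?m \<phi> y \<partial>\<nu>)"
      by (rule integral_mono[OF \<nu>.integral_simple(1)[OF \<nu>.simple_prefix] \<nu>.integral_birkhoff(2)[OF cont]])
         (use u in \<open>simp add: \<nu>.space_eq\<close>)
    finally show ?thesis unfolding c_def \<nu>.integral_birkhoff(1)[OF cont] by linarith
  qed
  have "ln W / real p \<le> ?r + ?I"
  proof (rule LIMSEQ_le)
    have "strict_mono (\<lambda>K. p * Suc K)" by (rule strict_monoI) (use p in auto)
    from LIMSEQ_subseq_LIMSEQ[OF \<nu>.ent_rate_limit(1)[OF \<nu>.simple_symbol] this]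
    have "(\<lambda>K. ent \<nu> (prefix (p * Suc K)) / real (p * Suc K)) \<longlonglongrightarrow> ?r"
      by (simp only: \<nu>.names_symbol comp_def)
    then show "(\<lambda>K. ent \<nu> (prefix (p * Suc K)) / real (p * Suc K) + ?I) \<longlonglongrightarrow> ?r + ?I"
      by (intro tendsto_add tendsto_const)
    have "(\<lambda>K. ln W / real p * (real K / real (Suc K)) - norm_sup * (1 / real (Suc K))) \<longlonglongrightarrow>
        ln W / real p * 1 - norm_sup * 0"
      using LIMSEQ_n_over_Suc_n LIMSEQ_Suc[OF lim_1_over_n]
      by (intro tendsto_diff tendsto_mult tendsto_const) auto
    then show "(\<lambda>K. ln W / real p * (real K / real (Suc K)) - norm_sup * (1 / real (Suc K))) \<longlonglongrightarrow> ln W / real p"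
      by simp
    have "ln W / real p * (real K / real (Suc K)) - norm_sup * (1 / real (Suc K)) \<le>
        ent \<nu> (prefix (p * Suc K)) / real (p * Suc K) + ?I" for K
    proof -
      have m: "real (p * Suc K) > 0" unfolding of_nat_0_less_iff using p by simp
      have "ln W / real p * (real K / real (Suc K)) - norm_sup * (1 / real (Suc K)) =
          (real K * ln W - real p * norm_sup) / real (p * Suc K)"
      proof -
        have "real p \<noteq> 0" "real (Suc K) \<noteq> 0" using p by simp_all
        then show ?thesis unfolding of_nat_mult by (simp add: divide_simps algebra_simps del: of_nat_Suc)
      qed
      also have "\<dots> \<le> (ent \<nu> (prefix (p * Suc K)) + real (p * Suc K) * ?I) / real (p * Suc K)"
        using bound[of K] by (rule divide_right_mono) (use m in simp)
      also have "\<dots> = ent \<nu> (prefix (p * Suc K)) / real (p * Suc K) + ?I"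
        using m by (simp add: add_divide_distrib del: of_nat_mult)
      finally show ?thesis .
    qed
    then show "\<exists>N. \<forall>K\<ge>N. ln W / real p * (real K / real (Suc K)) - norm_sup * (1 / real (Suc K)) \<le>
        ent \<nu> (prefix (p * Suc K)) / real (p * Suc K) + ?I" by blast
  qed
  then have "ereal (ln W / real p) \<le> ereal ?r + ereal ?I" by simp
  also have "\<dots> \<le> measure_entropy \<nu> shift + ereal ?I"
    by (intro add_right_mono \<nu>.measure_entropy_ge \<nu>.simple_symbol)
  finally show ?thesis using that inv by blast
qed

end

text \<open>The words of \<open>Y\<close> of a given length, sorted by the end symbols of chosen preimages, form finitely many
  families that are freely concatenable after inserting connecting words. The best of them carries a
  fixed proportion of the partition sum.\<close>

lemma (in sft_factor) free_energy_approximation: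
  assumes \<phi>: "continuous_on Y \<phi>" and e: "e > 0"
  shows "\<exists>\<nu>\<in>invariant_measures Y. ereal (pressure Y \<phi> - e) \<le> measure_entropy \<nu> shift + ereal (\<integral>y. \<phi> y \<partial>\<nu>)"
proof -
  interpret Y: potential Y \<phi> by (rule potential_Y[OF \<phi>])
  obtain L c where L: "\<And>a b. length (c a b) \<le> L" and c:
    "\<And>a b n V \<omega>. n \<ge> 1 \<Longrightarrow> V \<subseteq> {w \<in> words n X. hd w = a \<and> last w = b} \<Longrightarrow> (\<And>i. \<omega> i \<in> V) \<Longrightarrow>
       concat_point (n + length (c a b)) (\<lambda>i. \<omega> i @ c a b) \<in> X"
    by (rule connecting_words[OF sft irreducible]) blast
  obtain D where D: "D \<ge> 0" "\<And>n x x'. x \<in> Y \<Longrightarrow> x' \<in> Y \<Longrightarrow> prefix n x = prefix n x' \<Longrightarrow>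
       \<bar>birkhoff_sum n \<phi> x - birkhoff_sum n \<phi> x'\<bar> \<le> e / 2 * real n + D"
    by (rule Y.distortion[of "e / 2"]) (use e in auto)
  obtain k where k: "k \<ge> 1" "\<forall>x\<in>X. \<forall>i. x i \<in> {1..k}" using subshift unfolding subshift_def by auto
  define K where "K = {1..k} \<times> {1..k}"
  have K: "finite K" "K \<noteq> {}" "card K \<ge> 1" using k(1) by (auto simp: K_def Suc_le_eq card_gt_0_iff)
  let ?h = "pressure Y \<phi>"
  define B where "B = D + real L * Y.norm_sup"
  \<comment> \<open>Chosen for the final comparison of \<open>ln W\<close> with \<open>p\<close> times the pressure, as \<open>n \<le> p \<le> n + L\<close>.\<close>
  define C where "C = B + ln (real (card K)) + real L * \<bar>?h\<bar>"
  obtain n0 where n0: "real n0 > 2 * C / e" using reals_Archimedean2 by blast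
  define n where "n = Suc n0"
  have n: "n \<ge> 1" "C \<le> e / 2 * real n" using n0 e by (auto simp: n_def field_simps)
  have "\<exists>w. w \<in> words n X \<and> map \<Phi> w = u" if "u \<in> words n Y" for u
  proof -
    obtain x where "x \<in> X" "u = prefix n (\<pi> x)" using \<open>u \<in> words n Y\<close> unfolding Y.words_eq
      by (auto elim: factor_surj)
    then show ?thesis using prefix_in_words prefix_factor by metis
  qed
  then obtain U where U: "\<And>u. u \<in> words n Y \<Longrightarrow> U u \<in> words n X \<and> map \<Phi> (U u) = u" by metis
  let ?w = "cylinder_weight Y \<phi>"
  have "(\<lambda>u. (hd (U u), last (U u))) ` words n Y \<subseteq> K"
  proof (rule image_subsetI)
    fix u assume "u \<in> words n Y"
    then obtain x where x: "x \<in> X" "U u = prefix n x" using U words_eq by blast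
    moreover have "prefix n x \<noteq> []" using n by (metis length_prefix list.size(3) not_one_le_zero)
    ultimately show "(hd (U u), last (U u)) \<in> K" using k(2) n by (simp add: K_def hd_conv_nth last_conv_nth)
  qed
  then obtain ab where ab: "sum ?w (words n Y) \<le> real (card K) * sum ?w {u \<in> words n Y. (hd (U u), last (U u)) = ab}"
    by (rule pigeonhole_sum[OF Y.finite_words K(1,2)])
  obtain a b where ab_eq: "ab = (a, b)" by fastforce
  define A where "A = {u \<in> words n Y. hd (U u) = a \<and> last (U u) = b}"
  have sA: "partition_sum Y \<phi> n \<le> real (card K) * sum ?w A"
    using ab unfolding ab_eq A_def partition_sum_def by simp
  have A: "A \<subseteq> words n Y" "A \<noteq> {}" "finite A"
  proof -
    show "A \<subseteq> words n Y" by (auto simp: A_def)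
    then show "finite A" by (rule finite_subset[OF _ Y.finite_words])
    show "A \<noteq> {}"
    proof
      assume "A = {}"
      with sA have "partition_sum Y \<phi> n \<le> 0" by simp
      with Y.partition_sum_pos[of n] show False by simp
    qed
  qed
  have lenA: "length u = n" if "u \<in> A" for u using that A(1) by (auto simp: words_def)
  define d where "d = map \<Phi> (c a b)"
  define p where "p = n + length d"
  have pn: "p \<ge> 1" "n \<le> p" "p \<le> n + L" using n L by (auto simp: p_def d_def)
  define V where "V = (\<lambda>u. u @ d) ` A"
  define S where "S v = ln (?w (take n v)) - (e / 2 * real n + B)" for v
  have inj: "inj_on (\<lambda>u. u @ d) A" by (rule inj_onI) simp
  interpret block_system Y \<phi> p V S
  proof
    show "1 \<le> p" "finite V" "V \<noteq> {}" using pn A by (auto simp: V_def)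
    show "length v = p" if "v \<in> V" for v using that lenA by (auto simp: V_def p_def)
    show "concat_point p \<omega> \<in> Y" if \<omega>: "\<And>i. \<omega> i \<in> V" for \<omega>
    proof -
      have "\<exists>u. u \<in> A \<and> \<omega> i = u @ d" for i using \<omega>[of i] by (auto simp: V_def)
      then obtain u where u: "\<And>i. u i \<in> A" "\<And>i. \<omega> i = u i @ d" by metis
      have "U (u i) \<in> {w \<in> words n X. hd w = a \<and> last w = b}" for i
        using u(1)[of i] U by (auto simp: A_def)
      then have x: "concat_point p (\<lambda>i. U (u i) @ c a b) \<in> X"
        using c[OF n(1) order_refl, of "\<lambda>i. U (u i)" a b] by (simp add: p_def d_def)
      have "\<pi> (concat_point p (\<lambda>i. U (u i) @ c a b)) = concat_point p \<omega>"
      proof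
        fix i
        have uU: "u l \<in> words n Y" "length (U (u l)) = n" "map \<Phi> (U (u l)) = u l" for l
          using u(1)[of l] U[of "u l"] A(1) by (auto simp: words_def)
        have "length (U (u (i div p)) @ c a b) = p" using uU(2) by (simp add: p_def d_def)
        moreover have "i mod p < p" using pn(1) by (intro mod_less_divisor) linarith
        ultimately have "i mod p < length (U (u (i div p)) @ c a b)" by simp
        then have "\<Phi> ((U (u (i div p)) @ c a b) ! (i mod p)) = map \<Phi> (U (u (i div p)) @ c a b) ! (i mod p)"
          by (rule nth_map[symmetric])
        also have "map \<Phi> (U (u (i div p)) @ c a b) = \<omega> (i div p)" by (simp add: uU(3) u(2) d_def)
        finally show "\<pi> (concat_point p (\<lambda>i. U (u i) @ c a b)) i = concat_point p \<omega> i"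
          using block x unfolding one_block_def by (simp add: concat_point_def)
      qed
      then show ?thesis using factor_in[OF x] by simp
    qed
    show "S (prefix p y) \<le> birkhoff_sum p \<phi> y" if y: "y \<in> Y" and v: "prefix p y \<in> V" for y
    proof -
      have tk: "take n (prefix p y) = prefix n y" by (simp add: p_def take_prefix)
      obtain y' where y': "y' \<in> Y" "prefix n y' = prefix n y" "?w (prefix n y) = exp (birkhoff_sum n \<phi> y')"
        by (rule Y.weight_attained[OF prefix_in_words[OF y]])
      have "\<bar>birkhoff_sum n \<phi> y' - birkhoff_sum n \<phi> y\<bar> \<le> e / 2 * real n + D" by (rule D(2)[OF y'(1) y y'(2)])
      moreover have "\<bar>birkhoff_sum (length d) \<phi> ((shift ^^ n) y)\<bar> \<le> real L * Y.norm_sup"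
        using Y.birkhoff_abs[OF Y.funpow_closed[OF y], of "length d" n]
          mult_right_mono[of "real (length d)" "real L" Y.norm_sup] L Y.norm_sup_nonneg
        by (simp add: d_def)
      moreover have "S (prefix p y) = birkhoff_sum n \<phi> y' - (e / 2 * real n + B)"
        by (simp add: S_def tk y'(3))
      moreover have "birkhoff_sum p \<phi> y = birkhoff_sum n \<phi> y + birkhoff_sum (length d) \<phi> ((shift ^^ n) y)"
        by (simp add: p_def birkhoff_sum_add)
      ultimately show ?thesis unfolding B_def by linarith
    qed
  qed
  have W_eq: "W = exp (- (e / 2 * real n + B)) * sum ?w A"
  proof -
    have "W = (\<Sum>u\<in>A. exp (S (u @ d)))" unfolding W_def unfolding V_def by (simp add: sum.reindex[OF inj])
    also have "\<dots> = (\<Sum>u\<in>A. exp (- (e / 2 * real n + B)) * ?w u)"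
    proof (rule sum.cong[OF refl])
      fix u assume u: "u \<in> A"
      then have "0 < ?w u" using A(1) Y.weight_pos by blast
      moreover have "S (u @ d) = - (e / 2 * real n + B) + ln (?w u)" using lenA[OF u] by (simp add: S_def)
      ultimately show "exp (S (u @ d)) = exp (- (e / 2 * real n + B)) * ?w u" by (simp only: exp_add exp_ln)
    qed
    finally show ?thesis by (simp add: sum_distrib_left)
  qed
  have cA: "0 < sum ?w A" by (rule Y.sum_weight_pos[OF A(1,2)])
  have "?h - e \<le> ln W / real p"
  proof -
    have "real n * ?h \<le> ln (partition_sum Y \<phi> n)"
      using Y.pressure_limit(2)[OF n(1)] n(1) by (simp add: field_simps)
    also have "\<dots> \<le> ln (real (card K) * sum ?w A)" using sA Y.partition_sum_pos[of n] by simp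
    also have "\<dots> = ln (real (card K)) + ln (sum ?w A)" using K(3) cA by (simp add: ln_mult_pos)
    finally have 1: "real n * ?h - ln (real (card K)) - (e / 2 * real n + B) \<le> ln W"
      unfolding W_eq using cA by (simp add: ln_mult_pos)
    have "real p * ?h \<le> real n * ?h + real L * \<bar>?h\<bar>"
    proof -
      have "real p * ?h = real n * ?h + real (p - n) * ?h" using pn(2) by (simp add: of_nat_diff algebra_simps)
      also have "real (p - n) * ?h \<le> real (p - n) * \<bar>?h\<bar>" by (intro mult_left_mono) auto
      also have "\<dots> \<le> real L * \<bar>?h\<bar>" using pn(3) by (intro mult_right_mono) auto
      finally show ?thesis by simp
    qed
    moreover have "e * real n \<le> e * real p" using pn(2) e by simp
    ultimately have "real p * (?h - e) \<le> ln W"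
      using 1 n(2) unfolding C_def by (simp add: right_diff_distrib mult.commute[of e])
    then show ?thesis using pn(1) by (simp add: field_simps)
  qed
  then have "ereal (?h - e) \<le> ereal (ln W / real p)" by simp
  moreover obtain \<nu> where "\<nu> \<in> invariant_measures Y"
    "ereal (ln W / real p) \<le> measure_entropy \<nu> shift + ereal (\<integral>y. \<phi> y \<partial>\<nu>)"
    by (rule exists_measure) blast
  ultimately show ?thesis by (meson order_trans)
qed

theorem (in sft_factor) variational_principle:
  assumes \<phi>: "continuous_on Y \<phi>"
  shows "(SUP \<nu>\<in>invariant_measures Y. measure_entropy \<nu> shift + ereal (\<integral>y. \<phi> y \<partial>\<nu>)) = ereal (pressure Y \<phi>)"
proof (rule antisym)
  show "(SUP \<nu>\<in>invariant_measures Y. measure_entropy \<nu> shift + ereal (\<integral>y. \<phi> y \<partial>\<nu>)) \<le> ereal (pressure Y \<phi>)"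
  proof (rule SUP_least)
    fix \<nu> assume "\<nu> \<in> invariant_measures Y"
    then interpret shift_measure Y \<nu> by unfold_locales (rule subshift_Y)
    show "measure_entropy \<nu> shift + ereal (\<integral>y. \<phi> y \<partial>\<nu>) \<le> ereal (pressure Y \<phi>)"
      by (rule entropy_plus_integral_le[OF \<phi>])
  qed
  show "ereal (pressure Y \<phi>) \<le> (SUP \<nu>\<in>invariant_measures Y. measure_entropy \<nu> shift + ereal (\<integral>y. \<phi> y \<partial>\<nu>))"
  proof (rule ereal_le_epsilon2)
    fix e :: real assume "e > 0"
    from free_energy_approximation[OF \<phi> this] obtain \<nu> where \<nu>: "\<nu> \<in> invariant_measures Y"
      "ereal (pressure Y \<phi> - e) \<le> measure_entropy \<nu> shift + ereal (\<integral>y. \<phi> y \<partial>\<nu>)" by blast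
    have "ereal (pressure Y \<phi> - e) \<le> (SUP \<nu>\<in>invariant_measures Y. measure_entropy \<nu> shift + ereal (\<integral>y. \<phi> y \<partial>\<nu>))"
      by (rule SUP_upper2[of \<nu>]) (use \<nu> in auto)
    from add_right_mono[OF this, of "ereal e"]
    show "ereal (pressure Y \<phi>) \<le> (SUP \<nu>\<in>invariant_measures Y. measure_entropy \<nu> shift + ereal (\<integral>y. \<phi> y \<partial>\<nu>)) + ereal e"
      by simp
  qed
qed

section \<open>Compensation functions\<close>

context one_block_factor
begin

lemma partition_sum_fibres:
  "partition_sum X f n = (\<Sum>u\<in>words n Y. \<Sum>w\<in>{w \<in> words n X. map \<Phi> w = u}. cylinder_weight X f w)"
proof -
  interpret Y: potential Y "\<lambda>_. 0" by (rule potential_Y) simp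
  have "map \<Phi> ` words n X \<subseteq> words n Y"
    unfolding words_eq Y.words_eq using factor_in by (auto simp: prefix_factor[symmetric])
  then show ?thesis
    unfolding partition_sum_def by (rule sum.group[OF finite_words Y.finite_words, symmetric])
qed

lemma g_fun_prefix: "(\<Sum>w\<in>{w \<in> words n X. map \<Phi> w = prefix n y}. cylinder_weight X f w) = g_fun X \<Phi> f n y"
  unfolding g_fun_eq fibre_words_def ..

text \<open>Grouped by their images, the words of \<open>X\<close> over a word \<open>u\<close> of \<open>Y\<close> have total weight equal to that of \<open>u\<close>
  up to a uniform factor $e^{o(n)}$.\<close>

lemma pressure_lift_eq:
  assumes sub: "sublinear Y (\<lambda>n y. ln (g_fun X \<Phi> f n y))" and \<phi>: "continuous_on Y \<phi>"
  shows "pressure X (\<lambda>x. f x + \<phi> (\<pi> x)) = pressure Y \<phi>"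
proof -
  let ?f = "\<lambda>x. f x + \<phi> (\<pi> x)"
  interpret L: one_block_factor X ?f Y \<pi> \<Phi> by (rule factor_lift[OF \<phi>])
  interpret Y: potential Y \<phi> by (rule potential_Y[OF \<phi>])
  let ?d = "\<lambda>n. ln (partition_sum X ?f n) - ln (partition_sum Y \<phi> n)"
  have near: "sublinear Y (\<lambda>n y. ln (g_fun X \<Phi> ?f n y) - birkhoff_sum n \<phi> y)"
    by (rule sublinear_sum_bound[OF ln_g_lift[OF \<phi>] sub]) (smt (verit, best))
  have "sublinear {()} (\<lambda>n _. ?d n)"
    unfolding sublinear_def
  proof (intro allI impI)
    fix \<epsilon> :: real assume "\<epsilon> > 0"
    from sublinearD[OF near this] obtain C where
      C: "C \<ge> 0" "\<And>n y. y \<in> Y \<Longrightarrow> \<bar>ln (g_fun X \<Phi> ?f n y) - birkhoff_sum n \<phi> y\<bar> \<le> \<epsilon> * real n + C" by auto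
    have "\<bar>?d n\<bar> \<le> \<epsilon> * real n + C" for n
    proof -
      let ?E = "\<epsilon> * real n + C"
      let ?G = "\<lambda>u. \<Sum>w\<in>{w \<in> words n X. map \<Phi> w = u}. cylinder_weight X ?f w"
      have "?G u \<le> exp ?E * cylinder_weight Y \<phi> u \<and> exp (- ?E) * cylinder_weight Y \<phi> u \<le> ?G u"
        if u: "u \<in> words n Y" for u
      proof -
        obtain y where y: "y \<in> Y" "prefix n y = u" "cylinder_weight Y \<phi> u = exp (birkhoff_sum n \<phi> y)"
          by (rule Y.weight_attained[OF u])
        have G: "?G u = exp (ln (g_fun X \<Phi> ?f n y))"
          using L.g_fun_prefix[of n y] L.g_fun_pos[OF y(1), of n] y(2) by simp
        show ?thesis unfolding G y(3) using C(2)[OF y(1), of n] by (simp add: abs_le_iff flip: exp_add)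
      qed
      then have 1: "partition_sum X ?f n \<le> exp ?E * partition_sum Y \<phi> n"
        and 2: "exp (- ?E) * partition_sum Y \<phi> n \<le> partition_sum X ?f n"
        unfolding L.partition_sum_fibres partition_sum_def[of Y] sum_distrib_left by (auto intro!: sum_mono)
      note p = L.partition_sum_pos[of n] Y.partition_sum_pos[of n]
      have "ln (partition_sum X ?f n) \<le> ln (exp ?E * partition_sum Y \<phi> n)" using 1 p by simp
      moreover have "ln (exp (- ?E) * partition_sum Y \<phi> n) \<le> ln (partition_sum X ?f n)"
        using 2 p by (subst ln_le_cancel_iff) auto
      ultimately show ?thesis using p by (simp add: ln_mult_pos abs_le_iff)
    qed
    with C(1) show "\<exists>C\<ge>0. \<forall>n. \<forall>s\<in>{()}. \<bar>?d n\<bar> \<le> \<epsilon> * real n + C" by blast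
  qed
  then have "(\<lambda>n. ?d n / real n) \<longlonglongrightarrow> 0" by (rule sublinear_tendsto) simp
  moreover have "(\<lambda>n. ?d n / real n) \<longlonglongrightarrow> pressure X ?f - pressure Y \<phi>"
    unfolding diff_divide_distrib by (intro tendsto_diff L.pressure_limit(1) Y.pressure_limit(1))
  ultimately show ?thesis using LIMSEQ_unique by fastforce
qed

text \<open>A potential that vanishes on the orbit changes the weights over the orbit by a factor $e^{o(n)}$ only,
  and these weights are part of the partition sum.\<close>

lemma rate_le_pressure_lift:
  assumes y: "y \<in> Y" and q: "q \<ge> 1" "(shift ^^ q) y = y"
    and \<phi>: "continuous_on Y \<phi>" and zero: "\<And>i. \<phi> ((shift ^^ i) y) = 0"
  shows "fibre_rate X \<Phi> f y \<le> pressure X (\<lambda>x. f x + \<phi> (\<pi> x))"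
proof -
  let ?f = "\<lambda>x. f x + \<phi> (\<pi> x)"
  interpret L: one_block_factor X ?f Y \<pi> \<Phi> by (rule factor_lift[OF \<phi>])
  have S0: "birkhoff_sum n \<phi> y = 0" for n unfolding birkhoff_sum_def by (simp add: zero)
  have "(\<lambda>n. (ln (g_fun X \<Phi> ?f n y) - ln (g_fun X \<Phi> f n y)) / real n + ln (g_fun X \<Phi> f n y) / real n)
      \<longlonglongrightarrow> 0 + fibre_rate X \<Phi> f y"
    using sublinear_tendsto[OF ln_g_lift[OF \<phi>] y] by (intro tendsto_add periodic_rate(1)[OF y q]) (simp add: S0)
  then have "(\<lambda>n. ln (g_fun X \<Phi> ?f n y) / real n) \<longlonglongrightarrow> fibre_rate X \<Phi> f y"
    by (simp flip: add_divide_distrib)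
  then show ?thesis
  proof (rule LIMSEQ_le[OF _ L.pressure_limit(1)], intro exI allI impI)
    fix n :: nat
    have "g_fun X \<Phi> ?f n y \<le> partition_sum X ?f n"
      unfolding L.g_fun_eq partition_sum_def by (rule L.sum_weight_mono[OF L.fibre_words_subset order_refl])
    then have "ln (g_fun X \<Phi> ?f n y) \<le> ln (partition_sum X ?f n)"
      using L.g_fun_pos[OF y, of n] L.partition_sum_pos[of n] by simp
    then show "ln (g_fun X \<Phi> ?f n y) / real n \<le> ln (partition_sum X ?f n) / real n"
      by (rule divide_right_mono) simp
  qed
qed

text \<open>A penalty that is large away from a periodic orbit leaves only the growth over that orbit.\<close>

lemma pressure_concentrates:
  assumes y: "y \<in> Y" and q: "q \<ge> 1" "(shift ^^ q) y = y" and \<delta>: "\<delta> > 0"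
  obtains \<phi> where "continuous_on Y \<phi>" "\<And>i. \<phi> ((shift ^^ i) y) = 0"
    "pressure X (\<lambda>x. f x + \<phi> (\<pi> x)) \<le> fibre_rate X \<Phi> f y + \<delta>"
proof -
  let ?r = "fibre_rate X \<Phi> f y"
  have per: "(shift ^^ q) ((shift ^^ i) y) = (shift ^^ i) y" for i
    using q(2) by (simp add: funpow_shift_commute[of q])
  have "\<forall>\<^sub>F n in sequentially. ln (g_fun X \<Phi> f n ((shift ^^ i) y)) / real n < ?r + \<delta>/2" for i
    using order_tendstoD(2)[OF periodic_rate(1)[OF funpow_closed_Y[OF y, of i] q(1) per], of "?r + \<delta>/2"] \<delta>
      fibre_rate_orbit[OF y q] by simp
  then have "\<forall>\<^sub>F n in sequentially. \<forall>i\<in>{..<q}. ln (g_fun X \<Phi> f n ((shift ^^ i) y)) / real n < ?r + \<delta>/2"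
    by (intro eventually_ball_finite) auto
  moreover have "\<forall>\<^sub>F n in sequentially. ln (2 * real q) / real n < \<delta>/2"
    by (rule order_tendstoD(2)[OF lim_const_over_n]) (use \<delta> in simp)
  ultimately have "\<forall>\<^sub>F n in sequentially. (\<forall>i\<in>{..<q}. ln (g_fun X \<Phi> f n ((shift ^^ i) y)) / real n < ?r + \<delta>/2) \<and>
      ln (2 * real q) / real n < \<delta>/2 \<and> n \<ge> 1"
    using eventually_ge_at_top[of 1] by eventually_elim simp
  then obtain n where n: "n \<ge> 1" "ln (2 * real q) / real n < \<delta>/2"
    "\<And>i. i < q \<Longrightarrow> ln (g_fun X \<Phi> f n ((shift ^^ i) y)) / real n < ?r + \<delta>/2"
    by (auto simp: eventually_sequentially)
  have np: "real n > 0" using n(1) by simp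
  define B where "B = real q * exp ((?r + \<delta>/2) * real n)"
  have B: "B > 0" unfolding B_def using q by simp
  define O' where "O' = (\<lambda>i. prefix n ((shift ^^ i) y)) ` {..<q}"
  have orbit: "prefix n ((shift ^^ i) y) \<in> O'" for i
  proof -
    have "(shift ^^ i) y = (shift ^^ (i mod q)) ((shift ^^ (i div q * q)) y)"
      by (simp add: funpow_shift ac_simps)
    also have "\<dots> = (shift ^^ (i mod q)) y" by (simp add: funpow_mult_fix[OF q(2)])
    finally show ?thesis unfolding O'_def using q(1) by (intro image_eqI[of _ _ "i mod q"]) (simp_all add: less_le_trans)
  qed
  \<comment> \<open>This penalty makes the words off the orbit weigh at most \<open>B\<close> in total.\<close>
  define t where "t = \<bar>ln (partition_sum X f n) - ln B\<bar>"
  define \<phi> where "\<phi> x = (if prefix n x \<in> O' then 0 else - t)" for x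
  have \<phi>: "continuous_on Y \<phi>" unfolding \<phi>_def by (rule continuous_on_prefix)
  have t: "t \<ge> 0" by (simp add: t_def)
  let ?f = "\<lambda>x. f x + \<phi> (\<pi> x)"
  interpret L: one_block_factor X ?f Y \<pi> \<Phi> by (rule factor_lift[OF \<phi>])
  let ?c = "cylinder_weight X f"
  have w: "cylinder_weight X ?f w \<le> (if map \<Phi> w \<in> O' then ?c w else 0) + exp (- t) * ?c w"
    if ww: "w \<in> words n X" for w
  proof -
    obtain x where x: "x \<in> X" "prefix n x = w" "cylinder_weight X ?f w = exp (birkhoff_sum n ?f x)"
      by (rule L.weight_attained[OF ww])
    have pre: "prefix n (\<pi> x) = map \<Phi> w" using prefix_factor[OF x(1), of n] x(2) by simp
    have nonpos: "\<phi> z \<le> 0" for z using t by (simp add: \<phi>_def)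
    obtain n' where n': "n = 1 + n'" using n(1) by (metis le_add_diff_inverse)
    have "birkhoff_sum n' \<phi> z \<le> 0" for z
      unfolding birkhoff_sum_def by (rule sum_nonpos) (rule nonpos)
    then have S: "birkhoff_sum n \<phi> (\<pi> x) \<le> \<phi> (\<pi> x)"
      unfolding n' birkhoff_sum_add by (simp add: birkhoff_sum_def)
    have cx: "exp (birkhoff_sum n f x) \<le> ?c w" using weight_ge[OF x(1), of n] x(2) by simp
    have "cylinder_weight X ?f w = exp (birkhoff_sum n \<phi> (\<pi> x)) * exp (birkhoff_sum n f x)"
      unfolding x(3) birkhoff_lift[OF x(1)] by (simp add: exp_add)
    also have "\<dots> \<le> exp (\<phi> (\<pi> x)) * ?c w"
      using S cx by (intro mult_mono) auto
    also have "\<dots> \<le> (if map \<Phi> w \<in> O' then ?c w else 0) + exp (- t) * ?c w"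
      using weight_pos[OF ww] by (simp add: \<phi>_def pre)
    finally show ?thesis .
  qed
  have "partition_sum X ?f n \<le> (\<Sum>w\<in>words n X. if map \<Phi> w \<in> O' then ?c w else 0) + exp (- t) * partition_sum X f n"
    unfolding partition_sum_def sum_distrib_left sum.distrib[symmetric] by (rule sum_mono[OF w])
  also have "(\<Sum>w\<in>words n X. if map \<Phi> w \<in> O' then ?c w else 0) \<le> B"
  proof -
    have "(\<Sum>w\<in>words n X. if map \<Phi> w \<in> O' then ?c w else 0) = sum ?c {w \<in> words n X. map \<Phi> w \<in> O'}"
      by (rule sum.inter_filter[OF finite_words, symmetric])
    also have "\<dots> = (\<Sum>u\<in>O'. sum ?c {w \<in> {w \<in> words n X. map \<Phi> w \<in> O'}. map \<Phi> w = u})"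
      by (rule sum.group[symmetric]) (auto simp: O'_def finite_words)
    also have "\<dots> \<le> of_nat (card O') * exp ((?r + \<delta>/2) * real n)"
    proof (rule sum_bounded_above)
      fix u assume "u \<in> O'"
      then obtain i where i: "i < q" "u = prefix n ((shift ^^ i) y)" by (auto simp: O'_def)
      have "{w \<in> {w \<in> words n X. map \<Phi> w \<in> O'}. map \<Phi> w = u} = fibre_words X \<Phi> n ((shift ^^ i) y)"
        using \<open>u \<in> O'\<close> by (auto simp: fibre_words_def i(2))
      moreover have "ln (g_fun X \<Phi> f n ((shift ^^ i) y)) \<le> (?r + \<delta>/2) * real n"
        using n(3)[OF i(1)] np by (simp add: field_simps)
      ultimately show "sum ?c {w \<in> {w \<in> words n X. map \<Phi> w \<in> O'}. map \<Phi> w = u} \<le> exp ((?r + \<delta>/2) * real n)"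
        unfolding g_fun_eq[symmetric] using g_fun_pos[OF funpow_closed_Y[OF y, of i], of n]
        by (metis exp_le_cancel_iff exp_ln g_fun_eq)
    qed
    also have "card O' \<le> q" unfolding O'_def using card_image_le[of "{..<q}"] by simp
    then have "of_nat (card O') * exp ((?r + \<delta>/2) * real n) \<le> real q * exp ((?r + \<delta>/2) * real n)"
      by (intro mult_right_mono) auto
    finally show ?thesis by (simp add: B_def)
  qed
  also have "exp (- t) * partition_sum X f n \<le> B"
  proof -
    have "exp (- t) * partition_sum X f n = exp (ln (partition_sum X f n) - t)"
      using partition_sum_pos[of n] by (simp add: exp_diff exp_minus field_simps)
    also have "\<dots> \<le> exp (ln B)" unfolding t_def by simp
    finally show ?thesis using B by simp
  qed
  finally have "ln (partition_sum X ?f n) \<le> ln (2 * B)" using L.partition_sum_pos[of n] B by simp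
  also have "ln (2 * B) = ln (2 * real q) + (?r + \<delta>/2) * real n"
    unfolding B_def using q by (simp add: ln_mult_pos mult.assoc[symmetric])
  finally have "ln (partition_sum X ?f n) / real n \<le> ln (2 * real q) / real n + (?r + \<delta>/2)"
    using np by (simp add: field_simps)
  then have "pressure X ?f \<le> ?r + \<delta>" using L.pressure_limit(2)[OF n(1)] n(2) by linarith
  moreover have "\<phi> ((shift ^^ i) y) = 0" for i unfolding \<phi>_def using orbit by simp
  ultimately show ?thesis using that \<phi> by blast
qed

text \<open>Penalties that concentrate at the orbit bring the pressure of \<open>X\<close> down to the rate over the orbit, and
  that of \<open>Y\<close> down to the rate of \<open>Y\<close> over itself, which is \<open>0\<close>.\<close>

lemma rate_zero_of_pressures:
  assumes eq: "\<And>\<phi>. continuous_on Y \<phi> \<Longrightarrow> pressure X (\<lambda>x. f x + \<phi> (\<pi> x)) = pressure Y \<phi>"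
    and y: "y \<in> Y" and q: "q \<ge> 1" "(shift ^^ q) y = y"
  shows "fibre_rate X \<Phi> f y = 0"
proof -
  interpret I: one_block_factor Y "\<lambda>_. 0" Y "\<lambda>y. y" "\<lambda>a. a"
    by unfold_locales (auto simp: subshift_Y Y_nonempty factor_map_def one_block_def)
  have "g_fun Y (\<lambda>a. a) (\<lambda>_. 0) n y = 1" for n
  proof -
    have "fibre_words Y (\<lambda>a. a) n y = {prefix n y}"
      using prefix_in_words[OF y] by (auto simp: fibre_words_def)
    moreover obtain x where "cylinder_weight Y (\<lambda>_. 0) (prefix n y) = exp (birkhoff_sum n (\<lambda>_. 0) x)"
      by (rule I.weight_attained[OF prefix_in_words[OF y]])
    ultimately show ?thesis unfolding I.g_fun_eq by (simp add: birkhoff_sum_def)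
  qed
  then have r0: "fibre_rate Y (\<lambda>a. a) (\<lambda>_. 0) y = 0"
    unfolding fibre_rate_def by (simp add: limI)
  have 1: "fibre_rate X \<Phi> f y \<le> 0 + \<delta>" if \<delta>: "\<delta> > 0" for \<delta>
  proof -
    obtain \<phi> where \<phi>: "continuous_on Y \<phi>" "\<And>i. \<phi> ((shift ^^ i) y) = 0"
      "pressure Y (\<lambda>x. 0 + \<phi> x) \<le> fibre_rate Y (\<lambda>a. a) (\<lambda>_. 0) y + \<delta>"
      by (rule I.pressure_concentrates[OF y q \<delta>]) blast
    then show ?thesis using rate_le_pressure_lift[OF y q \<phi>(1,2)] eq[OF \<phi>(1)] r0 by simp
  qed
  have 2: "0 \<le> fibre_rate X \<Phi> f y + \<delta>" if \<delta>: "\<delta> > 0" for \<delta>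
  proof -
    obtain \<phi> where \<phi>: "continuous_on Y \<phi>" "\<And>i. \<phi> ((shift ^^ i) y) = 0"
      "pressure X (\<lambda>x. f x + \<phi> (\<pi> x)) \<le> fibre_rate X \<Phi> f y + \<delta>"
      by (rule pressure_concentrates[OF y q \<delta>]) blast
    then show ?thesis using I.rate_le_pressure_lift[OF y q \<phi>(1,2)] eq[OF \<phi>(1)] r0 by simp
  qed
  show ?thesis
    by (rule antisym; rule field_le_epsilon) (fact 1, fact 2)
qed

end

text \<open>By the variational principle both suprema are pressures; \<open>X\<close> is a factor of itself under the identity.\<close>

lemma (in sft_factor) compensation_iff:
  "compensation_function X Y \<pi> f \<longleftrightarrow>
     (\<forall>\<phi>. continuous_on Y \<phi> \<longrightarrow> pressure X (\<lambda>x. f x + \<phi> (\<pi> x)) = pressure Y \<phi>)"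
proof -
  interpret I: sft_factor X f X "\<lambda>x. x" "\<lambda>a. a"
    by unfold_locales (auto simp: subshift factor_map_def one_block_def sft irreducible)
  have "(SUP \<mu>\<in>invariant_measures X. measure_entropy \<mu> shift + ereal (\<integral>x. f x \<partial>\<mu>) + ereal (\<integral>x. \<phi> (\<pi> x) \<partial>\<mu>))
      = ereal (pressure X (\<lambda>x. f x + \<phi> (\<pi> x)))" if \<phi>: "continuous_on Y \<phi>" for \<phi>
  proof -
    have "(SUP \<mu>\<in>invariant_measures X. measure_entropy \<mu> shift + ereal (\<integral>x. f x \<partial>\<mu>) + ereal (\<integral>x. \<phi> (\<pi> x) \<partial>\<mu>))
        = (SUP \<mu>\<in>invariant_measures X. measure_entropy \<mu> shift + ereal (\<integral>x. f x + \<phi> (\<pi> x) \<partial>\<mu>))"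
    proof (rule SUP_cong[OF refl])
      fix \<mu> assume "\<mu> \<in> invariant_measures X"
      then interpret shift_measure X \<mu> by unfold_locales (rule subshift)
      have "continuous_on X (\<lambda>x. \<phi> (\<pi> x))"
        by (rule continuous_on_compose2[OF \<phi> continuous_factor]) (auto intro: factor_in)
      then have "(\<integral>x. f x + \<phi> (\<pi> x) \<partial>\<mu>) = (\<integral>x. f x \<partial>\<mu>) + (\<integral>x. \<phi> (\<pi> x) \<partial>\<mu>)"
        by (intro Bochner_Integration.integral_add integrable_continuous cont)
      then show "measure_entropy \<mu> shift + ereal (\<integral>x. f x \<partial>\<mu>) + ereal (\<integral>x. \<phi> (\<pi> x) \<partial>\<mu>) =
          measure_entropy \<mu> shift + ereal (\<integral>x. f x + \<phi> (\<pi> x) \<partial>\<mu>)"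
        by (simp add: add.assoc)
    qed
    also have "\<dots> = ereal (pressure X (\<lambda>x. f x + \<phi> (\<pi> x)))"
      by (rule I.variational_principle[OF potential_lift[OF \<phi>]])
    finally show ?thesis .
  qed
  then show ?thesis
    unfolding compensation_function_def using cont variational_principle by auto
qed

section \<open>Integrals of limit superiors\<close>

lemma limsup_bounded:
  fixes a :: "nat \<Rightarrow> real"
  assumes "\<And>n. \<bar>a n\<bar> \<le> B"
  shows "limsup (\<lambda>n. ereal (a n)) = ereal (real_of_ereal (limsup (\<lambda>n. ereal (a n))))"
    and "\<bar>real_of_ereal (limsup (\<lambda>n. ereal (a n)))\<bar> \<le> B"
proof -
  let ?L = "limsup (\<lambda>n. ereal (a n))"
  have "?L \<le> ereal B" by (rule Limsup_bounded) (use assms in \<open>auto simp: abs_le_iff\<close>)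
  moreover have "ereal (- B) \<le> ?L"
  proof (rule le_Limsup)
    have "- B \<le> a n" for n using assms[of n] by linarith
    then show "\<forall>\<^sub>F n in sequentially. ereal (- B) \<le> ereal (a n)" by simp
  qed simp
  ultimately show "?L = ereal (real_of_ereal ?L)" "\<bar>real_of_ereal ?L\<bar> \<le> B"
    by (cases ?L; simp)+
qed

lemma (in prob_space) integrable_bounded:
  "u \<in> borel_measurable M \<Longrightarrow> (\<And>x. x \<in> space M \<Longrightarrow> \<bar>u x\<bar> \<le> B) \<Longrightarrow> integrable M (u :: _ \<Rightarrow> real)"
  by (rule integrable_const_bound[of _ B]) (auto intro!: AE_I2)

text \<open>The reverse Fatou lemma: the suprema of the tails decrease to the limit superior, and their integrals
  converge by domination.\<close>

lemma (in prob_space) integral_limsup_ge: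
  fixes a :: "nat \<Rightarrow> 'a \<Rightarrow> real"
  assumes meas [measurable]: "\<And>n. a n \<in> borel_measurable M"
    and bound: "\<And>n x. x \<in> space M \<Longrightarrow> \<bar>a n x\<bar> \<le> B"
    and ge: "\<And>n. n \<ge> 1 \<Longrightarrow> t \<le> (\<integral>x. a n x \<partial>M)"
  shows "t \<le> (\<integral>x. real_of_ereal (limsup (\<lambda>n. ereal (a n x))) \<partial>M)"
proof -
  define s where "s n x = (SUP k\<in>{n..}. a k x)" for n x
  define L where "L x = real_of_ereal (limsup (\<lambda>n. ereal (a n x)))" for x
  have bdd: "bdd_above ((\<lambda>k. a k x) ` {n..})" if "x \<in> space M" for x n
    using bound[OF that] by (intro bdd_aboveI2[of _ _ B]) (auto simp: abs_le_iff)
  have upper: "a k x \<le> s n x" if "x \<in> space M" "k \<ge> n" for k n x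
    unfolding s_def by (rule cSUP_upper[OF _ bdd]) (use that in auto)
  have s_bound: "\<bar>s n x\<bar> \<le> B" if x: "x \<in> space M" for n x
  proof -
    have "s n x \<le> B" unfolding s_def
      by (rule cSUP_least) (use bound[OF x] in \<open>auto simp: abs_le_iff\<close>)
    moreover have "- B \<le> a n x" using bound[OF x, of n] by linarith
    ultimately show ?thesis using upper[OF x, of n n] by linarith
  qed
  have s_lim: "(\<lambda>n. s n x) \<longlonglongrightarrow> L x" if x: "x \<in> space M" for x
  proof -
    have sup: "ereal (s n x) = (SUP k\<in>{n..}. ereal (a k x))" for n
    proof -
      have "\<bar>SUP k\<in>{n..}. ereal (a k x)\<bar> \<noteq> \<infinity>"
      proof -
        have "(SUP k\<in>{n..}. ereal (a k x)) \<le> ereal (s n x)"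
          by (rule SUP_least) (use upper[OF x] in auto)
        moreover have "ereal (a n x) \<le> (SUP k\<in>{n..}. ereal (a k x))" by (rule SUP_upper) simp
        ultimately show ?thesis by auto
      qed
      then show ?thesis unfolding s_def by (rule ereal_SUP)
    qed
    have "decseq (\<lambda>n. SUP k\<in>{n..}. ereal (a k x))"
      by (rule antimonoI) (auto intro!: SUP_subset_mono)
    then have "(\<lambda>n. SUP k\<in>{n..}. ereal (a k x)) \<longlonglongrightarrow> limsup (\<lambda>n. ereal (a n x))"
      unfolding limsup_INF_SUP by (rule LIMSEQ_INF)
    then have "(\<lambda>n. ereal (s n x)) \<longlonglongrightarrow> ereal (L x)"
      unfolding sup L_def using limsup_bounded(1)[of "\<lambda>n. a n x" B] bound[OF x] by simp
    then show ?thesis by simp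
  qed
  have s_meas [measurable]: "s n \<in> borel_measurable M" for n
    unfolding s_def by (rule borel_measurable_cSUP) (auto intro: bdd)
  have L_meas [measurable]: "L \<in> borel_measurable M" unfolding L_def by measurable
  have "(\<lambda>n. \<integral>x. s n x \<partial>M) \<longlonglongrightarrow> (\<integral>x. L x \<partial>M)"
    by (rule integral_dominated_convergence[where w = "\<lambda>_. B"]) (use s_lim s_bound in \<open>auto intro!: AE_I2\<close>)
  moreover have "t \<le> (\<integral>x. s n x \<partial>M)" if n: "n \<ge> 1" for n
  proof -
    have "t \<le> (\<integral>x. a n x \<partial>M)" by (rule ge[OF n])
    also have "\<dots> \<le> (\<integral>x. s n x \<partial>M)"
      by (intro integral_mono integrable_bounded[of _ B] meas s_meas bound s_bound upper) auto
    finally show ?thesis .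
  qed
  ultimately have "t \<le> (\<integral>x. L x \<partial>M)" by (intro LIMSEQ_le_const) auto
  then show ?thesis by (simp add: L_def)
qed

context measure_preserving
begin

definition time_sum :: "('a \<Rightarrow> real) \<Rightarrow> nat \<Rightarrow> 'a \<Rightarrow> real" where
  "time_sum u n x = (\<Sum>i<n. u ((T ^^ i) x))"

lemma time_sum_Suc: "time_sum u (Suc n) x = u x + time_sum u n (T x)"
  unfolding time_sum_def sum.lessThan_Suc_shift by (simp add: funpow_swap1)

lemma measurable_time_sum [measurable]: "u \<in> borel_measurable M \<Longrightarrow> time_sum u n \<in> borel_measurable M"
  unfolding time_sum_def by (intro borel_measurable_sum measurable_compose[OF funpow_T])

text \<open>Garsia's argument. With \<open>m\<close> the maximum of the sums up to time \<open>N\<close>, one has \<open>u \<ge> m - m \<circ> T\<close> where \<open>m\<close>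
  is positive and \<open>m - m \<circ> T \<le> 0\<close> elsewhere, while \<open>m - m \<circ> T\<close> has integral \<open>0\<close>.\<close>

lemma maximal_ergodic:
  assumes u [measurable]: "u \<in> borel_measurable M" and B: "\<And>x. x \<in> space M \<Longrightarrow> \<bar>u x\<bar> \<le> B"
    and pos: "\<And>x. x \<in> space M \<Longrightarrow> \<exists>k. time_sum u k x > 0"
  shows "0 \<le> (\<integral>x. u x \<partial>M)"
proof -
  define m where "m N x = Max ((\<lambda>k. time_sum u k x) ` {..N})" for N x
  have m_ge: "time_sum u k x \<le> m N x" if "k \<le> N" for k N x
    unfolding m_def using that by (intro Max_ge) auto
  have m_nonneg: "0 \<le> m N x" for N x using m_ge[of 0 N x] by (simp add: time_sum_def)
  have m_meas [measurable]: "m N \<in> borel_measurable M" for N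
    unfolding m_def by (rule borel_measurable_Max) auto
  have ts: "\<bar>time_sum u k x\<bar> \<le> real k * B" if "x \<in> space M" for k x
  proof -
    have "\<bar>time_sum u k x\<bar> \<le> (\<Sum>i<k. \<bar>u ((T ^^ i) x)\<bar>)" unfolding time_sum_def by (rule sum_abs)
    also have "\<dots> \<le> (\<Sum>i<k. B)" using B space_T[OF that] by (intro sum_mono) auto
    finally show ?thesis by simp
  qed
  have m_attained: "\<exists>k\<le>N. m N x = time_sum u k x" for N x
  proof -
    have "m N x \<in> (\<lambda>k. time_sum u k x) ` {..N}" unfolding m_def by (rule Max_in) auto
    then show ?thesis by auto
  qed
  have m_int: "integrable M (m N)" for N
  proof (rule integrable_bounded[OF m_meas])
    fix x assume x: "x \<in> space M"
    obtain k where k: "k \<le> N" "m N x = time_sum u k x" using m_attained by blast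
    have "0 \<le> B" using B[OF x] by linarith
    then have "real k * B \<le> real N * B" using k(1) by (intro mult_right_mono) auto
    then show "\<bar>m N x\<bar> \<le> real N * B" using ts[OF x, of k] k(2) by simp
  qed
  let ?I = "\<lambda>N x. if m N x > 0 then u x else 0"
  have "0 \<le> (\<integral>x. ?I N x \<partial>M)" for N
  proof -
    have "(\<integral>x. m N x - m N (T x) \<partial>M) \<le> (\<integral>x. ?I N x \<partial>M)"
    proof (rule integral_mono)
      have "integrable M (\<lambda>x. m N (T x))"
        using integrable_distr[OF T, of "m N"] m_int by (simp add: invariant)
      then show "integrable M (\<lambda>x. m N x - m N (T x))" using m_int by simp
      show "integrable M (?I N)" by (rule integrable_bounded[of _ "\<bar>B\<bar>"]) (use B in \<open>auto, force\<close>)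
      fix x
      show "m N x - m N (T x) \<le> ?I N x"
      proof (cases "m N x > 0")
        case True
        obtain k where k: "k \<le> N" "m N x = time_sum u k x" using m_attained by blast
        with True obtain k' where k': "k = Suc k'" by (cases k) (auto simp: time_sum_def)
        have "m N x = u x + time_sum u k' (T x)" by (simp add: k(2) k' time_sum_Suc)
        also have "time_sum u k' (T x) \<le> m N (T x)" using k(1) k' by (intro m_ge) simp
        finally show ?thesis using True by simp
      next
        case False
        then show ?thesis using m_nonneg[of N x] m_nonneg[of N "T x"] by simp
      qed
    qed
    moreover have "(\<integral>x. m N (T x) \<partial>M) = (\<integral>x. m N x \<partial>M)" using integral_T[OF m_meas, of N 1] by simp
    moreover have "integrable M (\<lambda>x. m N (T x))"
      using integrable_distr[OF T, of "m N"] m_int by (simp add: invariant)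
    ultimately show ?thesis using m_int by simp
  qed
  moreover have "(\<lambda>N. \<integral>x. ?I N x \<partial>M) \<longlonglongrightarrow> (\<integral>x. u x \<partial>M)"
  proof (rule integral_dominated_convergence[where w = "\<lambda>_. B"])
    show "AE x in M. (\<lambda>N. ?I N x) \<longlonglongrightarrow> u x"
    proof (rule AE_I2)
      fix x assume "x \<in> space M"
      then obtain k where k: "time_sum u k x > 0" using pos by blast
      have "?I N x = u x" if "N \<ge> k" for N using m_ge[OF that, of x] k by simp
      then show "(\<lambda>N. ?I N x) \<longlonglongrightarrow> u x"
        by (intro tendsto_eventually eventually_sequentiallyI[of k]) simp
    qed
    show "AE x in M. norm (?I N x) \<le> B" for N
    proof (rule AE_I2)
      fix x assume "x \<in> space M"
      then show "norm (?I N x) \<le> B" using B[of x] by auto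
    qed
  qed auto
  ultimately show ?thesis by (intro LIMSEQ_le_const) auto
qed

text \<open>The half of Birkhoff's theorem that concerns upper averages: for their invariant limit superior \<open>H\<close>,
  the sums of \<open>h - H + \<epsilon>\<close> become positive everywhere, and the maximal inequality applies.\<close>

lemma integral_limsup_averages_le:
  assumes h [measurable]: "h \<in> borel_measurable M" and B: "\<And>x. x \<in> space M \<Longrightarrow> \<bar>h x\<bar> \<le> B"
  shows "(\<integral>x. real_of_ereal (limsup (\<lambda>n. ereal (time_sum h n x / real n))) \<partial>M) \<le> (\<integral>x. h x \<partial>M)"
proof -
  define H where "H x = real_of_ereal (limsup (\<lambda>n. ereal (time_sum h n x / real n)))" for x
  have Bnn: "B \<ge> 0" using B not_empty by fastforce
  have ts: "\<bar>time_sum h n x / real n\<bar> \<le> B" if x: "x \<in> space M" for n x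
  proof (cases "n = 0")
    case False
    have "\<bar>time_sum h n x\<bar> \<le> (\<Sum>i<n. \<bar>h ((T ^^ i) x)\<bar>)" unfolding time_sum_def by (rule sum_abs)
    also have "\<dots> \<le> (\<Sum>i<n. B)" using B space_T[OF x] by (intro sum_mono) auto
    finally show ?thesis using False by (simp add: abs_divide field_simps)
  qed (use Bnn in simp)
  note lim = limsup_bounded[of "\<lambda>n. time_sum h n x / real n" B for x, folded H_def]
  have H_meas [measurable]: "H \<in> borel_measurable M" unfolding H_def by measurable
  have H_inv: "H (T x) = H x" if x: "x \<in> space M" for x
  proof -
    have "(\<lambda>n. time_sum h n (T x) / real n - time_sum h n x / real n) \<longlonglongrightarrow> 0"
    proof (rule tendsto_rabs_zero_cancel, rule tendsto_sandwich[OF _ _ tendsto_const])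
      show "(\<lambda>n. 2 * B / real n) \<longlonglongrightarrow> 0" by (rule lim_const_over_n)
      have "\<bar>time_sum h n (T x) / real n - time_sum h n x / real n\<bar> \<le> 2 * B / real n" for n
      proof -
        have "h x + time_sum h n (T x) = time_sum h n x + h ((T ^^ n) x)"
          using time_sum_Suc[of h n x] by (simp add: time_sum_def)
        then have "\<bar>time_sum h n (T x) - time_sum h n x\<bar> \<le> 2 * B"
          using B[OF x] B[OF space_T[OF x, of n]] by linarith
        then show ?thesis by (simp add: divide_right_mono flip: diff_divide_distrib)
      qed
      then show "\<forall>\<^sub>F n in sequentially. \<bar>time_sum h n (T x) / real n - time_sum h n x / real n\<bar> \<le> 2 * B / real n"
        by simp
    qed simp
    from limsup_eq_of_diff_tendsto_0[OF this] show ?thesis by (simp add: H_def)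
  qed
  have HB: "\<bar>H x\<bar> \<le> B" if "x \<in> space M" for x using lim(2)[OF ts[OF that]] .
  have int: "integrable M h" "integrable M H"
    by (rule integrable_bounded[of _ B]; use B HB in simp)+
  have "(\<integral>x. H x \<partial>M) \<le> (\<integral>x. h x \<partial>M) + \<epsilon>" if \<epsilon>: "\<epsilon> > 0" for \<epsilon>
  proof -
    have "0 \<le> (\<integral>x. h x - H x + \<epsilon> \<partial>M)"
    proof (rule maximal_ergodic[where B = "2 * B + \<epsilon>"])
      show "\<bar>h x - H x + \<epsilon>\<bar> \<le> 2 * B + \<epsilon>" if "x \<in> space M" for x
        using B[OF that] HB[OF that] \<epsilon> by linarith
      fix x assume x: "x \<in> space M"
      have HT: "H ((T ^^ i) x) = H x" for i
        by (induction i) (use H_inv space_T[OF x] in auto)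
      have ts_eq: "time_sum (\<lambda>x. h x - H x + \<epsilon>) k x = time_sum h k x - real k * (H x - \<epsilon>)" for k
        unfolding time_sum_def HT by (simp add: sum.distrib sum_subtractf algebra_simps)
      show "\<exists>k. time_sum (\<lambda>x. h x - H x + \<epsilon>) k x > 0"
      proof (rule ccontr)
        assume "\<not> ?thesis"
        then have le: "time_sum h k x \<le> real k * (H x - \<epsilon>)" for k unfolding ts_eq by (simp add: not_less)
        have "limsup (\<lambda>n. ereal (time_sum h n x / real n)) \<le> ereal (H x - \<epsilon>)"
        proof (rule Limsup_bounded, rule eventually_sequentiallyI[of 1])
          fix n :: nat assume "1 \<le> n"
          then show "ereal (time_sum h n x / real n) \<le> ereal (H x - \<epsilon>)"
            using le[of n] by (simp add: field_simps)
        qed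
        then show False using lim(1)[OF ts[OF x]] \<epsilon> by simp
      qed
    qed simp
    then show ?thesis using int prob_space by simp
  qed
  then have "(\<integral>x. H x \<partial>M) \<le> (\<integral>x. h x \<partial>M)" by (rule field_le_epsilon)
  then show ?thesis by (simp add: H_def)
qed

end


section \<open>The integral of the relative pressure\<close>

context one_block_factor
begin

lemma fibre_sum_quotient_bound:
  obtains C where "C \<ge> 0" "\<And>n y. y \<in> Y \<Longrightarrow> \<bar>ln (fibre_sum X \<pi> f n y) / real n\<bar> \<le> C"
    "\<And>n N y. y \<in> Y \<Longrightarrow> \<bar>ln (ext_sum n N y)\<bar> \<le> C * real n"
proof -
  obtain C where C: "C \<ge> 0"
    "\<And>n A. A \<subseteq> words n X \<Longrightarrow> A \<noteq> {} \<Longrightarrow> \<bar>ln (\<Sum>w\<in>A. cylinder_weight X f w)\<bar> \<le> C * real n"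
    by (rule sum_weight_bound) blast
  have fs: "\<bar>ln (fibre_sum X \<pi> f n y)\<bar> \<le> C * real n" if y: "y \<in> Y" for n y
    unfolding fibre_sum_def
    by (rule C(2)[OF order_trans[OF fibre_prefixes_subset fibre_words_subset] fibre_prefixes_nonempty[OF y]])
  show ?thesis
  proof (rule that[OF C(1)])
    fix n N y assume y: "y \<in> Y"
    show "\<bar>ln (fibre_sum X \<pi> f n y) / real n\<bar> \<le> C"
      using fs[OF y, of n] C(1) by (cases "n = 0") (simp_all add: abs_divide field_simps)
    show "\<bar>ln (ext_sum n N y)\<bar> \<le> C * real n"
      unfolding ext_sum_def by (rule C(2)[OF ext_words_subset]) (simp add: fibre_words_nonempty[OF y])
  qed
qed

lemma ext_sum_continuous: "continuous_on S (\<lambda>y. ln (ext_sum n N y))"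
  using continuous_on_prefix[of S "\<lambda>u. ln (\<Sum>w\<in>take n ` {w \<in> words (n + N) X. map \<Phi> w = u}. cylinder_weight X f w)" "n + N"]
  by (simp add: ext_sum_def fibre_words_def)

lemma ext_sum_tendsto: "y \<in> Y \<Longrightarrow> (\<lambda>N. ln (ext_sum n N y)) \<longlonglongrightarrow> ln (fibre_sum X \<pi> f n y)"
proof -
  assume "y \<in> Y"
  then obtain N0 where "\<And>N. N \<ge> N0 \<Longrightarrow> take n ` fibre_words X \<Phi> (n + N) y = fibre_prefixes X \<pi> n y"
    by (rule extendable_words[of y n]) blast
  then show ?thesis
    by (intro tendsto_eventually eventually_sequentiallyI[of N0]) (simp add: ext_sum_def fibre_sum_def)
qed

lemma measurable_fibre_sum: "(\<lambda>y. ln (fibre_sum X \<pi> f n y)) \<in> borel_measurable (restrict_space borel Y)"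
  by (rule borel_measurable_LIMSEQ_real[where u = "\<lambda>N y. ln (ext_sum n N y)"])
     (auto simp: space_restrict_space intro!: ext_sum_tendsto borel_measurable_continuous_on_restrict ext_sum_continuous)

text \<open>A version of the relative pressure whose measurability can be read off: the sums over continuable
  words are limits of functions of finitely many coordinates.\<close>

definition real_rel_pressure :: "point \<Rightarrow> real" where
  "real_rel_pressure y = real_of_ereal (limsup (\<lambda>n. ereal (ln (fibre_sum X \<pi> f n y) / real n)))"

lemma real_rel_pressure: "y \<in> Y \<Longrightarrow> real_of_ereal (rel_pressure X \<pi> f y) = real_rel_pressure y"
  by (simp add: rel_pressure_eq real_rel_pressure_def)

lemma measurable_rel_pressure: "real_rel_pressure \<in> borel_measurable (restrict_space borel Y)"
proof -
  note [measurable] = measurable_fibre_sum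
  show ?thesis unfolding real_rel_pressure_def by measurable
qed

text \<open>The block decomposition of the words over \<open>y\<close> is integrated: by invariance every block contributes the
  same, so that continuable words have on average at least the growth of all words.\<close>

lemma integral_fibre_sum_ge:
  assumes h: "continuous_on Y h" and m: "m \<in> invariant_measures Y"
    and sub: "sublinear Y (\<lambda>n y. ln (g_fun X \<Phi> f n y) - birkhoff_sum n h y)"
  shows "real n * (\<integral>y. h y \<partial>m) \<le> (\<integral>y. ln (fibre_sum X \<pi> f n y) \<partial>m)"
proof -
  interpret m: shift_measure Y m by unfold_locales (use m subshift_Y in auto)
  let ?I = "\<integral>y. h y \<partial>m"
  obtain C where C: "\<And>k n N y. y \<in> Y \<Longrightarrow> ln (g_fun X \<Phi> f (k * n + N) y) \<le>
       (\<Sum>j<k. ln (ext_sum n N ((shift ^^ (j * n)) y))) + C * real N"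
    by (rule ln_g_le_sum_ext) blast
  obtain B where B: "B \<ge> 0" "\<And>n N y. y \<in> Y \<Longrightarrow> \<bar>ln (ext_sum n N y)\<bar> \<le> B * real n"
    by (rule fibre_sum_quotient_bound) blast
  have int_e: "integrable m (\<lambda>y. ln (ext_sum n N y))" for N
    by (rule m.integrable_continuous[OF ext_sum_continuous])
  have ext: "real n * ?I \<le> (\<integral>y. ln (ext_sum n N y) \<partial>m)" for N
  proof (rule field_le_epsilon)
    fix e :: real assume "e > 0"
    \<comment> \<open>With \<open>Suc n\<close> in place of \<open>n\<close>, the case \<open>n = 0\<close> is included.\<close>
    define \<epsilon> where "\<epsilon> = e / real (Suc n)"
    have \<epsilon>: "\<epsilon> > 0" "real n * \<epsilon> \<le> e" using \<open>e > 0\<close> by (auto simp: \<epsilon>_def field_simps)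
    obtain D where D: "\<And>n y. y \<in> Y \<Longrightarrow> \<bar>ln (g_fun X \<Phi> f n y) - birkhoff_sum n h y\<bar> \<le> \<epsilon> * real n + D"
      using sublinearD[OF sub \<epsilon>(1)] by auto
    let ?E = "\<integral>y. ln (ext_sum n N y) \<partial>m"
    have "real k * (real n * ?I - real n * \<epsilon> - ?E) \<le> C * real N + \<epsilon> * real N + D - real N * ?I" for k
    proof -
      let ?M = "k * n + N"
      have sh: "integrable m (\<lambda>y. ln (ext_sum n N ((shift ^^ (j * n)) y)))" for j
        by (rule m.integrable_bounded[of _ "B * real n"])
           (use B(2) funpow_closed_Y m.measurable_continuous[OF ext_sum_continuous] in
             \<open>auto simp: m.space_eq intro: measurable_compose[OF m.funpow_T]\<close>)
      have "real ?M * ?I = (\<integral>y. birkhoff_sum ?M h y \<partial>m)" by (rule m.integral_birkhoff(1)[OF h, symmetric])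
      also have "\<dots> \<le> (\<integral>y. (\<Sum>j<k. ln (ext_sum n N ((shift ^^ (j * n)) y))) + (C * real N + \<epsilon> * real ?M + D) \<partial>m)"
      proof (rule integral_mono[OF m.integral_birkhoff(2)[OF h]])
        show "integrable m (\<lambda>y. (\<Sum>j<k. ln (ext_sum n N ((shift ^^ (j * n)) y))) + (C * real N + \<epsilon> * real ?M + D))"
          using sh by simp
        fix y assume "y \<in> space m"
        then have y: "y \<in> Y" by (simp add: m.space_eq)
        show "birkhoff_sum ?M h y \<le> (\<Sum>j<k. ln (ext_sum n N ((shift ^^ (j * n)) y))) + (C * real N + \<epsilon> * real ?M + D)"
          using C[OF y, of k n N] D[OF y, of ?M] by linarith
      qed
      also have "\<dots> = real k * ?E + (C * real N + \<epsilon> * real ?M + D)"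
        using sh m.integral_T[OF m.measurable_continuous[OF ext_sum_continuous]] m.prob_space
        by (simp add: Bochner_Integration.integral_sum)
      finally show ?thesis by (simp add: algebra_simps)
    qed
    then have "real n * ?I - real n * \<epsilon> - ?E \<le> 0" by (rule linear_bound_nonpos)
    then show "real n * ?I \<le> ?E + e" using \<epsilon>(2) by linarith
  qed
  have meas: "(\<lambda>y. ln (fibre_sum X \<pi> f n y)) \<in> borel_measurable m"
    unfolding measurable_cong_sets[OF m.sets_eq refl] by (rule measurable_fibre_sum)
  have "(\<lambda>N. \<integral>y. ln (ext_sum n N y) \<partial>m) \<longlonglongrightarrow> (\<integral>y. ln (fibre_sum X \<pi> f n y) \<partial>m)"
    by (rule integral_dominated_convergence[where w = "\<lambda>_. B * real n"])
       (use meas B m.measurable_continuous[OF ext_sum_continuous] ext_sum_tendsto in \<open>auto simp: m.space_eq intro!: AE_I2\<close>)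
  then show ?thesis by (rule LIMSEQ_le_const) (use ext in blast)
qed

text \<open>The lower bound follows from the preceding lemma by the reverse Fatou lemma. For the upper bound, the
  relative pressure is at most the upper rate of $g_n$, which here is the upper Birkhoff average of \<open>h\<close>.\<close>

lemma integral_rel_pressure:
  assumes h: "continuous_on Y h" and m: "m \<in> invariant_measures Y"
    and sub: "sublinear Y (\<lambda>n y. ln (g_fun X \<Phi> f n y) - birkhoff_sum n h y)"
  shows "(\<integral>y. real_of_ereal (rel_pressure X \<pi> f y) \<partial>m) = (\<integral>y. h y \<partial>m)"
proof -
  interpret m: shift_measure Y m by unfold_locales (use m subshift_Y in auto)
  interpret h: potential Y h by (rule potential_Y[OF h])
  obtain B where B: "B \<ge> 0" "\<And>n y. y \<in> Y \<Longrightarrow> \<bar>ln (fibre_sum X \<pi> f n y) / real n\<bar> \<le> B"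
    by (rule fibre_sum_quotient_bound) blast
  have meas: "(\<lambda>y. ln (fibre_sum X \<pi> f n y)) \<in> borel_measurable m" for n
    unfolding measurable_cong_sets[OF m.sets_eq refl] by (rule measurable_fibre_sum)
  have pm: "real_rel_pressure \<in> borel_measurable m"
    unfolding measurable_cong_sets[OF m.sets_eq refl] by (rule measurable_rel_pressure)
  have "(\<integral>y. h y \<partial>m) \<le> (\<integral>y. real_rel_pressure y \<partial>m)"
    unfolding real_rel_pressure_def
  proof (rule m.integral_limsup_ge[of _ B])
    fix n :: nat assume "n \<ge> 1"
    then show "(\<integral>y. h y \<partial>m) \<le> (\<integral>y. ln (fibre_sum X \<pi> f n y) / real n \<partial>m)"
      using integral_fibre_sum_ge[OF h m sub, of n] by (simp add: field_simps)
  qed (use B meas in \<open>auto simp: m.space_eq\<close>)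
  moreover have "(\<integral>y. real_rel_pressure y \<partial>m) \<le> (\<integral>y. h y \<partial>m)"
  proof -
    let ?H = "\<lambda>y. real_of_ereal (limsup (\<lambda>n. ereal (m.time_sum h n y / real n)))"
    have ts: "m.time_sum h n y = birkhoff_sum n h y" for n y by (simp add: m.time_sum_def birkhoff_sum_def)
    have tb: "\<bar>m.time_sum h n y / real n\<bar> \<le> h.norm_sup" if "y \<in> Y" for n y
      using h.birkhoff_abs[OF that, of n] h.norm_sup_nonneg
      by (cases "n = 0") (simp_all add: ts abs_divide field_simps)
    note [measurable] = m.measurable_continuous[OF h]
    have le: "real_rel_pressure y \<le> ?H y" if y: "y \<in> Y" for y
    proof -
      have "limsup (\<lambda>n. ereal (ln (fibre_sum X \<pi> f n y) / real n)) \<le> limsup (\<lambda>n. ereal (ln (g_fun X \<Phi> f n y) / real n))"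
      proof (intro Limsup_mono always_eventually allI)
        fix n
        have "ln (fibre_sum X \<pi> f n y) \<le> ln (g_fun X \<Phi> f n y)"
          using fibre_sum_le_g[of n y] fibre_sum_pos[OF y, of n] g_fun_pos[OF y, of n] by simp
        then show "ereal (ln (fibre_sum X \<pi> f n y) / real n) \<le> ereal (ln (g_fun X \<Phi> f n y) / real n)"
          by (simp add: divide_right_mono)
      qed
      also have "\<dots> = limsup (\<lambda>n. ereal (m.time_sum h n y / real n))"
        by (rule limsup_eq_of_diff_tendsto_0)
           (use sublinear_tendsto[OF sub y] in \<open>simp add: ts diff_divide_distrib\<close>)
      finally have "ereal (real_rel_pressure y) \<le> ereal (?H y)"
        using limsup_bounded(1)[OF B(2)[OF y]] limsup_bounded(1)[OF tb[OF y]] by (simp add: real_rel_pressure_def)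
      then show ?thesis by simp
    qed
    have Hm: "?H \<in> borel_measurable m" by measurable
    have "(\<integral>y. real_rel_pressure y \<partial>m) \<le> (\<integral>y. ?H y \<partial>m)"
    proof (rule integral_mono)
      show "integrable m real_rel_pressure"
        by (rule m.integrable_bounded[OF pm, of B])
           (use limsup_bounded(2)[OF B(2)] in \<open>simp add: real_rel_pressure_def m.space_eq\<close>)
      show "integrable m ?H"
        by (rule m.integrable_bounded[OF Hm, of h.norm_sup]) (use limsup_bounded(2)[OF tb] in \<open>simp add: m.space_eq\<close>)
    qed (use le in \<open>simp add: m.space_eq\<close>)
    also have "\<dots> \<le> (\<integral>y. h y \<partial>m)"
      by (rule m.integral_limsup_averages_le[of _ h.norm_sup]) (use h.abs_le_norm_sup in \<open>auto simp: m.space_eq\<close>)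
    finally show ?thesis .
  qed
  moreover have "(\<integral>y. real_of_ereal (rel_pressure X \<pi> f y) \<partial>m) = (\<integral>y. real_rel_pressure y \<partial>m)"
    by (rule Bochner_Integration.integral_cong) (simp_all add: m.space_eq real_rel_pressure)
  ultimately show ?thesis by linarith
qed

text \<open>For the invariant measure on a periodic orbit both integrals are averages along the orbit.\<close>

lemma fibre_rate_of_integrals:
  assumes h: "continuous_on Y h"
    and eq: "\<And>m. m \<in> invariant_measures Y \<Longrightarrow> (\<integral>y. real_of_ereal (rel_pressure X \<pi> f y) \<partial>m) = (\<integral>y. h y \<partial>m)"
    and y: "y \<in> Y" and q: "q \<ge> 1" "(shift ^^ q) y = y"
  shows "fibre_rate X \<Phi> f y = birkhoff_sum q h y / real q"
proof -
  interpret h: potential Y h by (rule potential_Y[OF h])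
  define \<kappa> where "\<kappa> = return (restrict_space borel Y) y"
  have ys: "y \<in> space (restrict_space borel Y)" using y by (simp add: space_restrict_space)
  have ps: "prob_space \<kappa>" unfolding \<kappa>_def by (rule prob_space_return[OF ys])
  have sk: "sets \<kappa> = sets (restrict_space borel Y)" by (simp add: \<kappa>_def)
  have mT: "(shift ^^ n) \<in> measurable \<kappa> \<kappa>" for n
  proof (induction n)
    case (Suc n)
    have "shift \<in> measurable \<kappa> \<kappa>"
      unfolding measurable_cong_sets[OF sk sk] by (rule measurable_shift_restrict[OF h.shift_closed])
    with Suc show ?case unfolding funpow.simps by (rule measurable_comp)
  qed (simp add: id_def)
  have inv: "distr \<kappa> \<kappa> (shift ^^ q) = \<kappa>"
  proof -
    have "distr \<kappa> \<kappa> (shift ^^ q) = distr \<kappa> (restrict_space borel Y) (shift ^^ q)"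
      by (rule distr_cong) (simp_all add: sk)
    also have "\<dots> = return (restrict_space borel Y) ((shift ^^ q) y)"
      unfolding \<kappa>_def using mT[of q] by (intro distr_return[OF _ ys]) (simp only: measurable_cong_sets[OF sk sk])
    finally show ?thesis by (simp add: q(2) \<kappa>_def)
  qed
  obtain m where m: "m \<in> invariant_measures Y" "\<And>u C. u \<in> borel_measurable \<kappa> \<Longrightarrow> (\<And>x. x \<in> Y \<Longrightarrow> \<bar>u x\<bar> \<le> C) \<Longrightarrow>
       (\<integral>x. u x \<partial>m) = (\<Sum>j<q. \<integral>x. u ((shift ^^ j) x) \<partial>\<kappa>) / real q"
    by (rule average_invariant[OF subshift_Y ps sk q(1) inv]) blast
  interpret m: shift_measure Y m by unfold_locales (use m(1) subshift_Y in auto)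
  have int: "(\<integral>x. u x \<partial>m) = (\<Sum>j<q. u ((shift ^^ j) y)) / real q"
    if u: "u \<in> borel_measurable \<kappa>" "\<And>x. x \<in> Y \<Longrightarrow> \<bar>u x\<bar> \<le> C" for u :: "point \<Rightarrow> real" and C
  proof -
    have "(\<integral>x. u ((shift ^^ j) x) \<partial>\<kappa>) = u ((shift ^^ j) y)" for j
      using measurable_compose[OF mT u(1), of j] ys
      unfolding \<kappa>_def by (intro integral_return) (simp_all cong: measurable_cong_sets)
    then show ?thesis using m(2)[OF u] by simp
  qed
  obtain B where B: "B \<ge> 0" "\<And>n y. y \<in> Y \<Longrightarrow> \<bar>ln (fibre_sum X \<pi> f n y) / real n\<bar> \<le> B"
    by (rule fibre_sum_quotient_bound) blast
  have pk: "real_rel_pressure \<in> borel_measurable \<kappa>" and hk: "h \<in> borel_measurable \<kappa>"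
    unfolding measurable_cong_sets[OF sk refl]
    by (rule measurable_rel_pressure borel_measurable_continuous_on_restrict[OF h])+
  have "(\<integral>y. real_of_ereal (rel_pressure X \<pi> f y) \<partial>m) = (\<integral>y. real_rel_pressure y \<partial>m)"
    by (rule Bochner_Integration.integral_cong) (simp_all add: m.space_eq real_rel_pressure)
  also have "\<dots> = (\<Sum>j<q. real_rel_pressure ((shift ^^ j) y)) / real q"
    by (rule int[OF pk, of B]) (use limsup_bounded(2)[OF B(2)] in \<open>simp add: real_rel_pressure_def\<close>)
  also have "\<dots> = (\<Sum>j<q. fibre_rate X \<Phi> f y) / real q"
  proof -
    have "real_rel_pressure ((shift ^^ j) y) = fibre_rate X \<Phi> f y" for j
    proof -
      have "(shift ^^ q) ((shift ^^ j) y) = (shift ^^ j) y" using q(2) by (simp add: funpow_shift_commute[of q])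
      then have "rel_pressure X \<pi> f ((shift ^^ j) y) = ereal (fibre_rate X \<Phi> f ((shift ^^ j) y))"
        by (rule rel_pressure_periodic[OF funpow_closed_Y[OF y] q(1)])
      then show ?thesis
        using real_rel_pressure[OF funpow_closed_Y[OF y], of j] fibre_rate_orbit[OF y q] by simp
    qed
    then show ?thesis by simp
  qed
  also have "\<dots> = fibre_rate X \<Phi> f y" using q(1) by simp
  finally have "fibre_rate X \<Phi> f y = (\<integral>y. h y \<partial>m)" using eq[OF m(1)] by simp
  also have "\<dots> = (\<Sum>j<q. h ((shift ^^ j) y)) / real q"
    by (rule int[OF hk h.abs_le_norm_sup])
  finally show ?thesis by (simp add: birkhoff_sum_def)
qed

end

section \<open>The equivalence\<close>

lemma sup_norm_bound:
  assumes "\<And>y. y \<in> Y \<Longrightarrow> \<bar>u y\<bar> \<le> B" "0 \<le> B"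
  obtains s where "sup_norm Y u = ereal s" "0 \<le> s" "s \<le> B" "\<And>y. y \<in> Y \<Longrightarrow> \<bar>u y\<bar> \<le> s"
proof -
  have le: "sup_norm Y u \<le> ereal B" unfolding sup_norm_def using assms by (intro Sup_least) auto
  have ge: "0 \<le> sup_norm Y u" unfolding sup_norm_def by (rule Sup_upper) simp
  obtain s where s: "sup_norm Y u = ereal s" using le ge by (cases "sup_norm Y u") auto
  have "ereal \<bar>u y\<bar> \<le> sup_norm Y u" if "y \<in> Y" for y
    unfolding sup_norm_def using that by (intro Sup_upper) simp
  then show ?thesis using that[OF s] le ge unfolding s by simp
qed

lemma sup_norm_cong: "(\<And>y. y \<in> Y \<Longrightarrow> u y = v y) \<Longrightarrow> sup_norm Y u = sup_norm Y v"
  unfolding sup_norm_def by (metis (no_types, lifting) image_cong)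

lemma sublinear_imp_sup_norm_tendsto:
  assumes "sublinear Y u"
  shows "(\<lambda>n. ereal (1 / real n) * sup_norm Y (u n)) \<longlonglongrightarrow> 0"
proof -
  obtain C where C: "C \<ge> 0" "\<And>n y. y \<in> Y \<Longrightarrow> \<bar>u n y\<bar> \<le> 1 * real n + C"
    using sublinearD[OF assms, of 1] by auto
  have "\<exists>s. sup_norm Y (u n) = ereal s" for n
    by (rule sup_norm_bound[of Y "u n" "1 * real n + C"]) (use C in auto)
  then obtain s where s: "\<And>n. sup_norm Y (u n) = ereal (s n)" by metis
  have "sublinear {()} (\<lambda>n _. s n)"
    unfolding sublinear_def
  proof (intro allI impI)
    fix \<epsilon> :: real assume e: "\<epsilon> > 0"
    from sublinearD[OF assms e] obtain D where
      D: "D \<ge> 0" "\<And>n y. y \<in> Y \<Longrightarrow> \<bar>u n y\<bar> \<le> \<epsilon> * real n + D" by auto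
    have "\<bar>s n\<bar> \<le> \<epsilon> * real n + D" for n
      by (rule sup_norm_bound[of Y "u n" "\<epsilon> * real n + D"]) (use D e s in auto)
    with D(1) show "\<exists>C\<ge>0. \<forall>n. \<forall>t\<in>{()}. \<bar>s n\<bar> \<le> \<epsilon> * real n + C" by blast
  qed
  then have "(\<lambda>n. s n / real n) \<longlonglongrightarrow> 0" by (rule sublinear_tendsto) simp
  then have "(\<lambda>n. ereal (s n / real n)) \<longlonglongrightarrow> ereal 0" by simp
  then show ?thesis unfolding s by (simp add: zero_ereal_def)
qed

lemma tendsto_of_sup_norm:
  assumes lim: "(\<lambda>n. ereal (1 / real n) * sup_norm Y (u n)) \<longlonglongrightarrow> 0"
    and bound: "\<And>n y. y \<in> Y \<Longrightarrow> \<bar>u n y\<bar> \<le> B n" "\<And>n. 0 \<le> B n" and y: "y \<in> Y"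
  shows "(\<lambda>n. u n y / real n) \<longlonglongrightarrow> 0"
proof -
  have "\<exists>s. sup_norm Y (u n) = ereal s \<and> \<bar>u n y\<bar> \<le> s" for n
    by (rule sup_norm_bound[of Y "u n" "B n"]) (use bound y in auto)
  then obtain s where s: "\<And>n. sup_norm Y (u n) = ereal (s n)" "\<And>n. \<bar>u n y\<bar> \<le> s n" by metis
  have "(\<lambda>n. ereal (s n / real n)) \<longlonglongrightarrow> ereal 0" using lim unfolding s(1) by (simp add: zero_ereal_def)
  then have "(\<lambda>n. s n / real n) \<longlonglongrightarrow> 0" by simp
  then show ?thesis
  proof (rule Lim_null_comparison[rotated], intro always_eventually allI)
    show "norm (u n y / real n) \<le> s n / real n" for n
      using s(2)[of n] by (simp add: abs_divide divide_right_mono)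
  qed
qed

lemma invariant_measures_empty: "invariant_measures {} = {}"
proof -
  have False if "\<mu> \<in> invariant_measures {}" for \<mu>
  proof -
    have "space \<mu> = {}" using that sets_eq_imp_space_eq[of \<mu> "restrict_space borel {}"]
      by (simp add: invariant_measures_def space_restrict_space)
    moreover have "prob_space \<mu>" using that by (simp add: invariant_measures_def)
    ultimately show False using prob_space.not_empty by blast
  qed
  then show ?thesis by blast
qed

theorem theorem6p2:
  fixes X Y :: "(nat \<Rightarrow> nat) set"
    and \<pi> :: "(nat \<Rightarrow> nat) \<Rightarrow> (nat \<Rightarrow> nat)"
    and \<Phi> :: "nat \<Rightarrow> nat"
    and f h :: "(nat \<Rightarrow> nat) \<Rightarrow> real"
  assumes "one_step_SFT X" and "irreducible_shift X"
    and "subshift Y"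
    and "factor_map X Y \<pi>" and "one_block X \<pi> \<Phi>"
    and "continuous_on X f" and "continuous_on Y h"
  shows
    "let g = g_fun X \<Phi> f;
         i_pressure = (\<forall>y\<in>Y. periodic y \<longrightarrow> rel_pressure X \<pi> (\<lambda>x. f x - h (\<pi> x)) y = 0);
         i_limit = (\<forall>y\<in>Y. periodic y \<longrightarrow>
           (\<lambda>n. ln (g n y / exp (birkhoff_sum n h y)) / real n) \<longlonglongrightarrow> 0);
         ii = compensation_function X Y \<pi> (\<lambda>x. f x - h (\<pi> x));
         iii = (\<forall>y\<in>Y. (\<lambda>n. ln (g n y / exp (birkhoff_sum n h y)) / real n) \<longlonglongrightarrow> 0);
         iv = (log_asymptotically_additive Y g \<and>
           (\<lambda>n. ereal (1 / real n) *
             sup_norm Y (\<lambda>y. ln (g n y / exp (birkhoff_sum n h y)))) \<longlonglongrightarrow> 0);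
         v = (\<forall>m\<in>invariant_measures Y.
           (\<integral>y. real_of_ereal (rel_pressure X \<pi> f y) \<partial>m) = (\<integral>y. h y \<partial>m))
     in (i_pressure \<longleftrightarrow> i_limit) \<and> (i_limit \<longleftrightarrow> ii) \<and> (ii \<longleftrightarrow> iii) \<and> (iii \<longleftrightarrow> iv) \<and> (iv \<longleftrightarrow> v)"
proof (cases "X = {}")
  case True
  \<comment> \<open>Without points there are no periodic points and no measures, and all suprema are over empty sets.\<close>
  then have Y: "Y = {}" using assms(4) by (auto simp: factor_map_def)
  have "sup_norm {} u = 0" for u :: "point \<Rightarrow> real" by (simp add: sup_norm_def)
  then show ?thesis
    unfolding True Y
    by (simp add: compensation_function_def invariant_measures_empty log_asymptotically_additive_def Limsup_const zero_ereal_def)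
next
  case False
  define \<psi> where "\<psi> = (\<lambda>x. f x - h (\<pi> x))"
  have subshift: "subshift X" by (rule one_step_SFT_transitions(1)[OF assms(1)])
  interpret F: sft_factor X f Y \<pi> \<Phi>
    by unfold_locales (use assms subshift False in auto)
  have minus_h: "continuous_on Y (\<lambda>y. - h y)" using assms(7) by (rule continuous_on_minus)
  have \<psi>: "\<psi> = (\<lambda>x. f x + - h (\<pi> x))" by (simp add: \<psi>_def)
  have "continuous_on X \<psi>" unfolding \<psi> by (rule F.potential_lift[OF minus_h])
  then interpret P: sft_factor X \<psi> Y \<pi> \<Phi>
    by unfold_locales (use assms subshift False in auto)
  define a where "a n y = ln (g_fun X \<Phi> f n y / exp (birkhoff_sum n h y))" for n y
  define b where "b n y = ln (g_fun X \<Phi> \<psi> n y)" for n y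
  have a: "a n y = ln (g_fun X \<Phi> f n y) - birkhoff_sum n h y" if "y \<in> Y" for n y
    unfolding a_def using F.g_fun_pos[OF that, of n] by (simp add: ln_div)
  have near: "sublinear Y (\<lambda>n y. b n y - a n y)"
  proof (rule sublinear_bounded_by[OF F.ln_g_lift[OF minus_h]])
    fix n y assume y: "y \<in> Y"
    have "birkhoff_sum n (\<lambda>y. - h y) y = - birkhoff_sum n h y" by (simp add: birkhoff_sum_def sum_negf)
    then have "\<bar>b n y - a n y\<bar> \<le> \<bar>ln (g_fun X \<Phi> (\<lambda>x. f x + - h (\<pi> x)) n y) -
        (ln (g_fun X \<Phi> f n y) + birkhoff_sum n (\<lambda>y. - h y) y)\<bar>"
      unfolding b_def \<psi> a[OF y] by simp
    with y show "\<exists>t\<in>Y. \<bar>b n y - a n y\<bar> \<le> \<bar>ln (g_fun X \<Phi> (\<lambda>x. f x + - h (\<pi> x)) n t) -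
        (ln (g_fun X \<Phi> f n t) + birkhoff_sum n (\<lambda>y. - h y) t)\<bar>" by blast
  qed
  have lim_iff: "(\<lambda>n. a n y / real n) \<longlonglongrightarrow> 0 \<longleftrightarrow> (\<lambda>n. b n y / real n) \<longlonglongrightarrow> 0" if y: "y \<in> Y" for y
    using Lim_transform_eq[of "\<lambda>n. b n y / real n" "\<lambda>n. a n y / real n" sequentially 0]
      sublinear_tendsto[OF near y] by (simp add: diff_divide_distrib)
  have sub_iff: "sublinear Y a \<longleftrightarrow> sublinear Y b"
  proof
    assume s: "sublinear Y a"
    show "sublinear Y b"
      by (rule sublinear_sum_bound[OF near s, where w = b]) (smt (verit, best))
  next
    assume s: "sublinear Y b"
    show "sublinear Y a"
      by (rule sublinear_sum_bound[OF near s, where w = a]) (smt (verit, best))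
  qed
  have rate: "(\<lambda>n. b n y / real n) \<longlonglongrightarrow> fibre_rate X \<Phi> \<psi> y" "rel_pressure X \<pi> \<psi> y = ereal (fibre_rate X \<Phi> \<psi> y)"
    if "y \<in> Y" "periodic y" for y
  proof -
    obtain q where q: "q \<ge> 1" "(shift ^^ q) y = y" using \<open>periodic y\<close> unfolding periodic_def by blast
    show "(\<lambda>n. b n y / real n) \<longlonglongrightarrow> fibre_rate X \<Phi> \<psi> y"
      unfolding b_def by (rule P.periodic_rate(1)[OF \<open>y \<in> Y\<close> q])
    show "rel_pressure X \<pi> \<psi> y = ereal (fibre_rate X \<Phi> \<psi> y)"
      by (rule P.rel_pressure_periodic[OF \<open>y \<in> Y\<close> q])
  qed
  \<comment> \<open>All conditions are compared with the second form of (i).\<close>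
  define Per where "Per \<longleftrightarrow> (\<forall>y\<in>Y. periodic y \<longrightarrow> (\<lambda>n. a n y / real n) \<longlonglongrightarrow> 0)"
  have Per_rate: "Per \<longleftrightarrow> (\<forall>y\<in>Y. periodic y \<longrightarrow> fibre_rate X \<Phi> \<psi> y = 0)"
    unfolding Per_def using lim_iff rate(1) LIMSEQ_unique by metis
  have i: "(\<forall>y\<in>Y. periodic y \<longrightarrow> rel_pressure X \<pi> \<psi> y = 0) \<longleftrightarrow> Per"
    unfolding Per_rate using rate(2) by simp
  have Per_sub: "sublinear Y a" if "Per"
    unfolding sub_iff b_def
    by (rule P.sublinear_of_periodic) (use that lim_iff in \<open>auto simp: Per_def b_def\<close>)
  have sub_iii: "\<forall>y\<in>Y. (\<lambda>n. a n y / real n) \<longlonglongrightarrow> 0" if "sublinear Y a"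
    using sublinear_tendsto[OF that] by blast
  have iii: "(\<forall>y\<in>Y. (\<lambda>n. a n y / real n) \<longlonglongrightarrow> 0) \<longleftrightarrow> Per"
    using Per_sub sub_iii by (auto simp: Per_def)
  have ii: "compensation_function X Y \<pi> \<psi> \<longleftrightarrow> Per"
  proof
    assume "compensation_function X Y \<pi> \<psi>"
    then have eq: "pressure X (\<lambda>x. \<psi> x + \<phi> (\<pi> x)) = pressure Y \<phi>" if "continuous_on Y \<phi>" for \<phi>
      using that P.compensation_iff by blast
    show Per
      unfolding Per_rate periodic_def using P.rate_zero_of_pressures[OF eq] by blast
  next
    assume Per
    then have "sublinear Y (\<lambda>n y. ln (g_fun X \<Phi> \<psi> n y))" using Per_sub sub_iff by (simp add: b_def[abs_def])
    then show "compensation_function X Y \<pi> \<psi>"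
      unfolding P.compensation_iff using P.pressure_lift_eq by blast
  qed
  have iv: "log_asymptotically_additive Y (g_fun X \<Phi> f) \<and>
      (\<lambda>n. ereal (1 / real n) * sup_norm Y (a n)) \<longlonglongrightarrow> 0 \<longleftrightarrow> Per"
  proof
    assume "log_asymptotically_additive Y (g_fun X \<Phi> f) \<and>
      (\<lambda>n. ereal (1 / real n) * sup_norm Y (a n)) \<longlonglongrightarrow> 0"
    then have lim: "(\<lambda>n. ereal (1 / real n) * sup_norm Y (a n)) \<longlonglongrightarrow> 0" ..
    interpret h: potential Y h by (rule F.potential_Y[OF assms(7)])
    obtain C where C: "C \<ge> 0" "\<And>n y. y \<in> Y \<Longrightarrow> \<bar>ln (g_fun X \<Phi> f n y)\<bar> \<le> C * real n"
      by (rule F.ln_g_bound) blast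
    have "\<bar>a n y\<bar> \<le> C * real n + real n * h.norm_sup" if "y \<in> Y" for n y
      unfolding a[OF that] using C(2)[OF that, of n] h.birkhoff_abs[OF that, of n] by linarith
    then have "\<forall>y\<in>Y. (\<lambda>n. a n y / real n) \<longlonglongrightarrow> 0"
      using tendsto_of_sup_norm[OF lim, of "\<lambda>n. C * real n + real n * h.norm_sup"] C(1) h.norm_sup_nonneg by simp
    then show Per using iii by blast
  next
    assume Per
    then have lim: "(\<lambda>n. ereal (1 / real n) * sup_norm Y (a n)) \<longlonglongrightarrow> 0"
      by (intro sublinear_imp_sup_norm_tendsto Per_sub)
    have "sup_norm Y (\<lambda>y. ln (g_fun X \<Phi> f n y) - birkhoff_sum n h y) = sup_norm Y (a n)" for n
      by (rule sup_norm_cong) (simp add: a)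
    then have "limsup (\<lambda>n. ereal (1 / real n) * sup_norm Y (\<lambda>y. ln (g_fun X \<Phi> f n y) - birkhoff_sum n h y)) = 0"
      using lim_imp_Limsup[OF _ lim] by simp
    moreover have "continuous_on Y (g_fun X \<Phi> f n)" for n
      using continuous_on_prefix[of Y "\<lambda>u. \<Sum>w\<in>{w \<in> words n X. map \<Phi> w = u}. cylinder_weight X f w" n]
      by (simp add: F.g_fun_prefix cong: continuous_on_cong)
    ultimately have "log_asymptotically_additive Y (g_fun X \<Phi> f)"
      unfolding log_asymptotically_additive_def using F.g_fun_pos assms(7)
      by (auto intro!: exI[of _ h])
    with lim show "log_asymptotically_additive Y (g_fun X \<Phi> f) \<and>
      (\<lambda>n. ereal (1 / real n) * sup_norm Y (a n)) \<longlonglongrightarrow> 0" by blast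
  qed
  have v: "(\<forall>m\<in>invariant_measures Y. (\<integral>y. real_of_ereal (rel_pressure X \<pi> f y) \<partial>m) = (\<integral>y. h y \<partial>m)) \<longleftrightarrow> Per"
  proof
    assume Per
    then have "sublinear Y (\<lambda>n y. ln (g_fun X \<Phi> f n y) - birkhoff_sum n h y)"
      by (intro sublinear_bounded_by[OF Per_sub]) (auto simp: a)
    then show "\<forall>m\<in>invariant_measures Y. (\<integral>y. real_of_ereal (rel_pressure X \<pi> f y) \<partial>m) = (\<integral>y. h y \<partial>m)"
      using F.integral_rel_pressure[OF assms(7)] by blast
  next
    assume eq: "\<forall>m\<in>invariant_measures Y. (\<integral>y. real_of_ereal (rel_pressure X \<pi> f y) \<partial>m) = (\<integral>y. h y \<partial>m)"
    have "fibre_rate X \<Phi> \<psi> y = 0" if y: "y \<in> Y" "periodic y" for y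
    proof -
      obtain q where q: "q \<ge> 1" "(shift ^^ q) y = y" using y(2) unfolding periodic_def by blast
      \<comment> \<open>Along multiples of the period the Birkhoff averages of \<open>h\<close> are constant.\<close>
      define r where "r j = Suc j * q" for j
      have r: "strict_mono r" unfolding r_def by (rule strict_monoI) (use q(1) in auto)
      have "birkhoff_sum (r j) h y / real (r j) = birkhoff_sum q h y / real q" for j
      proof -
        have "real (Suc j) \<noteq> 0" by simp
        then show ?thesis
          unfolding r_def birkhoff_sum_mult funpow_mult_fix[OF q(2)] of_nat_mult by (simp del: of_nat_Suc)
      qed
      then have f_rate: "fibre_rate X \<Phi> f y = birkhoff_sum (r j) h y / real (r j)" for j
        using F.fibre_rate_of_integrals[OF assms(7) _ y(1) q] eq by simp
      have "(\<lambda>j. ln (g_fun X \<Phi> f (r j) y) / real (r j) - fibre_rate X \<Phi> f y) \<longlonglongrightarrow> 0"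
        using LIMSEQ_subseq_LIMSEQ[OF F.periodic_rate(1)[OF y(1) q] r]
        by (simp add: comp_def LIM_zero)
      then have "(\<lambda>j. a (r j) y / real (r j)) \<longlonglongrightarrow> 0"
        unfolding a[OF y(1)] diff_divide_distrib f_rate[symmetric] .
      moreover have "(\<lambda>j. (b (r j) y - a (r j) y) / real (r j)) \<longlonglongrightarrow> 0"
        using LIMSEQ_subseq_LIMSEQ[OF sublinear_tendsto[OF near y(1)] r] by (simp add: comp_def)
      ultimately have "(\<lambda>j. (b (r j) y - a (r j) y) / real (r j) + a (r j) y / real (r j)) \<longlonglongrightarrow> 0 + 0"
        by (intro tendsto_add)
      then have "(\<lambda>j. b (r j) y / real (r j)) \<longlonglongrightarrow> 0" by (simp flip: add_divide_distrib)
      moreover have "(\<lambda>j. b (r j) y / real (r j)) \<longlonglongrightarrow> fibre_rate X \<Phi> \<psi> y"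
        using LIMSEQ_subseq_LIMSEQ[OF rate(1)[OF y] r] by (simp add: comp_def)
      ultimately show ?thesis by (rule LIMSEQ_unique[symmetric])
    qed
    then show Per unfolding Per_rate by blast
  qed
  show ?thesis
    using i ii iii iv v unfolding Let_def Per_def a_def[abs_def] \<psi>_def by blast
qed

end
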